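(* Let $d\ge 3$ and let $C=(C_{i_1,\ldots,i_d})_{i_1,\ldots,i_d\in[n]}$ be an array of independent $\mathrm{Exp}(1)$ random variables. Let $Z_A^{(d)}$ be the minimum of $\sum_{i_1,\ldots,i_d}X_{i_1,\ldots,i_d}C_{i_1,\ldots,i_d}$ over all $0/1$ arrays $X$ such that for every line of the array (i.e. fixing any $d-1$ of the coordinates and letting the remaining one range over $[n]$) exactly one entry of $X$ on that line equals $1$. Then: (a) $Z_A^{(d)}=\Omega(n^{d-2})$ with probability tending to $1$ as $n\to\infty$, for every $d\ge3$; (b) for $d=3$ there is a polynomial-time algorithm that finds a feasible such $X$ (a 3-dimensional Axial assignment) whose cost $Z$ satisfies $Z=O(n\log n)$ with probability tending to $1$ as $n\to\infty$.
   Context: This is the random $d$-dimensional Axial assignment problem. For $d=3$, a feasible $X$ corresponds to a set of triples $\{(i,j,k)\}$ such that for each pair of coordinate positions and each pair of values in those positions there is exactly one chosen triple; equivalently, a decomposition of $K_{n,n}$ into $n$ perfect matchings $M_1,\ldots,M_n$, with triple $(i,j,k)$ chosen iff $(j,k)\in M_i$. *)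

theory Defs
  imports "HOL-Probability.Probability" "HOL-Computational_Algebra.Polynomial"
begin

section \<open>Axial assignments\<close>

text \<open>
  Coordinates range over \<open>{..<n}\<close>; a position of a \<open>d\<close>-dimensional array is a list of length \<open>d\<close>.
\<close>

definition positions :: "nat \<Rightarrow> nat \<Rightarrow> nat list set" where
  "positions d n = {ix. length ix = d \<and> set ix \<subseteq> {..<n}}"

text \<open>
  The line through the position \<open>ix\<close> in direction \<open>p\<close> consists of the positions \<open>ix[p := v]\<close>
  for \<open>v < n\<close>. The values of \<open>X\<close> outside \<open>positions d n\<close> are irrelevant.
\<close>

definition axial_assignment :: "nat \<Rightarrow> nat \<Rightarrow> (nat list \<Rightarrow> nat) \<Rightarrow> bool" where
  "axial_assignment d n X \<longleftrightarrow>
     (\<forall>ix\<in>positions d n. X ix \<in> {0, 1}) \<and>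
     (\<forall>ix\<in>positions d n. \<forall>p<d. \<exists>!v. v < n \<and> X (ix[p := v]) = 1)"

definition assignment_cost :: "nat \<Rightarrow> nat \<Rightarrow> (nat list \<Rightarrow> real) \<Rightarrow> (nat list \<Rightarrow> nat) \<Rightarrow> real" where
  "assignment_cost d n C X = (\<Sum>ix\<in>positions d n. real (X ix) * C ix)"

definition axial_min :: "nat \<Rightarrow> nat \<Rightarrow> (nat list \<Rightarrow> real) \<Rightarrow> real" where
  "axial_min d n C = Min {assignment_cost d n C X | X. axial_assignment d n X}"

lemma finite_positions: "finite (positions d n)"
proof -
  have "positions d n = {xs. set xs \<subseteq> {..<n} \<and> length xs = d}"
    by (auto simp: positions_def)
  then show ?thesis
    using finite_lists_length_eq[of "{..<n}" d] by simp
qed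

lemma finite_axial_costs: "finite {assignment_cost d n C X | X. axial_assignment d n X}"
proof (rule finite_subset)
  show "finite (assignment_cost d n C ` (positions d n \<rightarrow>\<^sub>E {0, 1}))"
    by (intro finite_imageI finite_PiE finite_positions) auto
  show "{assignment_cost d n C X | X. axial_assignment d n X}
          \<subseteq> assignment_cost d n C ` (positions d n \<rightarrow>\<^sub>E {0, 1})"
  proof (clarify, rule image_eqI)
    fix X assume "axial_assignment d n X"
    then show "restrict X (positions d n) \<in> positions d n \<rightarrow>\<^sub>E {0, 1}"
      by (auto simp: axial_assignment_def)
    show "assignment_cost d n C X = assignment_cost d n C (restrict X (positions d n))"
      by (simp add: assignment_cost_def)
  qed
qed

lemma axial_assignment_exists: "\<exists>X. axial_assignment d n X"
proof -
  define X where "X = (\<lambda>ix. if sum_list ix mod n = 0 then 1 else 0 :: nat)"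
  have "\<exists>!v. v < n \<and> X (ix[p := v]) = 1" if is_in: "ix \<in> positions d n" and "p < d" for ix p
  proof -
    have p: "p < length ix" "ix ! p < n"
      using that nth_mem[of p ix] by (force simp: positions_def)+
    then have n: "n > 0" by simp
    define s where "s = sum_list ix - ix ! p"
    have sum: "sum_list (ix[p := v]) = s + v" for v
      using p elem_le_sum_list[of p ix] by (simp add: sum_list_update s_def)
    define w where "w = (n - s mod n) mod n"
    have w0: "(s + w) mod n = 0"
    proof -
      have "(s + w) mod n = (s mod n + (n - s mod n)) mod n"
        unfolding w_def by (simp add: mod_simps)
      also have "\<dots> = 0"
        using mod_less_divisor[OF n, of s] by simp
      finally show ?thesis .
    qed
    show ?thesis
    proof (rule ex1I[of _ w])
      show "w < n \<and> X (ix[p := w]) = 1"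
        using w0 n by (simp add: X_def sum w_def)
    next
      fix v assume v: "v < n \<and> X (ix[p := v]) = 1"
      then have "(s + v) mod n = 0"
        by (auto simp: X_def sum split: if_splits)
      moreover have "(w + s) mod n = 0"
        using w0 by (simp add: add.commute)
      ultimately have "(w + s + v) mod n = w mod n" "(w + s + v) mod n = v mod n"
        by (metis add.assoc add_0_right mod_add_right_eq, metis add_0_left mod_add_left_eq)
      then have "v mod n = w mod n"
        by simp
      then show "v = w"
        using v p by (simp add: w_def)
    qed
  qed
  then have "axial_assignment d n X"
    by (auto simp: axial_assignment_def X_def)
  then show ?thesis by blast
qed

lemma axial_min_attained:
  obtains X where "axial_assignment d n X" "axial_min d n C = assignment_cost d n C X"
proof -
  have "axial_min d n C \<in> {assignment_cost d n C X | X. axial_assignment d n X}"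
    unfolding axial_min_def
    by (rule Min_in[OF finite_axial_costs]) (use axial_assignment_exists in auto)
  then show ?thesis using that by auto
qed

lemma axial_min_le: "axial_assignment d n X \<Longrightarrow> axial_min d n C \<le> assignment_cost d n C X"
  unfolding axial_min_def by (rule Min_le[OF finite_axial_costs]) auto

text \<open>The joint law of an array of independent \<open>Exp(1)\<close> random variables.\<close>

definition exp_array :: "nat \<Rightarrow> nat \<Rightarrow> (nat list \<Rightarrow> real) measure" where
  "exp_array d n = Pi\<^sub>M (positions d n) (\<lambda>_. density lborel (exponential_density 1))"


section \<open>Polynomial time on real inputs\<close>

text \<open>
  Programs run in the unit-cost model over the reals: a real number is a single memory cell, and
  the operations on reals are addition, subtraction and comparison. There is no passage from reals
  to naturals other than branching, real constants are integers, and naturals have no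
  multiplication, so that after \<open>t\<close> steps every natural has \<open>O(t + log n)\<close> bits. Hence neither unit-cost
  arithmetic nor the constants of a program provide more than a polynomial amount of work.

  Storage consists of multidimensional arrays of naturals and of reals; a scalar is an array entry
  with the empty list of indices. The cost of evaluating an expression is bounded by a constant
  that depends on the program only, so every assignment and every test is charged one step.
\<close>

type_synonym vname = string

datatype nexp =
    NConst nat
  | NVar vname "nexp list"
  | NAdd nexp nexp
  | NSub nexp nexp

datatype rexp =
    RConst int
  | RVar vname "nexp list"
  | RAdd rexp rexp
  | RSub rexp rexp

datatype bexp =
    NLess nexp nexp
  | RLess rexp rexp
  | BNot bexp
  | BAnd bexp bexp

datatype com =
    Skip
  | NAssign vname "nexp list" nexp
  | RAssign vname "nexp list" rexp
  | Seq com com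
  | Cond bexp com com
  | While bexp com

record store =
  nats :: "vname \<Rightarrow> nat list \<Rightarrow> nat"
  reals :: "vname \<Rightarrow> nat list \<Rightarrow> real"

primrec nval :: "nexp \<Rightarrow> store \<Rightarrow> nat" where
  "nval (NConst k) s = k"
| "nval (NVar x es) s = nats s x (map (\<lambda>e. nval e s) es)"
| "nval (NAdd a b) s = nval a s + nval b s"
| "nval (NSub a b) s = nval a s - nval b s"

primrec rval :: "rexp \<Rightarrow> store \<Rightarrow> real" where
  "rval (RConst k) s = of_int k"
| "rval (RVar x es) s = reals s x (map (\<lambda>e. nval e s) es)"
| "rval (RAdd a b) s = rval a s + rval b s"
| "rval (RSub a b) s = rval a s - rval b s"

primrec bval :: "bexp \<Rightarrow> store \<Rightarrow> bool" where
  "bval (NLess a b) s \<longleftrightarrow> nval a s < nval b s"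
| "bval (RLess a b) s \<longleftrightarrow> rval a s < rval b s"
| "bval (BNot b) s \<longleftrightarrow> \<not> bval b s"
| "bval (BAnd a b) s \<longleftrightarrow> bval a s \<and> bval b s"

definition upd :: "(vname \<Rightarrow> nat list \<Rightarrow> 'v) \<Rightarrow> vname \<Rightarrow> nat list \<Rightarrow> 'v \<Rightarrow> vname \<Rightarrow> nat list \<Rightarrow> 'v" where
  "upd m x ix v = m(x := (m x)(ix := v))"

text \<open>\<open>exec c s t s'\<close>: started in \<open>s\<close>, the program \<open>c\<close> halts in \<open>s'\<close> after \<open>t\<close> steps.\<close>

inductive exec :: "com \<Rightarrow> store \<Rightarrow> nat \<Rightarrow> store \<Rightarrow> bool" where
  Skip: "exec Skip s 1 s"
| NAssign: "exec (NAssign x es e) s 1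
     (s\<lparr>nats := upd (nats s) x (map (\<lambda>e. nval e s) es) (nval e s)\<rparr>)"
| RAssign: "exec (RAssign x es e) s 1
     (s\<lparr>reals := upd (reals s) x (map (\<lambda>e. nval e s) es) (rval e s)\<rparr>)"
| Seq: "exec c1 s1 t1 s2 \<Longrightarrow> exec c2 s2 t2 s3 \<Longrightarrow> exec (Seq c1 c2) s1 (t1 + t2) s3"
| CondTrue: "bval b s \<Longrightarrow> exec c1 s t s' \<Longrightarrow> exec (Cond b c1 c2) s (Suc t) s'"
| CondFalse: "\<not> bval b s \<Longrightarrow> exec c2 s t s' \<Longrightarrow> exec (Cond b c1 c2) s (Suc t) s'"
| WhileFalse: "\<not> bval b s \<Longrightarrow> exec (While b c) s 1 s"
| WhileTrue: "bval b s1 \<Longrightarrow> exec c s1 t1 s2 \<Longrightarrow> exec (While b c) s2 t2 s3 \<Longrightarrow>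
     exec (While b c) s1 (Suc (t1 + t2)) s3"

inductive_cases exec_elims:
  "exec Skip s t s'"
  "exec (NAssign x es e) s t s'"
  "exec (RAssign x es e) s t s'"
  "exec (Seq c1 c2) s t s'"
  "exec (Cond b c1 c2) s t s'"
  "exec (While b c) s t s'"

lemma exec_deterministic:
  "exec c s t s' \<Longrightarrow> exec c s u s'' \<Longrightarrow> t = u \<and> s' = s''"
proof (induction arbitrary: u s'' rule: exec.induct)
  case (Seq c1 s1 t1 s2 c2 t2 s3)
  from Seq.prems show ?case
    by (rule exec_elims(4)) (use Seq.IH in metis)
next
  case (CondTrue b s c1 t s' c2)
  from CondTrue.prems show ?case
    by (rule exec_elims(5)) (use CondTrue.hyps CondTrue.IH in metis)+
next
  case (CondFalse b s c2 t s' c1)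
  from CondFalse.prems show ?case
    by (rule exec_elims(5)) (use CondFalse.hyps CondFalse.IH in metis)+
next
  case (WhileFalse b s c)
  from WhileFalse.prems show ?case
    by (rule exec_elims(6)) (use WhileFalse.hyps in auto)
next
  case (WhileTrue b s1 c t1 s2 t2 s3)
  from WhileTrue.prems show ?case
    by (rule exec_elims(6)) (use WhileTrue.hyps(1) WhileTrue.IH in metis)+
qed (erule exec_elims, simp)+

definition input_store :: "nat \<Rightarrow> nat \<Rightarrow> (nat list \<Rightarrow> real) \<Rightarrow> store" where
  "input_store d n C =
     \<lparr>nats = upd (\<lambda>_ _. 0) ''n'' [] n,
      reals = (\<lambda>x ix. if x = ''C'' \<and> ix \<in> positions d n then C ix else 0)\<rparr>"

text \<open>
  An algorithm \<open>A\<close> maps the size \<open>n\<close> and a \<open>d\<close>-dimensional real array \<open>C\<close> to a \<open>d\<close>-dimensional array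
  of naturals. For fixed \<open>d\<close>, being polynomial in \<open>n\<close> and in the number \<open>n ^ d\<close> of entries is the same.
\<close>

definition poly_time_algorithm :: "nat \<Rightarrow> (nat \<Rightarrow> (nat list \<Rightarrow> real) \<Rightarrow> nat list \<Rightarrow> nat) \<Rightarrow> bool" where
  "poly_time_algorithm d A \<longleftrightarrow>
     (\<exists>(c :: com) (T :: nat poly). \<forall>n C. \<exists>t s.
        exec c (input_store d n C) t s \<and> t \<le> poly T n \<and>
        (\<forall>ix\<in>positions d n. nats s ''X'' ix = A n C ix))"

end

theory Submission
  imports Defs
begin

text \<open>
  Lower bound: an axial assignment picks one entry from each of the \<open>N = n ^ (d - 1)\<close> lines in the first
  direction. For a fixed choice of entries the exponential moment bounds the probability that their sum
  is at most \<open>N / (4 n)\<close> by \<open>(e / (1 + 4 n)) ^ N\<close>, which beats the number \<open>n ^ N\<close> of choices.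

  Upper bound: choose the matchings \<open>M\<^sub>0, M\<^sub>1, \<dots>\<close> greedily, each of minimum cost in the bipartite graph of
  pairs not used before, by the Hungarian method. At level \<open>v\<close> this graph is \<open>r\<close>-regular, \<open>r = n - v\<close>,
  and independent of the costs of the level, so it suffices that in an \<open>r\<close>-regular graph with
  independent \<open>Exp(1)\<close> costs the minimum cost exceeds \<open>10 n / r\<close> with probability at most \<open>4 ^ (- n)\<close>;
  then the total is at most \<open>10 n\<close> times a harmonic number.

  For the tail bound, round the costs to multiples of \<open>1 / r\<close> and perturb them by fixed generic offsets,
  so that at most \<open>2 n\<close> edges are tight for the optimal dual solution \<open>u\<close>. Group the outcomes by their
  canonical dual and tight set. A group is a product event: tight edges have a prescribed cost, and every
  other edge \<open>e\<close> costs more than \<open>u e\<close>. Compared with costs of rate \<open>1/2\<close>, such an event is less likely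
  by a factor of about \<open>2 ^ (2 n) * exp (- (\<Sum>e. u e) / 2)\<close>, and \<open>\<Sum>e. u e\<close> is \<open>r\<close> times the minimum
  cost by regularity. The groups are disjoint, so their probabilities at rate \<open>1/2\<close> sum to at most 1.
\<close>

section \<open>Generic offsets\<close>

text \<open>That the minimum cost is large is certified by a dual solution, but a union bound over
  dual vectors on a grid would pay for every value of every potential. Comparison with a second
  product measure avoids this count. The densities of rates 1 and 1/2 have the ratio 2 exp (- x /
  2): large dual values are a gain, and only edges with a prescribed cost lose a factor 2. Rounding
  gives such edges positive probability and leaves countably many groups, but it creates ties, which
  the offsets break. Without a choice of dual that depends only on what a group prescribes, the
  groups would overlap. The constant 10: in cells of width 1 / r, rounding loses n and the offsets
  another n; half of the remaining 8 n beats 2 ^ (2 n) with 4 ^ (- n) to spare. Strong duality is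
  read off from the correctness of the program for one level. The independence between levels is
  also a property of that program: it reads costs of the current level only.\<close>

lemma integer_dependence:
  fixes x :: "'e \<Rightarrow> 'v \<Rightarrow> int"
  assumes "finite V" "finite T" "card V < card T"
  shows "\<exists>m. (\<exists>e\<in>T. m e \<noteq> 0) \<and> (\<forall>v\<in>V. (\<Sum>e\<in>T. m e * x e v) = 0)"
  using assms
proof (induction V arbitrary: T x rule: finite_induct)
  case empty
  then have "T \<noteq> {}" by auto
  then show ?case by (intro exI[of _ "\<lambda>_. 1"]) auto
next
  case (insert v V)
  show ?case
  proof (cases "\<forall>e\<in>T. x e v = 0")
    case True
    have "card V < card T" using insert by simp
    from insert.IH[OF insert.prems(1) this, of x] True show ?thesis by auto
  next
    case False
    then obtain f where f: "f \<in> T" "x f v \<noteq> 0" by auto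
    \<comment> \<open>Fraction-free elimination with pivot \<open>f\<close>: the combination
      vanishes at \<open>v\<close>, and staying within the integers keeps the relation
      integral.\<close>
    define y where "y e u = x f v * x e u - x e v * x f u" for e u
    have "card V < card (T - {f})" using insert f by simp
    from insert.IH[OF _ this, of y] insert.prems obtain m
      where m: "\<exists>e\<in>T - {f}. m e \<noteq> 0" "\<forall>u\<in>V. (\<Sum>e\<in>T - {f}. m e * y e u) = 0" by auto
    \<comment> \<open>The coefficient of the pivot is forced by the requirement at \<open>v\<close>;
      the others are scaled by the nonzero \<open>x f v\<close>, so the relation stays
      nontrivial.\<close>
    define m' where "m' e = (if e = f then - (\<Sum>e\<in>T - {f}. m e * x e v) else m e * x f v)" for e
    have split: "(\<Sum>e\<in>T. m' e * x e u) = (\<Sum>e\<in>T - {f}. m e * y e u)" for u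
    proof -
      have "(\<Sum>e\<in>T. m' e * x e u) = m' f * x f u + (\<Sum>e\<in>T - {f}. m' e * x e u)"
        using f insert.prems by (simp add: sum.remove)
      also have "(\<Sum>e\<in>T - {f}. m' e * x e u) = (\<Sum>e\<in>T - {f}. m e * x f v * x e u)"
        by (intro sum.cong) (auto simp: m'_def)
      also have "m' f * x f u = (\<Sum>e\<in>T - {f}. - (m e * x e v * x f u))"
        by (simp add: m'_def sum_distrib_right sum_negf)
      finally show ?thesis
        by (simp add: y_def sum.distrib[symmetric] algebra_simps)
    qed
    have "(\<Sum>e\<in>T - {f}. m e * y e v) = 0"
      by (simp add: y_def)
    moreover have "\<exists>e\<in>T. m' e \<noteq> 0"
      using m(1) f by (auto simp: m'_def)
    ultimately show ?thesis
      using m(2) split by (intro exI[of _ m']) auto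
  qed
qed

text \<open>Each offset avoids the countably many values that would complete an integral relation
  with the offsets chosen before. Thus 1 and the offsets are linearly independent over the
  rationals.\<close>

lemma generic_offsets:
  assumes "finite E"
  shows "\<exists>\<delta> :: 'e \<Rightarrow> real. (\<forall>e. 0 < \<delta> e \<and> \<delta> e < 1) \<and>
           (\<forall>m :: 'e \<Rightarrow> int. (\<Sum>e\<in>E. of_int (m e) * \<delta> e) \<in> \<int> \<longrightarrow> (\<forall>e\<in>E. m e = 0))"
  using assms
proof (induction E rule: finite_induct)
  case empty
  show ?case by (intro exI[of _ "\<lambda>_. 1/2"]) auto
next
  case (insert f E)
  then obtain \<delta> :: "'e \<Rightarrow> real" where d: "\<And>e. 0 < \<delta> e \<and> \<delta> e < 1"
    "\<And>m :: 'e \<Rightarrow> int. (\<Sum>e\<in>E. of_int (m e) * \<delta> e) \<in> \<int> \<Longrightarrow> \<forall>e\<in>E. m e = 0"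
    by blast
  \<comment> \<open>Solutions for the new offset of a relation in which it has coefficient
    \<open>k\<close>; quotients with \<open>k = 0\<close> evaluate to 0 and do no harm.\<close>
  define B where "B = (\<lambda>(z :: int, k :: int, m). (of_int z - (\<Sum>e\<in>E. of_int (m e) * \<delta> e)) / of_int k) `
      (UNIV \<times> UNIV \<times> (E \<rightarrow>\<^sub>E (UNIV :: int set)))"
  have "countable B"
    unfolding B_def by (intro countable_image countable_SIGMA countable_PiE insert.hyps) auto
  moreover have "uncountable {0<..<1::real}"
    by (rule uncountable_open_interval[THEN iffD2]) simp
  ultimately obtain x where x: "0 < x" "x < 1" "x \<notin> B"
    by (metis countable_subset greaterThanLessThan_iff subsetI)
  define \<delta>' where "\<delta>' = \<delta>(f := x)"
  have "\<forall>e\<in>insert f E. m e = 0" if m: "(\<Sum>e\<in>insert f E. of_int (m e) * \<delta>' e) \<in> \<int>" for m :: "'e \<Rightarrow> int"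
  proof -
    have *: "(\<Sum>e\<in>E. of_int (m e) * \<delta>' e) = (\<Sum>e\<in>E. of_int (m e) * \<delta> e)"
      using insert.hyps by (intro sum.cong) (auto simp: \<delta>'_def)
    obtain z where z: "of_int (m f) * x + (\<Sum>e\<in>E. of_int (m e) * \<delta> e) = of_int z"
      using m insert.hyps * by (auto simp: \<delta>'_def elim: Ints_cases)
    have "m f = 0"
    proof (rule ccontr)
      assume "m f \<noteq> 0"
      then have "x = (of_int z - (\<Sum>e\<in>E. of_int (restrict m E e) * \<delta> e)) / of_int (m f)"
        using z by (simp add: field_simps)
      then have "x \<in> B"
        unfolding B_def by (intro image_eqI[of _ _ "(z, m f, restrict m E)"]) auto
      then show False using x by simp
    qed
    then have "(\<Sum>e\<in>E. of_int (m e) * \<delta> e) \<in> \<int>"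
      using z by simp
    then show ?thesis using d(2) \<open>m f = 0\<close> by auto
  qed
  then show ?case
    using x d(1) by (intro exI[of _ \<delta>']) (auto simp: \<delta>'_def)
qed


section \<open>Canonical dual solutions\<close>

definition tight_edges ::
    "(nat \<times> nat) set \<Rightarrow> (nat \<times> nat \<Rightarrow> real) \<Rightarrow> (nat \<Rightarrow> real) \<Rightarrow> (nat \<Rightarrow> real) \<Rightarrow> (nat \<times> nat) set" where
  "tight_edges E w a b = {(j, k) \<in> E. a j + b k = w (j, k)}"

definition dual_feasible ::
    "(nat \<times> nat) set \<Rightarrow> (nat \<times> nat \<Rightarrow> real) \<Rightarrow> (nat \<Rightarrow> real) \<Rightarrow> (nat \<Rightarrow> real) \<Rightarrow> bool" where
  "dual_feasible E w a b \<longleftrightarrow> (\<forall>(j, k)\<in>E. a j + b k \<le> w (j, k))"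

definition perfect_matching :: "nat \<Rightarrow> (nat \<times> nat) set \<Rightarrow> (nat \<Rightarrow> nat) \<Rightarrow> bool" where
  "perfect_matching n E M \<longleftrightarrow> bij_betw M {..<n} {..<n} \<and> (\<forall>j<n. (j, M j) \<in> E)"

text \<open>One step is an alternating path of length two: from row \<open>j\<close> along a tight
  edge to column \<open>M i\<close>, then back along the matching to row \<open>i\<close>. The roots
  are the rows whose dual sits at the lower bound 0.\<close>

inductive_set reach :: "nat \<Rightarrow> (nat \<times> nat) set \<Rightarrow> (nat \<Rightarrow> nat) \<Rightarrow> (nat \<Rightarrow> real) \<Rightarrow> nat set"
  for n T M a where
  root: "j < n \<Longrightarrow> a j = 0 \<Longrightarrow> j \<in> reach n T M a"
| step: "j \<in> reach n T M a \<Longrightarrow> (j, M i) \<in> T \<Longrightarrow> i < n \<Longrightarrow> i \<in> reach n T M a"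

text \<open>Among all optimal dual solutions this singles out exactly one; moreover, whether \<open>(a, b)\<close> is
  canonical depends on \<open>w\<close> only through feasibility and the set of tight edges.\<close>

definition canonical_dual ::
    "nat \<Rightarrow> (nat \<times> nat) set \<Rightarrow> (nat \<times> nat \<Rightarrow> real) \<Rightarrow> (nat \<Rightarrow> real) \<Rightarrow> (nat \<Rightarrow> real) \<Rightarrow> bool" where
  "canonical_dual n E w a b \<longleftrightarrow>
     dual_feasible E w a b \<and> (\<forall>j. 0 \<le> a j) \<and> (\<forall>j\<ge>n. a j = 0 \<and> b j = 0) \<and>
     (\<exists>M. perfect_matching n (tight_edges E w a b) M \<and> {..<n} \<subseteq> reach n (tight_edges E w a b) M a)"

lemma perfect_matching_surj:
  assumes "perfect_matching n E M" "k < n"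
  obtains j where "j < n" "M j = k"
proof -
  have "k \<in> M ` {..<n}"
    using assms by (simp add: perfect_matching_def bij_betw_def)
  with that show ?thesis by auto
qed

lemma sum_over_matching:
  fixes a b :: "nat \<Rightarrow> real"
  assumes "perfect_matching n E M"
  shows "(\<Sum>j<n. a j + b (M j)) = (\<Sum>j<n. a j) + (\<Sum>k<n. b k)"
  using assms sum.reindex_bij_betw[of M "{..<n}" "{..<n}" b]
  by (simp add: perfect_matching_def sum.distrib)

text \<open>Weak duality with equality on \<open>M\<close>: the dual sum is the same along every
  perfect matching.\<close>

lemma tight_matching_optimal:
  assumes M: "perfect_matching n (tight_edges E w a b) M"
    and "dual_feasible E w a b" and M': "perfect_matching n E M'"
  shows "(\<Sum>j<n. w (j, M j)) \<le> (\<Sum>j<n. w (j, M' j))"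
proof -
  have "(\<Sum>j<n. w (j, M j)) = (\<Sum>j<n. a j + b (M j))"
    using M by (intro sum.cong) (auto simp: perfect_matching_def tight_edges_def)
  also have "\<dots> = (\<Sum>j<n. a j + b (M' j))"
    by (simp add: sum_over_matching[OF M] sum_over_matching[OF M'])
  also have "\<dots> \<le> (\<Sum>j<n. w (j, M' j))"
    using assms by (intro sum_mono) (auto simp: perfect_matching_def dual_feasible_def)
  finally show ?thesis .
qed

text \<open>This makes the canonical row dual the least one. The bound holds at the roots, where
  \<open>a\<close> is 0, and passes along every alternating step, because \<open>M\<close> has
  minimum cost and is therefore tight for \<open>(a', b')\<close> as well.\<close>

lemma canonical_dual_le:
  assumes c: "canonical_dual n E w a b" and c': "canonical_dual n E w a' b'" and "j < n"
  shows "a j \<le> a' j"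
proof -
  from c obtain M where M: "perfect_matching n (tight_edges E w a b) M"
    "{..<n} \<subseteq> reach n (tight_edges E w a b) M a" and f: "dual_feasible E w a b"
    by (auto simp: canonical_dual_def)
  from c' obtain M' where M': "perfect_matching n (tight_edges E w a' b') M'"
    and f': "dual_feasible E w a' b'" and pos: "\<And>j. 0 \<le> a' j"
    by (auto simp: canonical_dual_def)
  have ME: "perfect_matching n E M" and ME': "perfect_matching n E M'"
    using M M' by (auto simp: perfect_matching_def tight_edges_def)
  have "(\<Sum>j<n. w (j, M j)) \<le> (\<Sum>j<n. w (j, M' j))"
    by (rule tight_matching_optimal[OF M(1) f ME'])
  also have "\<dots> = (\<Sum>j<n. a' j + b' (M' j))"
    using M' by (intro sum.cong) (auto simp: perfect_matching_def tight_edges_def)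
  also have "\<dots> = (\<Sum>j<n. a' j + b' (M j))"
    by (simp add: sum_over_matching[OF ME] sum_over_matching[OF ME'])
  finally have "(\<Sum>j<n. w (j, M j) - (a' j + b' (M j))) \<le> 0"
    by (simp add: sum_subtractf)
  moreover have nn: "\<And>j. j \<in> {..<n} \<Longrightarrow> 0 \<le> w (j, M j) - (a' j + b' (M j))"
    using ME f' by (auto simp: perfect_matching_def dual_feasible_def)
  ultimately have "\<forall>j\<in>{..<n}. w (j, M j) - (a' j + b' (M j)) = 0"
    using sum_nonneg_eq_0_iff[of "{..<n}" "\<lambda>j. w (j, M j) - (a' j + b' (M j))"]
      sum_nonneg[of "{..<n}" "\<lambda>j. w (j, M j) - (a' j + b' (M j))"] by force
  then have t': "a' j + b' (M j) = w (j, M j)" if "j < n" for j using that by auto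
  have t: "a j + b (M j) = w (j, M j)" if "j < n" for j
    using M(1) that by (auto simp: perfect_matching_def tight_edges_def)
  have "i \<in> reach n (tight_edges E w a b) M a \<Longrightarrow> a i \<le> a' i" for i
  proof (induction rule: reach.induct)
    case (step j i)
    have "a' j + b' (M i) \<le> a j + b (M i)"
      using step f' by (auto simp: tight_edges_def dual_feasible_def)
    then show ?case
      using step t[of i] t'[of i] by simp
  qed (use pos in auto)
  then show ?thesis using M \<open>j < n\<close> by auto
qed

text \<open>Minimality in both directions settles the row duals; they determine the column duals,
  since every column lies on a tight matching edge.\<close>

lemma canonical_dual_unique:
  assumes c: "canonical_dual n E w a b" and c': "canonical_dual n E w a' b'"
  shows "a = a' \<and> b = b'"
proof -
  have a: "a j = a' j" for j
    using canonical_dual_le[OF c c'] canonical_dual_le[OF c' c] c c'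
    by (cases "j < n") (force simp: canonical_dual_def)+
  have le: "b1 k \<le> b2 k" if c1: "canonical_dual n E w a b1" and c2: "canonical_dual n E w a b2" for b1 b2 k
  proof (cases "k < n")
    case True
    from c2 obtain M where M: "perfect_matching n (tight_edges E w a b2) M"
      by (auto simp: canonical_dual_def)
    obtain j where j: "j < n" "M j = k"
      by (rule perfect_matching_surj[OF M True])
    then have "(j, k) \<in> E" "a j + b2 k = w (j, k)"
      using M by (auto simp: perfect_matching_def tight_edges_def)
    moreover from this have "a j + b1 k \<le> w (j, k)"
      using c1 by (auto simp: canonical_dual_def dual_feasible_def)
    ultimately show ?thesis by simp
  qed (use c1 c2 in \<open>auto simp: canonical_dual_def\<close>)
  have aa: "a = a'" using a by auto
  have "b k = b' k" for k
    using le[OF c, of b' k] le[of b' b k] c c' aa by (metis order_antisym)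
  then show ?thesis using aa by blast
qed

text \<open>Extremal argument with \<open>M\<close> fixed: among the nonnegative duals tight on
  \<open>M\<close>, take one that reaches most rows. If a row is missing, lowering the duals of all
  unreached rows and raising those of their mates by the same amount keeps \<open>M\<close> tight
  and the reached rows reached, until one more row is reached.\<close>

lemma canonical_dual_exists:
  assumes f0: "dual_feasible E w a0 b0" and M0: "perfect_matching n (tight_edges E w a0 b0) M"
    and E: "E \<subseteq> {..<n} \<times> {..<n}"
  shows "\<exists>a b. canonical_dual n E w a b"
proof -
  define P where "P = (\<lambda>(a, b). dual_feasible E w a b \<and> (\<forall>j<n. 0 \<le> a j) \<and>
      perfect_matching n (tight_edges E w a b) M)"
  define R where "R = (\<lambda>(a, b). reach n (tight_edges E w a b) M a)"
  have R_sub: "R p \<subseteq> {..<n}" for p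
    by (auto simp: R_def elim: reach.cases split: prod.splits)
  \<comment> \<open>Shifting by the least row dual makes the row duals nonnegative and changes no
    sum \<open>a j + b k\<close>.\<close>
  have "P (\<lambda>j. a0 j - Min (a0 ` {..<n}), \<lambda>k. b0 k + Min (a0 ` {..<n}))"
    using f0 M0 by (auto simp: P_def dual_feasible_def tight_edges_def)
  then obtain p where p: "P p" and max: "\<And>q. P q \<Longrightarrow> card (R q) \<le> card (R p)"
    using ex_has_greatest_nat[of P _ "\<lambda>p. card (R p)" "Suc n"] card_mono[OF finite_lessThan R_sub]
    by (metis card_lessThan le_imp_less_Suc order_less_imp_le)
  obtain a b where ab: "p = (a, b)" by force
  have f: "dual_feasible E w a b" and pos: "\<And>j. j < n \<Longrightarrow> 0 \<le> a j"
    and M: "perfect_matching n (tight_edges E w a b) M"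
    using p by (auto simp: P_def ab)
  have M_inj: "inj_on M {..<n}" and M_lt: "\<And>j. j < n \<Longrightarrow> M j < n"
    using M by (auto simp: perfect_matching_def bij_betw_def)
  define N where "N = {..<n} - R p"
  have "N = {}"
  proof (rule ccontr)
    assume "N \<noteq> {}"
    \<comment> \<open>Candidate shifts: those that turn an unreached row into a root, and those that
      make an edge from a reached row to the mate of an unreached one tight. All are positive, as
      otherwise the row would be reached already.\<close>
    define D where "D = a ` N \<union> (\<lambda>(j, k). w (j, k) - a j - b k) ` (E \<inter> (R p \<times> M ` N))"
    have fin: "finite D" "D \<noteq> {}"
      using \<open>N \<noteq> {}\<close> finite_subset[OF E] by (auto simp: D_def N_def)
    define \<theta> where "\<theta> = Min D"
    have in_D: "\<theta> \<in> D" and le_D: "\<And>d. d \<in> D \<Longrightarrow> \<theta> \<le> d"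
      using fin by (auto simp: \<theta>_def)
    have RN: "j \<in> R p" if "j < n" "j \<notin> N" for j using that by (auto simp: N_def)
    have "d > 0" if "d \<in> D" for d
    proof -
      have "a j > 0" if "j \<in> N" for j
        using that pos[of j] reach.root[of j n a] by (force simp: N_def R_def ab)
      moreover have "w (j, M i) - a j - b (M i) > 0" if "(j, M i) \<in> E" "j \<in> R p" "i \<in> N" for i j
      proof -
        have "(j, M i) \<notin> tight_edges E w a b"
          using that reach.step[of j n "tight_edges E w a b" M a i] by (auto simp: N_def R_def ab)
        moreover have "a j + b (M i) \<le> w (j, M i)"
          using that f by (auto simp: dual_feasible_def)
        ultimately show ?thesis using that by (auto simp: tight_edges_def)
      qed
      ultimately show ?thesis using that by (auto simp: D_def)
    qed
    with in_D have "\<theta> > 0" by auto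
    define a' where "a' j = (if j \<in> N then a j - \<theta> else a j)" for j
    define b' where "b' k = (if k \<in> M ` N then b k + \<theta> else b k)" for k
    have MN: "M j \<in> M ` N \<longleftrightarrow> j \<in> N" if "j < n" for j
      using inj_on_image_mem_iff[OF M_inj, of j N] that by (auto simp: N_def)
    have "dual_feasible E w a' b'"
      unfolding dual_feasible_def
    proof clarify
      fix j k assume jk: "(j, k) \<in> E"
      then have "a j + b k \<le> w (j, k)" using f by (auto simp: dual_feasible_def)
      moreover have "\<theta> \<le> w (j, k) - a j - b k" if "j \<notin> N" "k \<in> M ` N"
        using that jk E RN[of j] by (intro le_D) (force simp: D_def)
      ultimately show "a' j + b' k \<le> w (j, k)"
        using \<open>\<theta> > 0\<close> by (force simp: a'_def b'_def)
    qed
    moreover have "0 \<le> a' j" if "j < n" for j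
      using pos[OF that] le_D[of "a j"] by (auto simp: a'_def D_def)
    moreover have "(j, M j) \<in> tight_edges E w a' b'" if "j < n" for j
      using M that MN[OF that] by (auto simp: perfect_matching_def tight_edges_def a'_def b'_def)
    then have "perfect_matching n (tight_edges E w a' b') M"
      using M by (auto simp: perfect_matching_def)
    ultimately have P': "P (a', b')" by (simp add: P_def)
    have sub: "j \<in> R (a', b')" if "j \<in> R p" for j
    proof -
      have "j \<in> reach n (tight_edges E w a b) M a \<Longrightarrow> j \<in> reach n (tight_edges E w a' b') M a'"
      proof (induction rule: reach.induct)
        case (root j)
        then have "j \<in> R p" by (simp add: R_def ab reach.root)
        then have "a' j = a j" by (simp add: a'_def N_def)
        with root show ?case by (intro reach.root) simp_all
      next
        case (step j i)
        from step.hyps(1) have "j \<in> R p" by (simp add: R_def ab)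
        moreover from reach.step[OF step.hyps] have "i \<in> R p" by (simp add: R_def ab)
        ultimately have "j \<notin> N" "M i \<notin> M ` N"
          using MN[OF step.hyps(3)] by (simp_all add: N_def)
        then have "(j, M i) \<in> tight_edges E w a' b'"
          using step.hyps(2) by (simp add: tight_edges_def a'_def b'_def)
        from reach.step[OF step.IH this step.hyps(3)] show ?case .
      qed
      with that show ?thesis by (simp add: R_def ab)
    qed
    have "\<exists>i\<in>N. i \<in> R (a', b')"
    proof -
      consider i where "i \<in> N" "\<theta> = a i"
        | i j where "i \<in> N" "j \<in> R p" "(j, M i) \<in> E" "\<theta> = w (j, M i) - a j - b (M i)"
        using in_D by (auto simp: D_def)
      then show ?thesis
      proof cases
        case 1
        then have "i \<in> R (a', b')"
          by (simp add: R_def a'_def N_def reach.root)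
        with 1 show ?thesis by blast
      next
        case 2
        then have "(j, M i) \<in> tight_edges E w a' b'"
          by (auto simp: tight_edges_def a'_def b'_def N_def)
        moreover have "i < n" using 2 by (auto simp: N_def)
        ultimately have "i \<in> R (a', b')"
          using reach.step[of j n "tight_edges E w a' b'" M a' i] sub[OF 2(2)] by (auto simp: R_def)
        with 2 show ?thesis by blast
      qed
    qed
    then have "R p \<subset> R (a', b')" using sub by (auto simp: N_def)
    then have "card (R p) < card (R (a', b'))"
      using R_sub[of "(a', b')"] by (meson finite_lessThan finite_subset psubset_card_mono)
    with max[OF P'] show False by simp
  qed
  then have all: "{..<n} \<subseteq> R p" by (auto simp: N_def)
  \<comment> \<open>Values off the vertex set are fixed at 0, so that uniqueness can be an equality
    of functions.\<close>
  define a' where "a' j = (if j < n then a j else 0)" for j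
  define b' where "b' j = (if j < n then b j else 0)" for j
  have T: "tight_edges E w a' b' = tight_edges E w a b"
    using E by (auto simp: tight_edges_def a'_def b'_def)
  have "reach n T M a' = reach n T M a" for T
  proof -
    have "reach n T M a \<subseteq> reach n T M a'" if "\<And>j. j < n \<Longrightarrow> a j = a' j" for a a'
    proof
      fix j assume "j \<in> reach n T M a"
      then show "j \<in> reach n T M a'"
        by (induction rule: reach.induct) (use that in \<open>auto intro: reach.intros\<close>)
    qed
    from this[of a a'] this[of a' a] show ?thesis by (auto simp: a'_def)
  qed
  with T M all pos f E have "canonical_dual n E w a' b'"
    unfolding canonical_dual_def dual_feasible_def
    by (auto simp: a'_def b'_def R_def ab intro!: exI[of _ M])
  then show ?thesis by blast
qed

section \<open>Regular bipartite graphs and their tight edges\<close>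

definition regular_graph :: "nat \<Rightarrow> nat \<Rightarrow> (nat \<times> nat) set \<Rightarrow> bool" where
  "regular_graph n r E \<longleftrightarrow> E \<subseteq> {..<n} \<times> {..<n} \<and>
     (\<forall>j<n. card {k. (j, k) \<in> E} = r) \<and> (\<forall>k<n. card {j. (j, k) \<in> E} = r)"

text \<open>Double counting over the \<open>r\<close> edges at each vertex. It turns the dual
  objective into a sum over edges; applied to indicator functions it also yields the counting
  argument for alternating trees.\<close>

lemma regular_graph_sum:
  fixes a b :: "nat \<Rightarrow> real"
  assumes "regular_graph n r E"
  shows "(\<Sum>(j, k)\<in>E. a j + b k) = real r * ((\<Sum>j<n. a j) + (\<Sum>k<n. b k))"
proof -
  have E: "E \<subseteq> {..<n} \<times> {..<n}" and r: "\<And>j. j < n \<Longrightarrow> card {k. (j, k) \<in> E} = r"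
     "\<And>k. k < n \<Longrightarrow> card {j. (j, k) \<in> E} = r"
    using assms by (auto simp: regular_graph_def)
  have fin: "finite {k. (j, k) \<in> E}" "finite {j. (j, k) \<in> E}" for j k
    by (rule finite_subset[of _ "{..<n}"]; use E in force)+
  have "(\<Sum>(j, k)\<in>E. a j) = (\<Sum>(j, k)\<in>(SIGMA j:{..<n}. {k. (j, k) \<in> E}). a j)"
    using E by (intro sum.cong) auto
  also have "\<dots> = (\<Sum>j<n. \<Sum>k | (j, k) \<in> E. a j)"
    using fin by (intro sum.Sigma[symmetric]) auto
  finally have 1: "(\<Sum>(j, k)\<in>E. a j) = real r * (\<Sum>j<n. a j)"
    using r by (simp add: sum_distrib_left)
  have "(\<Sum>(j, k)\<in>E. b k) = (\<Sum>(k, j)\<in>(SIGMA k:{..<n}. {j. (j, k) \<in> E}). b k)"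
    using E by (intro sum.reindex_bij_witness[of _ "\<lambda>(k, j). (j, k)" "\<lambda>(j, k). (k, j)"]) auto
  also have "\<dots> = (\<Sum>k<n. \<Sum>j | (j, k) \<in> E. b k)"
    using fin by (intro sum.Sigma[symmetric]) auto
  finally have 2: "(\<Sum>(j, k)\<in>E. b k) = real r * (\<Sum>k<n. b k)"
    using r by (simp add: sum_distrib_left)
  have "(\<Sum>(j, k)\<in>E. a j + b k) = (\<Sum>(j, k)\<in>E. a j) + (\<Sum>(j, k)\<in>E. b k)"
    by (simp add: sum.distrib[symmetric] split_def)
  then show ?thesis by (simp only: 1 2 distrib_left)
qed

lemma regular_graph_card:
  assumes "regular_graph n r E"
  shows "card E = n * r"
proof -
  have "real (card E) = (\<Sum>(j, k)\<in>E. 1 + 0)" by simp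
  also have "\<dots> = real r * real n"
    using regular_graph_sum[OF assms, of "\<lambda>_. 1" "\<lambda>_. 0"] by simp
  finally show ?thesis by (metis mult.commute of_nat_eq_iff of_nat_mult)
qed

text \<open>Each tight edge is a linear equation in the \<open>2 * n\<close> potentials. The
  incidence vectors of more than \<open>2 * n\<close> edges satisfy an integer relation; it cancels
  the potentials and makes a nontrivial integer combination of the offsets integral, against
  genericity.\<close>

lemma card_tight_edges_le:
  fixes \<delta> :: "nat \<times> nat \<Rightarrow> real" and g :: "nat \<times> nat \<Rightarrow> nat"
  assumes E: "E \<subseteq> {..<n} \<times> {..<n}"
    and gen: "\<And>m :: nat \<times> nat \<Rightarrow> int. (\<Sum>e\<in>E. of_int (m e) * \<delta> e) \<in> \<int> \<Longrightarrow> \<forall>e\<in>E. m e = 0"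
  shows "card (tight_edges E (\<lambda>e. real (g e) + \<delta> e) a b) \<le> 2 * n"
proof (rule ccontr)
  define T where "T = tight_edges E (\<lambda>e. real (g e) + \<delta> e) a b"
  have T: "T \<subseteq> E" by (auto simp: T_def tight_edges_def)
  have fin: "finite E" using E by (rule finite_subset) auto
  define V where "V = {..<n} <+> {..<n}"
  define x :: "nat \<times> nat \<Rightarrow> nat + nat \<Rightarrow> int"
    where "x e v = (case v of Inl j \<Rightarrow> of_bool (fst e = j) | Inr k \<Rightarrow> of_bool (snd e = k))" for e v
  assume "\<not> ?thesis"
  then have "card V < card T" by (simp add: T_def V_def card_Plus)
  then obtain m where m: "\<exists>e\<in>T. m e \<noteq> 0" "\<And>v. v \<in> V \<Longrightarrow> (\<Sum>e\<in>T. m e * x e v) = 0"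
    using integer_dependence[of V T x] finite_subset[OF T fin] by (auto simp: V_def)
  \<comment> \<open>The coefficients at each vertex sum to 0, so every function of the vertex drops
    out. Stated for an arbitrary end \<open>h\<close> to cover rows and columns at once.\<close>
  have expand: "(\<Sum>e\<in>T. of_int (m e) * f (h e)) = 0"
    if h: "\<And>e. e \<in> T \<Longrightarrow> h e < n" and c: "\<And>e j. x e (c j) = of_bool (h e = j)" and cV: "\<And>j. j < n \<Longrightarrow> c j \<in> V"
    for f :: "nat \<Rightarrow> real" and h c
  proof -
    have "(\<Sum>e\<in>T. of_int (m e) * f (h e)) = (\<Sum>e\<in>T. \<Sum>j<n. of_int (m e * x e (c j)) * f j)"
    proof (rule sum.cong[OF refl])
      fix e assume "e \<in> T"
      have "(\<Sum>j<n. of_int (m e * x e (c j)) * f j) = (\<Sum>j<n. if h e = j then of_int (m e) * f j else 0)"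
        by (intro sum.cong) (auto simp: c)
      also have "\<dots> = of_int (m e) * f (h e)"
        using h[OF \<open>e \<in> T\<close>] by (subst sum.delta') auto
      finally show "of_int (m e) * f (h e) = (\<Sum>j<n. of_int (m e * x e (c j)) * f j)" ..
    qed
    also have "\<dots> = (\<Sum>j<n. of_int (\<Sum>e\<in>T. m e * x e (c j)) * f j)"
      by (subst sum.swap) (simp add: sum_distrib_right)
    also have "\<dots> = 0"
      by (rule sum.neutral) (use m(2) cV in \<open>simp del: of_int_sum\<close>)
    finally show ?thesis .
  qed
  have lt: "fst e < n" "snd e < n" if "e \<in> T" for e using that E T by auto
  have "(\<Sum>e\<in>T. of_int (m e) * a (fst e)) = 0"
    by (rule expand[of _ Inl]) (auto simp: lt x_def V_def)
  moreover have "(\<Sum>e\<in>T. of_int (m e) * b (snd e)) = 0"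
    by (rule expand[of _ Inr]) (auto simp: lt x_def V_def)
  ultimately have "(\<Sum>e\<in>T. of_int (m e) * (a (fst e) + b (snd e))) = 0"
    by (simp add: distrib_left sum.distrib)
  moreover have "a (fst e) + b (snd e) = real (g e) + \<delta> e" if "e \<in> T" for e
    using that by (auto simp: T_def tight_edges_def)
  ultimately have "(\<Sum>e\<in>T. of_int (m e) * \<delta> e) = - (\<Sum>e\<in>T. of_int (m e) * real (g e))"
    by (simp add: distrib_left sum.distrib)
  also have "\<dots> = of_int (- (\<Sum>e\<in>T. m e * int (g e)))" by simp
  finally have "(\<Sum>e\<in>T. of_int (m e) * \<delta> e) \<in> \<int>" by (metis Ints_of_int)
  also have "(\<Sum>e\<in>T. of_int (m e) * \<delta> e) = (\<Sum>e\<in>E. of_int (if e \<in> T then m e else 0) * \<delta> e)"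
    by (rule sum.mono_neutral_cong_left[OF fin T]) auto
  finally have "\<forall>e\<in>E. (if e \<in> T then m e else 0) = 0" by (rule gen)
  then show False using m(1) T by (metis subsetD)
qed


section \<open>Minimum matching cost in regular graphs\<close>

abbreviation exponential_measure :: "real \<Rightarrow> real measure" where
  "exponential_measure l \<equiv> density lborel (exponential_density l)"

text \<open>The index of the cell \<open>(m / R, (m + 1) / R]\<close> containing \<open>x\<close>; half-open on the left so that
  the events \<open>L \<le> cell R x\<close> are open rays.\<close>

definition cell :: "real \<Rightarrow> real \<Rightarrow> nat" where
  "cell R x = nat (\<lceil>R * x\<rceil> - 1)"

text \<open>\<open>L = 0\<close> is a separate case because \<open>nat\<close> cuts off at 0: the
  lowest cell also contains everything to its left.\<close>

lemma cell_ge_iff: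
  assumes "0 < R"
  shows "L \<le> cell R x \<longleftrightarrow> L = 0 \<or> real L / R < x"
proof (cases "L = 0")
  case False
  then have "L \<le> cell R x \<longleftrightarrow> int L < \<lceil>R * x\<rceil>"
    by (auto simp: cell_def le_nat_iff)
  also have "\<dots> \<longleftrightarrow> real L < R * x" by (simp add: less_ceiling_iff)
  also have "\<dots> \<longleftrightarrow> real L / R < x" using assms by (simp add: field_simps)
  finally show ?thesis using False by simp
qed simp

lemma le_cell: "0 < R \<Longrightarrow> x \<le> (real (cell R x) + 1) / R"
  by (simp add: cell_def field_simps) linarith

lemma measure_exponential_cell_ge:
  assumes "0 < R" "0 < l"
  shows "measure (exponential_measure l) {x. L \<le> cell R x} = exp (- l * real L / R)"
proof -
  interpret prob_space "exponential_measure l"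
    by (rule prob_space_exponential_density) fact
  have D: "distributed (exponential_measure l) lborel (\<lambda>x. x) (exponential_density l)"
    by (auto simp: distributed_def intro!: measure_eqI)
       (simp add: emeasure_distr)
  show ?thesis
  proof (cases "L = 0")
    case True
    then show ?thesis using prob_space by simp
  next
    case False
    have "{x. L \<le> cell R x} = {x \<in> space (exponential_measure l). real L / R < x}"
      using assms False by (auto simp: cell_ge_iff)
    then show ?thesis
      using exponential_distributedD_gt[OF D, of "real L / R"] assms by (simp add: mult.commute)
  qed
qed

lemma sets_cell_ge [measurable]: "{x. L \<le> cell R x} \<in> sets borel"
  unfolding cell_def by measurable

lemma measure_exponential_cell_eq:
  assumes "0 < R" "0 < l"
  shows "measure (exponential_measure l) {x. cell R x = v} = exp (- l * real v / R) * (1 - exp (- l / R))"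
proof -
  interpret prob_space "exponential_measure l"
    by (rule prob_space_exponential_density) fact
  have "{x. cell R x = v} = {x. v \<le> cell R x} - {x. Suc v \<le> cell R x}" by auto
  also have "measure (exponential_measure l) \<dots> =
      measure (exponential_measure l) {x. v \<le> cell R x} - measure (exponential_measure l) {x. Suc v \<le> cell R x}"
    by (intro finite_measure_Diff) auto
  also have "\<dots> = exp (- l * real v / R) * (1 - exp (- l / R))"
  proof -
    have "- l * real (Suc v) / R = - l * real v / R + - l / R"
      by (simp add: add_divide_distrib diff_divide_distrib algebra_simps)
    then have "exp (- l * real (Suc v) / R) = exp (- l * real v / R) * exp (- l / R)"
      by (simp only: exp_add)
    then show ?thesis
      using assms by (simp add: measure_exponential_cell_ge right_diff_distrib)
  qed
  finally show ?thesis .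
qed

text \<open>With \<open>h\<close> the decay of the rate 1/2 law over one cell, the two masses are
  \<open>y * y * (1 - h * h)\<close> and \<open>y * (1 - h)\<close>; the surplus factor
  \<open>1 + h\<close> is at most 2.\<close>

lemma measure_cell_eq_ratio:
  assumes "0 < R"
  shows "measure (exponential_measure 1) {x. cell R x = v}
     \<le> 2 * exp (- real v / (2 * R)) * measure (exponential_measure (1/2)) {x. cell R x = v}"
proof -
  define h y where "h = exp (- 1 / (2 * R))" and "y = exp (- real v / (2 * R))"
  have h: "0 < h" "h < 1" and "0 < y" using assms by (auto simp: h_def y_def)
  have "exp (- 1 / R) = h * h" "exp (- real v / R) = y * y"
    using assms by (auto simp: h_def y_def exp_add[symmetric] field_simps)
  then have "measure (exponential_measure 1) {x. cell R x = v} = y * y * (1 - h * h)"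
    using assms by (simp add: measure_exponential_cell_eq)
  also have "\<dots> = (1 + h) * (y * (y * (1 - h)))" by (simp add: algebra_simps)
  also have "\<dots> \<le> 2 * (y * (y * (1 - h)))"
    using h \<open>0 < y\<close> by (intro mult_right_mono) auto
  also have "\<dots> = 2 * exp (- real v / (2 * R)) * measure (exponential_measure (1/2)) {x. cell R x = v}"
    using assms by (simp add: measure_exponential_cell_eq h_def y_def)
  finally show ?thesis .
qed

text \<open>Tails of both laws are pure exponentials, so a mere inequality on a cost loses no factor
  2.\<close>

lemma measure_cell_ge_ratio:
  assumes "0 < R"
  shows "measure (exponential_measure 1) {x. L \<le> cell R x}
     = exp (- real L / (2 * R)) * measure (exponential_measure (1/2)) {x. L \<le> cell R x}"
  using assms by (simp add: measure_exponential_cell_ge exp_add[symmetric] field_simps)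

lemma finite_product_prob_space_exponential:
  assumes "finite I" "0 < l"
  shows "finite_product_prob_space (\<lambda>_. exponential_measure l) I"
  using assms prob_space_exponential_density[of l]
  by (intro finite_product_prob_space.intro product_prob_space.intro product_sigma_finite.intro
      product_prob_space_axioms.intro finite_product_sigma_finite.intro finite_product_sigma_finite_axioms.intro
      prob_space_imp_sigma_finite) auto

text \<open>The premise \<open>dual\<close> is strong duality for bipartite matching, supplied later
  by a run of the program. \<open>P l\<close> has the same measurable sets for every
  \<open>l\<close>, so one event can be measured under rates 1 and 1/2.\<close>

lemma matching_cost_tail:
  assumes reg: "regular_graph n r E" and r: "0 < r"
    and dual: "\<And>w. \<exists>a b M. dual_feasible E w a b \<and> perfect_matching n (tight_edges E w a b) M"
  defines "P \<equiv> \<lambda>l. Pi\<^sub>M E (\<lambda>_. exponential_measure l)"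
  shows "measure (P 1) {c \<in> space (P 1). \<forall>M. perfect_matching n E M \<longrightarrow> 10 * real n / real r < (\<Sum>j<n. c (j, M j))}
     \<le> (1 / 4) ^ n"
proof -
  have E: "E \<subseteq> {..<n} \<times> {..<n}" using reg by (simp add: regular_graph_def)
  then have fin: "finite E" by (rule finite_subset) auto
  define R where "R = real r"
  have R: "0 < R" using r by (simp add: R_def)
  obtain \<delta> :: "nat \<times> nat \<Rightarrow> real" where \<delta>: "\<And>e. 0 < \<delta> e" "\<And>e. \<delta> e < 1"
    and gen: "\<And>m :: nat \<times> nat \<Rightarrow> int. (\<Sum>e\<in>E. of_int (m e) * \<delta> e) \<in> \<int> \<Longrightarrow> \<forall>e\<in>E. m e = 0"
    using generic_offsets[OF fin] by metis
  \<comment> \<open>Costs in units of cells: the cell indices \<open>g\<close> shifted by the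
    offsets.\<close>
  define w where "w g = (\<lambda>e. real (g e) + \<delta> e)" for g :: "nat \<times> nat \<Rightarrow> nat"
  have "\<forall>g. \<exists>a b. canonical_dual n E (w g) a b"
    using dual canonical_dual_exists[OF _ _ E] by metis
  then obtain A B where AB: "\<And>g. canonical_dual n E (w g) (A g) (B g)" by metis
  define u where "u g = (\<lambda>(j, k). A g j + B g k)" for g
  define T where "T g = tight_edges E (w g) (A g) (B g)" for g
  define D where "D g = (\<Sum>j<n. A g j) + (\<Sum>k<n. B g k)" for g
  \<comment> \<open>The least cell index at which edge \<open>e\<close> has positive slack for the
    dual of \<open>g\<close>.\<close>
  define l where "l g e = nat (\<lfloor>u g e - \<delta> e\<rfloor> + 1)" for g e
  define X where "X g e = (if e \<in> T g then {x. cell R x = g e} else {x. l g e \<le> cell R x})" for g e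
  define Ev where "Ev g = Pi\<^sub>E E (X g)" for g
  have T_sub: "T g \<subseteq> E" for g by (auto simp: T_def tight_edges_def)
  have l_iff: "l g e \<le> m \<longleftrightarrow> u g e < real m + \<delta> e" for g e m
    unfolding l_def by (simp add: nat_le_iff) linarith
  have u_less: "u g e < w g e" if "e \<in> E" "e \<notin> T g" for g e
    using AB[of g] that by (force simp: canonical_dual_def dual_feasible_def T_def tight_edges_def u_def)
  have u_eq: "u g e = w g e" if "e \<in> T g" for g e
    using that by (auto simp: T_def tight_edges_def u_def)
  have own_class: "c \<in> Ev (\<lambda>e\<in>E. cell R (c e))" if "c \<in> extensional E" for c
    using that u_less[of _ "\<lambda>e\<in>E. cell R (c e)"]
    by (auto simp: Ev_def PiE_def X_def l_iff w_def Pi_def)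
  \<comment> \<open>The dual of \<open>g\<close> stays feasible, with the same tight edges, for the
    rounding of any outcome in \<open>Ev g\<close>. By uniqueness it is the canonical dual there
    too, so two such events are equal or disjoint.\<close>
  have same_class: "Ev (\<lambda>e\<in>E. cell R (c e)) = Ev g" if c: "c \<in> Ev g" for c g
  proof -
    define g' where "g' = (\<lambda>e\<in>E. cell R (c e))"
    have on_T: "g' e = g e" if "e \<in> T g" for e
    proof -
      have "e \<in> E" using that T_sub by auto
      moreover from this have "c e \<in> X g e" using c by (auto simp: Ev_def)
      ultimately show ?thesis using that by (simp add: X_def g'_def)
    qed
    have off_T: "u g e < w g' e" if "e \<in> E" "e \<notin> T g" for e
    proof -
      have "c e \<in> X g e" using c that by (auto simp: Ev_def)
      then show ?thesis using that by (simp add: X_def l_iff g'_def w_def)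
    qed
    have ab: "A g j + B g k = w g' (j, k)" if "(j, k) \<in> T g" for j k
      using u_eq[OF that] on_T[OF that] by (simp add: w_def u_def)
    have ab': "A g j + B g k < w g' (j, k)" if "(j, k) \<in> E" "(j, k) \<notin> T g" for j k
      using off_T[OF that] by (simp add: u_def)
    have "tight_edges E (w g') (A g) (B g) = T g"
      using ab ab' T_sub[of g] by (force simp: tight_edges_def)
    moreover have "dual_feasible E (w g') (A g) (B g)"
      unfolding dual_feasible_def using ab ab' by (auto simp: less_imp_le) (metis less_imp_le order_refl)
    ultimately have "canonical_dual n E (w g') (A g) (B g)"
      using AB[of g] by (simp add: canonical_dual_def T_def)
    with AB[of g'] have eq: "A g' = A g" "B g' = B g"
      by (blast dest: canonical_dual_unique)+
    with \<open>tight_edges E (w g') (A g) (B g) = T g\<close> have "T g' = T g" by (simp add: T_def)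
    moreover have "u g' = u g" using eq by (simp add: u_def)
    ultimately have "X g' e = X g e" if "e \<in> E" for e
      using on_T by (simp add: X_def l_def)
    then show ?thesis unfolding Ev_def g'_def[symmetric] by (intro PiE_cong)
  qed
  interpret P1: finite_product_prob_space "\<lambda>_. exponential_measure 1" E
    by (rule finite_product_prob_space_exponential[OF fin]) simp
  interpret P2: finite_product_prob_space "\<lambda>_. exponential_measure (1/2)" E
    by (rule finite_product_prob_space_exponential[OF fin]) simp
  have X_sets: "X g e \<in> sets borel" for g e
  proof -
    have "{x. cell R x = v} = {x. v \<le> cell R x} - {x. Suc v \<le> cell R x}" for v by auto
    then show ?thesis by (simp add: X_def sets.Diff)
  qed
  have Ev_sets: "Ev g \<in> sets (P k)" for g k
    unfolding Ev_def P_def using X_sets by (intro sets_PiM_I_finite fin) auto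
  have ratio: "measure (P 1) (Ev g) \<le> (1 / 4) ^ n * measure (P (1/2)) (Ev g)" if "9 * real n < D g" for g
  proof -
    \<comment> \<open>What one edge contributes to the comparison of the rates: decay in its dual
      value, and a factor 2 if its cost is prescribed.\<close>
    define f where "f e = (if e \<in> T g then 2 else 1) * exp (- (u g e - \<delta> e) / (2 * R))" for e
    have le: "measure (exponential_measure 1) (X g e) \<le> f e * measure (exponential_measure (1/2)) (X g e)" for e
    proof (cases "e \<in> T g")
      case True
      then have "real (g e) = u g e - \<delta> e" using u_eq[of e g] by (simp add: w_def)
      then show ?thesis
        using measure_cell_eq_ratio[OF R, of "g e"] True by (simp add: f_def X_def)
    next
      case False
      have "u g e - \<delta> e \<le> real (l g e)"
        using l_iff[of g e "l g e"] by simp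
      then have "exp (- real (l g e) / (2 * R)) \<le> f e"
        using False R by (simp add: f_def field_simps)
      then show ?thesis
        using measure_cell_ge_ratio[OF R, of "l g e"] False
        by (simp add: X_def mult_right_mono)
    qed
    have "measure (P 1) (Ev g) = (\<Prod>e\<in>E. measure (exponential_measure 1) (X g e))"
      unfolding Ev_def P_def using X_sets by (intro P1.finite_measure_PiM_emb) auto
    also have "\<dots> \<le> (\<Prod>e\<in>E. f e * measure (exponential_measure (1/2)) (X g e))"
      using le by (intro prod_mono) auto
    also have "\<dots> = (\<Prod>e\<in>E. f e) * measure (P (1/2)) (Ev g)"
      unfolding Ev_def P_def using X_sets by (subst P2.finite_measure_PiM_emb) (auto simp: prod.distrib)
    also have "\<dots> \<le> (1 / 4) ^ n * measure (P (1/2)) (Ev g)"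
    proof (rule mult_right_mono)
      have "(\<Prod>e\<in>E. f e) = (\<Prod>e\<in>E. if e \<in> T g then 2 else 1) * exp (\<Sum>e\<in>E. - (u g e - \<delta> e) / (2 * R))"
        unfolding f_def by (simp add: prod.distrib exp_sum[OF fin])
      also have "(\<Prod>e\<in>E. if e \<in> T g then 2 else 1 :: real) = 2 ^ card (T g)"
        using fin T_sub[of g] by (simp add: prod.If_cases Int_absorb1)
      also have "(\<Sum>e\<in>E. - (u g e - \<delta> e) / (2 * R)) = (\<Sum>e\<in>E. \<delta> e - u g e) / (2 * R)"
        by (simp add: sum_divide_distrib)
      also have "\<dots> = ((\<Sum>e\<in>E. \<delta> e) - R * D g) / (2 * R)"
        using regular_graph_sum[OF reg, of "A g" "B g"]
        by (simp add: sum_subtractf u_def D_def R_def)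
      \<comment> \<open>The offsets sum to at most \<open>R n\<close>, so the exponent is at most
        \<open>(R n - 9 R n) / (2 R) = - 4 n\<close>.\<close>
      also have "2 ^ card (T g) * exp \<dots> \<le> 2 ^ (2 * n) * exp (- 4 * real n)"
      proof (intro mult_mono)
        show "(2::real) ^ card (T g) \<le> 2 ^ (2 * n)"
          using card_tight_edges_le[OF E gen, where g = g and a = "A g" and b = "B g"]
          by (intro power_increasing) (auto simp: T_def w_def)
        have "(\<Sum>e\<in>E. \<delta> e) \<le> (\<Sum>e\<in>E. 1)" using \<delta> by (intro sum_mono) (simp add: less_imp_le)
        also have "\<dots> = R * real n" using regular_graph_card[OF reg] by (simp add: R_def)
        finally have "(\<Sum>e\<in>E. \<delta> e) - R * D g \<le> R * real n - R * (9 * real n)"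
          using that R by (intro diff_mono) auto
        then have "((\<Sum>e\<in>E. \<delta> e) - R * D g) / (2 * R) \<le> - 4 * real n"
          using R by (simp add: field_simps)
        then show "exp (((\<Sum>e\<in>E. \<delta> e) - R * D g) / (2 * R)) \<le> exp (- 4 * real n)" by simp
      qed auto
      also have "\<dots> = (4 * exp (- 4)) ^ n"
      proof -
        have "(2::real) ^ (2 * n) = 4 ^ n" by (simp add: power_mult)
        moreover have "exp (- 4 * real n) = exp (- 4) ^ n"
          using exp_of_nat_mult[of n "- 4 :: real"] by (simp add: mult.commute)
        ultimately show ?thesis by (simp add: power_mult_distrib)
      qed
      also have "\<dots> \<le> (1 / 4) ^ n"
      proof (rule power_mono)
        have "(2::real) ^ 4 \<le> exp 1 ^ 4"
          using exp_ge_add_one_self[of 1] by (intro power_mono) auto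
        also have "exp 1 ^ 4 = exp (4::real)" using exp_of_nat_mult[of 4 "1 :: real"] by simp
        finally have "16 \<le> exp (4::real)" by simp
        then show "4 * exp (- 4) \<le> (1 / 4 :: real)" by (simp add: exp_minus field_simps)
      qed auto
      finally show "(\<Prod>e\<in>E. f e) \<le> (1 / 4) ^ n" .
    qed auto
    finally show ?thesis .
  qed
  \<comment> \<open>A set of events, not a family indexed by \<open>g\<close>: many \<open>g\<close>
    give the same event, and each event may be counted only once.\<close>
  define K where "K = Ev ` {g \<in> E \<rightarrow>\<^sub>E UNIV. 9 * real n < D g}"
  have "countable (E \<rightarrow>\<^sub>E (UNIV :: nat set))" by (intro countable_PiE fin) auto
  then have "countable {g \<in> E \<rightarrow>\<^sub>E UNIV. 9 * real n < D g}"
    by (rule countable_subset[rotated]) blast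
  then have "countable K" unfolding K_def by (rule countable_image)
  have "disjoint_family_on (\<lambda>S. S) K"
    unfolding disjoint_family_on_def
  proof (intro ballI impI, rule ccontr)
    fix S S' assume "S \<in> K" "S' \<in> K" "S \<noteq> S'" "S \<inter> S' \<noteq> {}"
    then obtain g g' c where S: "S = Ev g" "S' = Ev g'" and "c \<in> Ev g" "c \<in> Ev g'"
      unfolding K_def by blast
    then have "Ev g = Ev g'" using same_class[of c g] same_class[of c g'] by simp
    then show False using S \<open>S \<noteq> S'\<close> by simp
  qed
  have K_sets: "S \<in> sets (P k)" if "S \<in> K" for S k
    using that Ev_sets by (auto simp: K_def)
  let ?B = "{c \<in> space (P 1). \<forall>M. perfect_matching n E M \<longrightarrow> 10 * real n / real r < (\<Sum>j<n. c (j, M j))}"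
  have "?B \<subseteq> \<Union>K"
  proof
    fix c assume c: "c \<in> ?B"
    define g where "g = (\<lambda>e\<in>E. cell R (c e))"
    obtain M where M: "perfect_matching n (tight_edges E (w g) (A g) (B g)) M"
      using AB[of g] by (auto simp: canonical_dual_def)
    then have ME: "perfect_matching n E M" by (auto simp: perfect_matching_def tight_edges_def)
    have "10 * real n / R < (\<Sum>j<n. c (j, M j))" using c ME by (auto simp: R_def)
    \<comment> \<open>Each cost is at most the right end of its cell, one cell above the rounded
      value. Over \<open>n\<close> edges this uses up \<open>n\<close> of the \<open>10 * n\<close>
      cells and leaves 9.\<close>
    also have "\<dots> \<le> (\<Sum>j<n. (w g (j, M j) + 1) / R)"
    proof (rule sum_mono)
      fix j assume "j \<in> {..<n}"
      then have "(j, M j) \<in> E" using ME by (auto simp: perfect_matching_def)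
      then have "real (cell R (c (j, M j))) \<le> w g (j, M j)"
        using \<delta>(1)[of "(j, M j)"] by (simp add: w_def g_def)
      then show "c (j, M j) \<le> (w g (j, M j) + 1) / R"
        using le_cell[OF R, of "c (j, M j)"] R by (simp add: field_simps)
    qed
    also have "\<dots> = ((\<Sum>j<n. w g (j, M j)) + real n) / R"
      by (simp add: sum_divide_distrib[symmetric] sum.distrib)
    also have "(\<Sum>j<n. w g (j, M j)) = (\<Sum>j<n. A g j + B g (M j))"
      using M by (intro sum.cong) (auto simp: perfect_matching_def tight_edges_def)
    also have "\<dots> = D g" by (simp add: sum_over_matching[OF M] D_def)
    finally have "9 * real n < D g" using R by (simp add: field_simps)
    moreover have "c \<in> Ev g"
      using c own_class[of c] by (simp add: g_def P_def space_PiM PiE_def)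
    moreover have "g \<in> E \<rightarrow>\<^sub>E UNIV" by (simp add: g_def)
    ultimately show "c \<in> \<Union>K" unfolding K_def by blast
  qed
  have "measure (P 1) ?B \<le> measure (P 1) (\<Union>K)"
    using \<open>?B \<subseteq> \<Union>K\<close> \<open>countable K\<close> K_sets unfolding P_def
    by (intro P1.finite_measure_mono sets.countable_Union) auto
  also have "\<dots> \<le> (1 / 4) ^ n"
  proof -
    have "emeasure (P 1) (\<Union>K) = (\<integral>\<^sup>+ S. emeasure (P 1) S \<partial>count_space K)"
      using emeasure_UN_countable[of K "\<lambda>S. S" "P 1"] K_sets \<open>countable K\<close> \<open>disjoint_family_on (\<lambda>S. S) K\<close> by simp
    also have "\<dots> \<le> (\<integral>\<^sup>+ S. ennreal ((1 / 4) ^ n) * emeasure (P (1/2)) S \<partial>count_space K)"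
    proof (rule nn_integral_mono)
      fix S assume "S \<in> space (count_space K)"
      then obtain g where g: "S = Ev g" "9 * real n < D g" by (auto simp: K_def)
      show "emeasure (P 1) S \<le> ennreal ((1 / 4) ^ n) * emeasure (P (1/2)) S"
        using ratio[OF g(2)] unfolding g(1) P_def
        by (simp add: P1.emeasure_eq_measure P2.emeasure_eq_measure ennreal_mult[symmetric] ennreal_leI)
    qed
    also have "\<dots> = ennreal ((1 / 4) ^ n) * (\<integral>\<^sup>+ S. emeasure (P (1/2)) S \<partial>count_space K)"
      by (rule nn_integral_cmult) simp
    also have "(\<integral>\<^sup>+ S. emeasure (P (1/2)) S \<partial>count_space K) = emeasure (P (1/2)) (\<Union>K)"
      using emeasure_UN_countable[of K "\<lambda>S. S" "P (1/2)"] K_sets \<open>countable K\<close> \<open>disjoint_family_on (\<lambda>S. S) K\<close> by simp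
    also have "ennreal ((1 / 4) ^ n) * \<dots> \<le> ennreal ((1 / 4) ^ n) * 1"
      unfolding P_def by (intro mult_left_mono P2.emeasure_le_1) auto
    finally show ?thesis
      unfolding P_def by (simp add: P1.emeasure_eq_measure)
  qed
  finally show ?thesis .
qed

section \<open>The lower bound\<close>

lemma prob_space_exp_array: "prob_space (exp_array d n)"
proof -
  interpret finite_product_prob_space "\<lambda>_. exponential_measure 1" "positions d n"
    by (rule finite_product_prob_space_exponential) (auto intro: finite_positions)
  show ?thesis unfolding exp_array_def by unfold_locales
qed

lemma measurable_exp_array_component [measurable]:
  assumes "ix \<in> positions d n"
  shows "(\<lambda>C. C ix) \<in> borel_measurable (exp_array d n)"
proof -
  have "(\<lambda>C. C ix) \<in> measurable (exp_array d n) (exponential_measure 1)"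
    using assms unfolding exp_array_def by measurable
  then show ?thesis by simp
qed

lemma card_positions: "card (positions d n) = n ^ d"
proof -
  have "positions d n = {xs. set xs \<subseteq> {..<n} \<and> length xs = d}" by (auto simp: positions_def)
  then show ?thesis using card_lists_length_eq[of "{..<n}" d] by simp
qed

lemma Cons_positions: "v # jx \<in> positions (Suc d) n \<longleftrightarrow> v < n \<and> jx \<in> positions d n"
  by (auto simp: positions_def)

lemma positions_Suc: "positions (Suc d) n = (\<lambda>(v, jx). v # jx) ` ({..<n} \<times> positions d n)"
proof (intro equalityI subsetI)
  fix ix assume "ix \<in> positions (Suc d) n"
  then show "ix \<in> (\<lambda>(v, jx). v # jx) ` ({..<n} \<times> positions d n)"
    by (cases ix) (auto simp: positions_def)
qed (auto simp: Cons_positions)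

lemma sum_positions_Suc: "(\<Sum>ix\<in>positions (Suc d) n. g ix) = (\<Sum>v<n. \<Sum>jx\<in>positions d n. g (v # jx))"
proof -
  have "(\<Sum>ix\<in>positions (Suc d) n. g ix) = (\<Sum>(v, jx)\<in>{..<n} \<times> positions d n. g (v # jx))"
    unfolding positions_Suc by (subst sum.reindex) (auto simp: inj_on_def split_def)
  then show ?thesis by (simp add: sum.cartesian_product)
qed

text \<open>Lines in the first direction are indexed by the other coordinates \<open>jx\<close>, and
  \<open>f jx\<close> is the value chosen there. As \<open>f\<close> is independent of
  \<open>C\<close>, a union bound may run over all selections.\<close>

lemma assignment_cost_eq_selection:
  assumes X: "axial_assignment (Suc d) n X" and "0 < n"
  obtains f where "f \<in> positions d n \<rightarrow>\<^sub>E {..<n}"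
    "\<And>C. assignment_cost (Suc d) n C X = (\<Sum>jx\<in>positions d n. C (f jx # jx))"
proof -
  have ex: "\<exists>!v. v < n \<and> X (v # jx) = 1" if "jx \<in> positions d n" for jx
  proof -
    have "0 # jx \<in> positions (Suc d) n" using that \<open>0 < n\<close> by (simp add: Cons_positions)
    then have "\<exists>!v. v < n \<and> X ((0 # jx)[0 := v]) = 1"
      using X unfolding axial_assignment_def by blast
    then show ?thesis by simp
  qed
  define f where "f = (\<lambda>jx\<in>positions d n. THE v. v < n \<and> X (v # jx) = 1)"
  have f: "f jx < n" "X (f jx # jx) = 1" if "jx \<in> positions d n" for jx
    using theI'[OF ex[OF that]] that by (simp_all add: f_def)
  have X_eq: "real (X (v # jx)) = of_bool (v = f jx)" if "jx \<in> positions d n" "v < n" for v jx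
  proof (cases "v = f jx")
    case False
    then have "X (v # jx) \<noteq> 1" using ex[OF that(1)] f[OF that(1)] that by blast
    moreover have "X (v # jx) \<in> {0, 1}"
      using X that by (simp add: axial_assignment_def Cons_positions)
    ultimately show ?thesis using False by auto
  qed (use f[OF that(1)] in auto)
  have "assignment_cost (Suc d) n C X = (\<Sum>jx\<in>positions d n. C (f jx # jx))" for C
  proof -
    have "assignment_cost (Suc d) n C X = (\<Sum>v<n. \<Sum>jx\<in>positions d n. real (X (v # jx)) * C (v # jx))"
      by (simp add: assignment_cost_def sum_positions_Suc)
    also have "\<dots> = (\<Sum>jx\<in>positions d n. \<Sum>v<n. if f jx = v then C (v # jx) else 0)"
      by (subst sum.swap, intro sum.cong) (auto simp: X_eq)
    also have "\<dots> = (\<Sum>jx\<in>positions d n. C (f jx # jx))"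
      by (intro sum.cong refl, subst sum.delta') (auto simp: f)
    finally show ?thesis .
  qed
  moreover have "f \<in> positions d n \<rightarrow>\<^sub>E {..<n}" using f by (auto simp: f_def)
  ultimately show ?thesis using that by blast
qed

lemma measurable_axial_min [measurable]: "axial_min d n \<in> borel_measurable (exp_array d n)"
proof -
  define F where "F = {X \<in> positions d n \<rightarrow>\<^sub>E {0, 1}. axial_assignment d n X}"
  have "finite F" unfolding F_def
    by (rule finite_subset[of _ "positions d n \<rightarrow>\<^sub>E {0, 1}"]) (auto intro!: finite_PiE finite_positions)
  have restr: "restrict X (positions d n) \<in> F" "assignment_cost d n C X = assignment_cost d n C (restrict X (positions d n))"
    if X: "axial_assignment d n X" for X C
  proof -
    \<comment> \<open>Lines do not leave \<open>positions d n\<close>, so restricting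
      \<open>X\<close> preserves the assignment property and only finitely many candidates
      remain.\<close>
    have "ix[p := v] \<in> positions d n" if "ix \<in> positions d n" "v < n" for ix p v
      using that set_update_subset_insert[of ix p v] by (auto simp: positions_def)
    then show "restrict X (positions d n) \<in> F"
      using X unfolding F_def axial_assignment_def by (auto cong: conj_cong)
  qed (simp add: assignment_cost_def)
  have "{assignment_cost d n C X |X. axial_assignment d n X} = (\<lambda>X. assignment_cost d n C X) ` F" for C
  proof (intro equalityI subsetI)
    fix y assume "y \<in> {assignment_cost d n C X |X. axial_assignment d n X}"
    then show "y \<in> (\<lambda>X. assignment_cost d n C X) ` F" using restr by blast
  qed (auto simp: F_def)
  then have "axial_min d n = (\<lambda>C. Min ((\<lambda>X. assignment_cost d n C X) ` F))"
    by (simp add: axial_min_def fun_eq_iff)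
  moreover have "(\<lambda>C. assignment_cost d n C X) \<in> borel_measurable (exp_array d n)" for X
    unfolding assignment_cost_def by measurable
  ultimately show ?thesis
    using borel_measurable_Min[OF \<open>finite F\<close>, of "\<lambda>X C. assignment_cost d n C X" "exp_array d n"] by simp
qed

text \<open>Exponential tilting: \<open>exp (- t * x)\<close> times the density of rate 1 is
  \<open>1 / (1 + t)\<close> times the density of rate \<open>1 + t\<close>.\<close>

lemma exponential_moment:
  assumes "0 \<le> t"
  shows "(\<integral>\<^sup>+ x. ennreal (exp (- t * x)) \<partial>exponential_measure 1) = ennreal (1 / (1 + t))"
proof -
  interpret prob_space "exponential_measure (1 + t)"
    by (rule prob_space_exponential_density) (use assms in simp)
  have "(\<integral>\<^sup>+ x. ennreal (exp (- t * x)) \<partial>exponential_measure 1) =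
      (\<integral>\<^sup>+ x. ennreal (1 / (1 + t)) * ennreal (exponential_density (1 + t) x) \<partial>lborel)"
  proof (subst nn_integral_density)
    show "(\<integral>\<^sup>+ x. ennreal (exponential_density 1 x) * ennreal (exp (- t * x)) \<partial>lborel) =
       (\<integral>\<^sup>+ x. ennreal (1 / (1 + t)) * ennreal (exponential_density (1 + t) x) \<partial>lborel)"
    proof (rule nn_integral_cong)
      fix x :: real
      have "exponential_density 1 x * exp (- t * x) = 1 / (1 + t) * exponential_density (1 + t) x"
      proof -
        have "exp (- x) * exp (- t * x) = exp (- (x * (1 + t)))"
          by (simp add: exp_add[symmetric] algebra_simps)
        then show ?thesis using assms by (simp add: exponential_density_def)
      qed
      then show "ennreal (exponential_density 1 x) * ennreal (exp (- t * x)) =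
          ennreal (1 / (1 + t)) * ennreal (exponential_density (1 + t) x)"
        using assms by (simp add: ennreal_mult[symmetric] exponential_density_nonneg)
    qed
  qed auto
  also have "\<dots> = ennreal (1 / (1 + t)) * emeasure (exponential_measure (1 + t)) UNIV"
    by (subst nn_integral_cmult) (auto simp: emeasure_density)
  finally show ?thesis using emeasure_space_1 by simp
qed

text \<open>Markov's inequality for the exponential of \<open>t\<close> times \<open>s\<close> minus
  the sum; coordinates outside \<open>Q\<close> contribute factors 1 to the product
  integral.\<close>

lemma exponential_sum_lower_tail:
  assumes fin: "finite I" and Q: "Q \<subseteq> I" and t: "0 \<le> t"
  defines "P \<equiv> Pi\<^sub>M I (\<lambda>_. exponential_measure 1)"
  shows "measure P {C \<in> space P. (\<Sum>i\<in>Q. C i) \<le> s} \<le> exp (t * s) / (1 + t) ^ card Q"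
proof -
  interpret finite_product_prob_space "\<lambda>_. exponential_measure 1" I
    by (rule finite_product_prob_space_exponential) (use fin in auto)
  have finQ: "finite Q" using Q fin by (rule finite_subset)
  have [measurable]: "(\<lambda>C. C i) \<in> borel_measurable P" if "i \<in> I" for i
  proof -
    have "(\<lambda>C. C i) \<in> measurable P (exponential_measure 1)"
      using that unfolding P_def by measurable
    then show ?thesis by simp
  qed
  have [measurable]: "(\<lambda>C. \<Sum>i\<in>Q. C i) \<in> borel_measurable P"
    using Q by (intro borel_measurable_sum) (auto intro: \<open>\<And>i. i \<in> I \<Longrightarrow> _\<close>)
  have "emeasure P {C \<in> space P. (\<Sum>i\<in>Q. C i) \<le> s}
      \<le> emeasure P {C \<in> space P. 1 \<le> ennreal (exp (t * s)) * ennreal (exp (- t * (\<Sum>i\<in>Q. C i)))}"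
  proof (rule emeasure_mono)
    show "{C \<in> space P. (\<Sum>i\<in>Q. C i) \<le> s} \<subseteq> {C \<in> space P. 1 \<le> ennreal (exp (t * s)) * ennreal (exp (- t * (\<Sum>i\<in>Q. C i)))}"
      using t by (auto simp: ennreal_mult[symmetric] exp_add[symmetric] mult_left_mono)
  qed measurable
  also have "\<dots> \<le> ennreal (exp (t * s)) * (\<integral>\<^sup>+ C. ennreal (exp (- t * (\<Sum>i\<in>Q. C i))) * indicator (space P) C \<partial>P)"
    by (rule nn_integral_Markov_inequality) measurable
  also have "(\<integral>\<^sup>+ C. ennreal (exp (- t * (\<Sum>i\<in>Q. C i))) * indicator (space P) C \<partial>P)
     = (\<integral>\<^sup>+ C. (\<Prod>i\<in>I. if i \<in> Q then ennreal (exp (- t * C i)) else 1) \<partial>P)"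
  proof (rule nn_integral_cong)
    fix C assume "C \<in> space P"
    have "(\<Prod>i\<in>I. if i \<in> Q then ennreal (exp (- t * C i)) else 1) = (\<Prod>i\<in>Q. ennreal (exp (- t * C i)))"
      using fin Q by (simp add: prod.If_cases Int_absorb1)
    also have "\<dots> = ennreal (exp (- t * (\<Sum>i\<in>Q. C i)))"
      by (simp add: prod_ennreal exp_sum[OF finQ] sum_distrib_left)
    finally show "ennreal (exp (- t * (\<Sum>i\<in>Q. C i))) * indicator (space P) C
       = (\<Prod>i\<in>I. if i \<in> Q then ennreal (exp (- t * C i)) else 1)"
      using \<open>C \<in> space P\<close> by simp
  qed
  also have "\<dots> = (\<Prod>i\<in>I. \<integral>\<^sup>+ x. (if i \<in> Q then ennreal (exp (- t * x)) else 1) \<partial>exponential_measure 1)"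
    unfolding P_def by (rule product_nn_integral_prod[OF fin]) auto
  also have "\<dots> = (\<Prod>i\<in>I. if i \<in> Q then ennreal (1 / (1 + t)) else 1)"
    using exponential_moment[OF t] M.emeasure_space_1 by (intro prod.cong) auto
  also have "\<dots> = ennreal (1 / (1 + t)) ^ card Q"
    using fin Q by (simp add: prod.If_cases Int_absorb1)
  also have "ennreal (exp (t * s)) * \<dots> = ennreal (exp (t * s) / (1 + t) ^ card Q)"
    using t by (simp add: ennreal_power ennreal_mult[symmetric] power_one_over)
  finally show ?thesis
    using t unfolding P_def by (subst (asm) emeasure_eq_measure) simp
qed

text \<open>Here \<open>d\<close> is the dimension minus 2, so the exponents are free of truncated
  subtraction.\<close>

lemma axial_min_lower_tail:
  assumes "0 < n"
  shows "\<P>(C in exp_array (Suc (Suc d)) n. axial_min (Suc (Suc d)) n C < 1/4 * real n ^ d) \<le> (3 / 4) ^ n ^ Suc d"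
proof -
  define N where "N = n ^ Suc d"
  define F where "F = positions (Suc d) n \<rightarrow>\<^sub>E {..<n}"
  define s where "s = 1/4 * real n ^ d"
  let ?P = "exp_array (Suc (Suc d)) n"
  interpret prob_space ?P by (rule prob_space_exp_array)
  have fin: "finite F" unfolding F_def by (intro finite_PiE finite_positions) auto
  have cardF: "card F = n ^ N"
    by (simp add: F_def card_PiE finite_positions card_positions N_def del: power_Suc)
  define S where "S f = {C \<in> space ?P. (\<Sum>jx\<in>positions (Suc d) n. C (f jx # jx)) \<le> s}" for f
  have S_sets: "S f \<in> sets ?P" if "f \<in> F" for f
    unfolding S_def using that
    by (intro borel_measurable_le borel_measurable_sum measurable_exp_array_component borel_measurable_const)
       (auto simp: F_def Cons_positions)
  have S_le: "prob (S f) \<le> exp (4 * real n * s) / (1 + 4 * real n) ^ N" if "f \<in> F" for f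
  proof -
    define Q where "Q = (\<lambda>jx. f jx # jx) ` positions (Suc d) n"
    have inj: "inj_on (\<lambda>jx. f jx # jx) (positions (Suc d) n)" by (auto simp: inj_on_def)
    have "card Q = N" unfolding Q_def by (simp add: card_image[OF inj] card_positions N_def)
    moreover have "Q \<subseteq> positions (Suc (Suc d)) n" using that by (auto simp: Q_def F_def Cons_positions)
    moreover have "(\<Sum>jx\<in>positions (Suc d) n. C (f jx # jx)) = (\<Sum>i\<in>Q. C i)" for C :: "nat list \<Rightarrow> real"
      unfolding Q_def by (simp add: sum.reindex[OF inj])
    ultimately show ?thesis
      \<comment> \<open>With \<open>t = 4 * real n\<close> the exponent \<open>t * s\<close> is
        exactly \<open>N\<close>, one unit for each selected entry.\<close>
      using exponential_sum_lower_tail[OF finite_positions, of Q "Suc (Suc d)" n "4 * real n" s]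
      by (simp add: S_def exp_array_def)
  qed
  have "prob {C \<in> space ?P. axial_min (Suc (Suc d)) n C < s} \<le> prob (\<Union>f\<in>F. S f)"
  proof (rule finite_measure_mono)
    show "{C \<in> space ?P. axial_min (Suc (Suc d)) n C < s} \<subseteq> (\<Union>f\<in>F. S f)"
    proof safe
      fix C assume C: "C \<in> space ?P" "axial_min (Suc (Suc d)) n C < s"
      obtain X where X: "axial_assignment (Suc (Suc d)) n X"
        "axial_min (Suc (Suc d)) n C = assignment_cost (Suc (Suc d)) n C X"
        by (rule axial_min_attained)
      obtain f where "f \<in> F" "assignment_cost (Suc (Suc d)) n C X = (\<Sum>jx\<in>positions (Suc d) n. C (f jx # jx))"
        using assignment_cost_eq_selection[OF X(1) \<open>0 < n\<close>] unfolding F_def by metis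
      then show "C \<in> (\<Union>f\<in>F. S f)" using C X(2) by (force simp: S_def)
    qed
    show "(\<Union>f\<in>F. S f) \<in> sets ?P" using fin S_sets by (intro sets.finite_UN) auto
  qed
  also have "\<dots> \<le> (\<Sum>f\<in>F. prob (S f))"
    using fin S_sets by (intro finite_measure_subadditive_finite) auto
  also have "\<dots> \<le> (\<Sum>f\<in>F. exp (4 * real n * s) / (1 + 4 * real n) ^ N)"
    by (intro sum_mono S_le)
  also have "\<dots> = real n ^ N * (exp (real N) / (1 + 4 * real n) ^ N)"
    by (simp add: cardF s_def N_def mult.assoc)
  also have "\<dots> = (real n * exp 1 / (1 + 4 * real n)) ^ N"
    using exp_of_nat_mult[of N "1 :: real"] by (simp add: power_mult_distrib power_divide)
  also have "\<dots> \<le> (3 / 4) ^ N"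
  proof (rule power_mono)
    have "real n * exp 1 \<le> real n * 3" using exp_le by (intro mult_left_mono) auto
    then show "real n * exp 1 / (1 + 4 * real n) \<le> 3 / 4" by (simp add: field_simps)
  qed auto
  finally show ?thesis by (simp add: s_def N_def)
qed

lemma axial_min_lower_bound_whp:
  assumes "d \<ge> 3"
  shows "(\<lambda>n. \<P>(C in exp_array d n. axial_min d n C \<ge> 1/4 * real n ^ (d - 2))) \<longlonglongrightarrow> 1"
proof (rule tendsto_sandwich)
  obtain e where d: "d = Suc (Suc e)" using assms by (metis Suc_le_D numeral_3_eq_3 Suc_le_mono)
  show "\<forall>\<^sub>F n in sequentially. 1 - (3 / 4) ^ n \<le> \<P>(C in exp_array d n. axial_min d n C \<ge> 1/4 * real n ^ (d - 2))"
  proof (rule eventually_sequentiallyI)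
    fix n :: nat assume "1 \<le> n"
    interpret prob_space "exp_array d n" by (rule prob_space_exp_array)
    have "n ^ 1 \<le> n ^ Suc e" using \<open>1 \<le> n\<close> by (intro power_increasing) auto
    then have "(3 / 4 :: real) ^ n ^ Suc e \<le> (3 / 4) ^ n" by (intro power_decreasing) auto
    then have "prob {C \<in> space (exp_array d n). axial_min d n C < 1/4 * real n ^ (d - 2)} \<le> (3 / 4) ^ n"
      using order_trans[OF axial_min_lower_tail[of n e]] \<open>1 \<le> n\<close> by (simp add: d)
    moreover have "prob {C \<in> space (exp_array d n). \<not> axial_min d n C < 1/4 * real n ^ (d - 2)}
       = 1 - prob {C \<in> space (exp_array d n). axial_min d n C < 1/4 * real n ^ (d - 2)}"
      by (rule prob_neg) measurable
    ultimately show "1 - (3 / 4) ^ n \<le> prob {C \<in> space (exp_array d n). axial_min d n C \<ge> 1/4 * real n ^ (d - 2)}"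
      by (simp add: not_less)
  qed
  show "\<forall>\<^sub>F n in sequentially. \<P>(C in exp_array d n. axial_min d n C \<ge> 1/4 * real n ^ (d - 2)) \<le> 1"
    using prob_space.prob_le_1[OF prob_space_exp_array] by simp
  show "(\<lambda>n. 1 - (3 / 4) ^ n :: real) \<longlonglongrightarrow> 1"
    by (rule tendsto_eq_intros LIMSEQ_power_zero refl | simp)+
qed simp

section \<open>Alternating trees\<close>

definition matched where
  "matched n E w p a b m c \<longleftrightarrow>
     (\<forall>j<p. (j, m j) \<in> E \<and> c (m j) = Suc j \<and> a j + b (m j) = (w (j, m j) :: real)) \<and>
     (\<forall>k<n. c k \<noteq> 0 \<longrightarrow> c k \<le> p \<and> m (c k - 1) = (k :: nat))"

text \<open>While rows are inserted one by one, the rows from \<open>p\<close> on still carry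
  arbitrary duals, so they are exempt.\<close>

definition feasible_below where
  "feasible_below E w p a b \<longleftrightarrow> (\<forall>(j, k)\<in>E. j < p \<longrightarrow> a j + b k \<le> (w (j, k) :: real))"

text \<open>\<open>S\<close> and \<open>T\<close> are the rows and columns of the alternating tree grown from row \<open>p\<close>, \<open>c k\<close> is the
  successor of the row matched to column \<open>k\<close> (or 0), and \<open>P k\<close> is the row from which column \<open>k\<close> was
  reached. The function \<open>ord\<close> witnesses that following parents and mates leads back to the root.\<close>

definition tree_inv where
  "tree_inv n E w p a b m c S T P \<longleftrightarrow>
     matched n E w p a b m c \<and> feasible_below E w (if T = {} then p else Suc p) a b \<and>
     T \<subseteq> {..<n} \<and> (\<forall>k\<in>T. c k \<noteq> 0) \<and> S = insert p ((\<lambda>k. c k - 1) ` T) \<and>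
     (\<exists>ord :: nat \<Rightarrow> nat. \<forall>k\<in>T. P k \<in> S \<and> (P k, k) \<in> E \<and> a (P k) + b k = w (P k, k) \<and>
        (P k \<noteq> p \<longrightarrow> ord (m (P k)) < ord k) \<and> ord k < card T)"

text \<open>The state in the middle of an augmentation. Column \<open>y\<close> is the one to be
  given to its parent row; its entry \<open>c y\<close> may be stale and is exempt. \<open>D\<close>
  consists of columns ranked by \<open>ord\<close>. Those ranked above \<open>v\<close> may have
  been rematched already, so the path data are claimed only up to \<open>v\<close>, which also
  bounds the steps still to come.\<close>

definition augment_inv where
  "augment_inv n E w p a b m c P y v \<longleftrightarrow>
     y < n \<and> (\<forall>j<p. (j, m j) \<in> E \<and> m j \<noteq> y \<and> c (m j) = Suc j \<and> a j + b (m j) = (w (j, m j) :: real)) \<and>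
     (\<forall>k<n. k \<noteq> y \<and> c k \<noteq> 0 \<longrightarrow> c k \<le> p \<and> m (c k - 1) = k) \<and>
     (\<exists>D (ord :: nat \<Rightarrow> nat). y \<in> D \<and> ord y = v \<and>
        (\<forall>k\<in>D. ord k \<le> v \<longrightarrow> P k \<le> p \<and> (P k, k) \<in> E \<and> a (P k) + b k = w (P k, k) \<and>
           (P k \<noteq> p \<longrightarrow> m (P k) \<in> D \<and> ord (m (P k)) < ord k)))"

lemma tree_inv_initial:
  "matched n E w p a b m c \<Longrightarrow> feasible_below E w p a b \<Longrightarrow> tree_inv n E w p a b m c {p} {} P"
  by (simp add: tree_inv_def)

lemma tree_inv_S_le:
  assumes "tree_inv n E w p a b m c S T P" "j \<in> S"
  shows "j \<le> p"
proof -
  have "c k \<le> p" if "k \<in> T" for k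
    using assms(1) that by (auto simp: tree_inv_def matched_def)
  then show ?thesis using assms by (force simp: tree_inv_def)
qed

text \<open>This is why a dual shift keeps matched edges tight: both ends move or neither
  does.\<close>

lemma tree_inv_mate:
  assumes "tree_inv n E w p a b m c S T P" "j < p"
  shows "m j \<in> T \<longleftrightarrow> j \<in> S"
proof
  assume "m j \<in> T"
  moreover have "c (m j) = Suc j" using assms by (auto simp: tree_inv_def matched_def)
  ultimately show "j \<in> S" using assms(1) by (force simp: tree_inv_def image_iff)
next
  assume "j \<in> S"
  then obtain k where "k \<in> T" "j = c k - 1" using assms by (auto simp: tree_inv_def)
  then show "m j \<in> T" using assms(1) by (auto simp: tree_inv_def matched_def)
qed

text \<open>The tree has one row more than columns, so by regularity more edges start in
  \<open>S\<close> than end in \<open>T\<close>.\<close>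

lemma tree_inv_frontier:
  assumes reg: "regular_graph n r E" and "0 < r" and inv: "tree_inv n E w p a b m c S T P" and "p < n"
  shows "\<exists>x\<in>S. \<exists>y. y \<notin> T \<and> (x, y) \<in> E"
proof (rule ccontr)
  assume no: "\<not> ?thesis"
  have T: "T \<subseteq> {..<n}" and S: "S = insert p ((\<lambda>k. c k - 1) ` T)"
    and mc: "\<And>k. k \<in> T \<Longrightarrow> c k \<noteq> 0 \<and> c k \<le> p \<and> m (c k - 1) = k"
    using inv by (auto simp: tree_inv_def matched_def)
  have fin: "finite T" using T by (rule finite_subset) auto
  have S_sub: "S \<subseteq> {..<n}" using tree_inv_S_le[OF inv] \<open>p < n\<close> by fastforce
  have "inj_on (\<lambda>k. c k - 1) T" by (intro inj_onI) (metis mc)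
  moreover have "p \<notin> (\<lambda>k. c k - 1) ` T" using mc by force
  ultimately have card: "card S = Suc (card T)" using fin by (simp add: S card_image)
  \<comment> \<open>Indicators as potentials: the sum equals \<open>r\<close> times
    \<open>card S - card T\<close>, hence \<open>r\<close>, while no edge contributes a positive
    amount if every edge from \<open>S\<close> ends in \<open>T\<close>.\<close>
  have "(\<Sum>(j, k)\<in>E. of_bool (j \<in> S) + - of_bool (k \<in> T) :: real) \<le> 0"
  proof (rule sum_nonpos)
    fix e assume "e \<in> E"
    then have "snd e \<in> T" if "fst e \<in> S" using no that by (cases e) auto
    then show "(case e of (j, k) \<Rightarrow> of_bool (j \<in> S) + - of_bool (k \<in> T)) \<le> (0 :: real)"
      by (cases e) auto
  qed
  then have "real r * ((\<Sum>j<n. of_bool (j \<in> S)) + (\<Sum>k<n. - of_bool (k \<in> T))) \<le> 0"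
    by (subst (asm) regular_graph_sum[OF reg])
  then have "(\<Sum>j<n. of_bool (j \<in> S)) + (\<Sum>k<n. - of_bool (k \<in> T)) \<le> (0 :: real)"
    using \<open>0 < r\<close> by (simp add: mult_le_0_iff)
  moreover have "(\<Sum>j<n. of_bool (j \<in> A)) = real (card A)" if "A \<subseteq> {..<n}" for A
    using that by (simp add: of_bool_def sum.If_cases Int_absorb1)
  ultimately show False using S_sub T card by (simp add: sum_negf)
qed

text \<open>Edges inside the tree keep their sum, edges leaving it lose no more than their slack,
  and edges from other rows into \<open>T\<close> gain slack, as \<open>\<theta>\<close> is
  nonnegative once \<open>T\<close> is nonempty. For empty \<open>T\<close> no column dual moves, so
  a negative \<open>\<theta>\<close> concerns row \<open>p\<close> alone.\<close>

lemma tree_inv_shift: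
  assumes inv: "tree_inv n E w p a b m c S T P"
    and x: "x \<in> S" and y: "y \<notin> T" "(x, y) \<in> E" and \<theta>: "\<theta> = w (x, y) - a x - b y"
    and min: "\<And>j k. j \<in> S \<Longrightarrow> k \<notin> T \<Longrightarrow> (j, k) \<in> E \<Longrightarrow> \<theta> \<le> w (j, k) - a j - b k"
  defines "a' \<equiv> \<lambda>j. if j \<in> S then a j + \<theta> else a j"
    and "b' \<equiv> \<lambda>k. if k \<in> T then b k - \<theta> else b k"
  shows "tree_inv n E w p a' b' m c S T P" "feasible_below E w (Suc p) a' b'" "a' x + b' y = w (x, y)"
proof -
  have feas: "a j + b k \<le> w (j, k)" if "(j, k) \<in> E" "j < p \<or> j = p \<and> T \<noteq> {}" for j k
    using inv that by (auto simp: tree_inv_def feasible_below_def split: if_splits)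
  have \<theta>_nonneg: "0 \<le> \<theta>" if "T \<noteq> {}"
    using feas[OF y(2)] tree_inv_S_le[OF inv x] that by (force simp: \<theta>)
  have "p \<in> S" using inv by (simp add: tree_inv_def)
  show feas': "feasible_below E w (Suc p) a' b'"
    unfolding feasible_below_def
  proof clarify
    fix j k assume jk: "(j, k) \<in> E" "j < Suc p"
    consider "j \<in> S" "k \<notin> T" | "j \<in> S" "k \<in> T" | "j \<notin> S" by blast
    then show "a' j + b' k \<le> w (j, k)"
    proof cases
      case 1
      then show ?thesis using min[OF 1 jk(1)] by (simp add: a'_def b'_def)
    next
      case 2
      then show ?thesis using feas[OF jk(1)] jk(2) by (force simp: a'_def b'_def)
    next
      case 3
      then have "j < p" using jk \<open>p \<in> S\<close> by (cases "j = p") auto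
      then show ?thesis using 3 feas[OF jk(1)] \<theta>_nonneg by (force simp: a'_def b'_def)
    qed
  qed
  show "a' x + b' y = w (x, y)" using x y by (simp add: a'_def b'_def \<theta>)
  have "a' j + b' (m j) = a j + b (m j)" if "j < p" for j
    using tree_inv_mate[OF inv that] by (simp add: a'_def b'_def)
  then have "matched n E w p a' b' m c" using inv by (simp add: tree_inv_def matched_def)
  moreover have "feasible_below E w (if T = {} then p else Suc p) a' b'"
    using feas' by (auto simp: feasible_below_def)
  moreover have "\<exists>ord :: nat \<Rightarrow> nat. \<forall>k\<in>T. P k \<in> S \<and> (P k, k) \<in> E \<and> a' (P k) + b' k = w (P k, k) \<and>
      (P k \<noteq> p \<longrightarrow> ord (m (P k)) < ord k) \<and> ord k < card T"
  proof -
    obtain ord :: "nat \<Rightarrow> nat" where ord: "\<And>k. k \<in> T \<Longrightarrow> P k \<in> S \<and> (P k, k) \<in> E \<and> a (P k) + b k = w (P k, k) \<and>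
        (P k \<noteq> p \<longrightarrow> ord (m (P k)) < ord k) \<and> ord k < card T"
      using inv unfolding tree_inv_def by blast
    show ?thesis using ord by (intro exI[of _ ord]) (simp add: a'_def b'_def)
  qed
  ultimately show "tree_inv n E w p a' b' m c S T P"
    using inv unfolding tree_inv_def by blast
qed

text \<open>The new column gets rank \<open>card T\<close>, above all earlier ranks, so parents and
  mates always lead to older columns.\<close>

lemma tree_inv_grow:
  assumes inv: "tree_inv n E w p a b m c S T P" and feas: "feasible_below E w (Suc p) a b"
    and x: "x \<in> S" and y: "y \<notin> T" "y < n" "(x, y) \<in> E" "a x + b y = w (x, y)" and "c y \<noteq> 0"
  shows "tree_inv n E w p a b m c (insert (c y - 1) S) (insert y T) (P(y := x))"
proof -
  obtain ord :: "nat \<Rightarrow> nat" where ord: "\<And>k. k \<in> T \<Longrightarrow> P k \<in> S \<and> (P k, k) \<in> E \<and> a (P k) + b k = w (P k, k) \<and>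
        (P k \<noteq> p \<longrightarrow> ord (m (P k)) < ord k) \<and> ord k < card T"
    using inv unfolding tree_inv_def by blast
  have fin: "finite T" using inv by (auto simp: tree_inv_def intro: finite_subset)
  have mate: "m j \<in> T" if "j \<in> S" "j \<noteq> p" for j
    using tree_inv_mate[OF inv, of j] tree_inv_S_le[OF inv that(1)] that by auto
  define ord' where "ord' = ord(y := card T)"
  have "(P(y := x)) k \<in> insert (c y - 1) S \<and> ((P(y := x)) k, k) \<in> E \<and>
      a ((P(y := x)) k) + b k = w ((P(y := x)) k, k) \<and>
      ((P(y := x)) k \<noteq> p \<longrightarrow> ord' (m ((P(y := x)) k)) < ord' k) \<and> ord' k < card (insert y T)"
    if k: "k \<in> insert y T" for k
  proof (cases "k = y")
    case True
    have "ord' (m x) < card T" if "x \<noteq> p"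
      using mate[OF x that] ord[of "m x"] y(1) by (auto simp: ord'_def)
    then show ?thesis using True x y fin by (auto simp: ord'_def)
  next
    case False
    then have "k \<in> T" using k by simp
    moreover have "m (P k) \<noteq> y" if "P k \<noteq> p"
      using mate[of "P k"] ord[OF \<open>k \<in> T\<close>] that y(1) by auto
    ultimately show ?thesis
      using False ord[of k] fin y(1) by (auto simp: ord'_def)
  qed
  then have "\<exists>ord :: nat \<Rightarrow> nat. \<forall>k\<in>insert y T. (P(y := x)) k \<in> insert (c y - 1) S \<and> ((P(y := x)) k, k) \<in> E \<and>
      a ((P(y := x)) k) + b k = w ((P(y := x)) k, k) \<and>
      ((P(y := x)) k \<noteq> p \<longrightarrow> ord (m ((P(y := x)) k)) < ord k) \<and> ord k < card (insert y T)"
    by blast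
  moreover have "insert (c y - 1) S = insert p ((\<lambda>k. c k - 1) ` insert y T)"
    using inv by (auto simp: tree_inv_def)
  moreover have "matched n E w p a b m c" "insert y T \<subseteq> {..<n}" "\<forall>k\<in>insert y T. c k \<noteq> 0"
    using inv y(2) \<open>c y \<noteq> 0\<close> by (auto simp: tree_inv_def)
  moreover have "feasible_below E w (if insert y T = {} then p else Suc p) a b" using feas by simp
  ultimately show ?thesis unfolding tree_inv_def by blast
qed

text \<open>A free column at the border of the tree ends an augmenting path. Its rank
  \<open>card T\<close> bounds the number of rematchings by \<open>n\<close>.\<close>

lemma tree_inv_augment:
  assumes inv: "tree_inv n E w p a b m c S T P"
    and x: "x \<in> S" and y: "y \<notin> T" "y < n" "(x, y) \<in> E" "a x + b y = w (x, y)" and "c y = 0"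
  shows "\<exists>v\<le>n. augment_inv n E w p a b m c (P(y := x)) y v"
proof -
  obtain ord :: "nat \<Rightarrow> nat" where ord: "\<And>k. k \<in> T \<Longrightarrow> P k \<in> S \<and> (P k, k) \<in> E \<and> a (P k) + b k = w (P k, k) \<and>
        (P k \<noteq> p \<longrightarrow> ord (m (P k)) < ord k) \<and> ord k < card T"
    using inv unfolding tree_inv_def by blast
  have mate: "m j \<in> T" if "j \<in> S" "j \<noteq> p" for j
    using tree_inv_mate[OF inv, of j] tree_inv_S_le[OF inv that(1)] that by auto
  define ord' where "ord' = ord(y := card T)"
  have "(P(y := x)) k \<le> p \<and> ((P(y := x)) k, k) \<in> E \<and>
      a ((P(y := x)) k) + b k = w ((P(y := x)) k, k) \<and>
      ((P(y := x)) k \<noteq> p \<longrightarrow> m ((P(y := x)) k) \<in> insert y T \<and> ord' (m ((P(y := x)) k)) < ord' k)"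
    if k: "k \<in> insert y T" for k
  proof (cases "k = y")
    case True
    have "m x \<in> T \<and> ord' (m x) < card T" if "x \<noteq> p"
      using mate[OF x that] ord[of "m x"] y(1) by (auto simp: ord'_def)
    then show ?thesis using True x y tree_inv_S_le[OF inv x] by (auto simp: ord'_def)
  next
    case False
    then have "k \<in> T" using k by simp
    moreover have "m (P k) \<in> T \<and> m (P k) \<noteq> y" if "P k \<noteq> p"
      using mate[of "P k"] ord[OF \<open>k \<in> T\<close>] that y(1) by auto
    ultimately show ?thesis
      using False ord[of k] tree_inv_S_le[OF inv, of "P k"] by (auto simp: ord'_def)
  qed
  then have D: "\<exists>D (ord :: nat \<Rightarrow> nat). y \<in> D \<and> ord y = card T \<and>
      (\<forall>k\<in>D. ord k \<le> card T \<longrightarrow> (P(y := x)) k \<le> p \<and> ((P(y := x)) k, k) \<in> E \<and>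
      a ((P(y := x)) k) + b k = w ((P(y := x)) k, k) \<and>
      ((P(y := x)) k \<noteq> p \<longrightarrow> m ((P(y := x)) k) \<in> D \<and> ord (m ((P(y := x)) k)) < ord k))"
    by (intro exI[of _ "insert y T"] exI[of _ ord']) (auto simp: ord'_def)
  have "matched n E w p a b m c" using inv by (simp add: tree_inv_def)
  then have "(\<forall>j<p. (j, m j) \<in> E \<and> m j \<noteq> y \<and> c (m j) = Suc j \<and> a j + b (m j) = w (j, m j))"
    "(\<forall>k<n. k \<noteq> y \<and> c k \<noteq> 0 \<longrightarrow> c k \<le> p \<and> m (c k - 1) = k)"
    using \<open>c y = 0\<close> by (auto simp: matched_def)
  with D y(2) have "augment_inv n E w p a b m c (P(y := x)) y (card T)"
    unfolding augment_inv_def by blast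
  moreover have "card T \<le> n"
    using inv card_mono[of "{..<n}" T] by (simp add: tree_inv_def)
  ultimately show ?thesis by blast
qed

text \<open>Row \<open>x = P y\<close> moves from its old mate \<open>y'\<close> to
  \<open>y\<close>, which leaves \<open>y'\<close> to be given to its own parent. Ranks fall
  strictly along the path, so \<open>x\<close> is not the parent of any column ranked up to
  \<open>y'\<close>, and their path data survive the change of \<open>m\<close>.\<close>

lemma augment_inv_step:
  assumes E: "E \<subseteq> {..<n} \<times> {..<n}" and inv: "augment_inv n E w p a b m c P y v" and lt: "P y < p"
  shows "\<exists>v'<v. augment_inv n E w p a b (m(P y := y)) (c(y := Suc (P y))) P (m (P y)) v'"
proof -
  define x y' where "x = P y" and "y' = m x"
  from inv obtain D and ord :: "nat \<Rightarrow> nat" where D: "y \<in> D" "ord y = v"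
    and o: "\<And>k. k \<in> D \<Longrightarrow> ord k \<le> v \<Longrightarrow> P k \<le> p \<and> (P k, k) \<in> E \<and> a (P k) + b k = w (P k, k) \<and>
           (P k \<noteq> p \<longrightarrow> m (P k) \<in> D \<and> ord (m (P k)) < ord k)"
    unfolding augment_inv_def by blast
  have y: "y < n" and mj: "\<And>j. j < p \<Longrightarrow> (j, m j) \<in> E \<and> m j \<noteq> y \<and> c (m j) = Suc j \<and> a j + b (m j) = w (j, m j)"
    and ck: "\<And>k. k < n \<Longrightarrow> k \<noteq> y \<Longrightarrow> c k \<noteq> 0 \<Longrightarrow> c k \<le> p \<and> m (c k - 1) = k"
    using inv by (auto simp: augment_inv_def)
  have xp: "x < p" using lt by (simp add: x_def)
  have xy: "(x, y) \<in> E" "a x + b y = w (x, y)" and y': "y' \<in> D" "ord y' < v"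
    using o[of y] D lt by (auto simp: x_def y'_def)
  have "y' < n" "y' \<noteq> y" and cy': "c y' = Suc x" using mj[OF xp] E by (auto simp: y'_def)
  have 1: "(j, (m(x := y)) j) \<in> E \<and> (m(x := y)) j \<noteq> y' \<and> (c(y := Suc x)) ((m(x := y)) j) = Suc j \<and>
      a j + b ((m(x := y)) j) = w (j, (m(x := y)) j)" if "j < p" for j
    using mj[OF that] xy \<open>y' \<noteq> y\<close> cy' by (auto simp: fun_upd_def)
  have 2: "(c(y := Suc x)) k \<le> p \<and> (m(x := y)) ((c(y := Suc x)) k - 1) = k"
    if "k < n" "k \<noteq> y'" "(c(y := Suc x)) k \<noteq> 0" for k
  proof (cases "k = y")
    case False
    then have "m (c k - 1) = k" "c k \<le> p" using ck[of k] that by auto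
    then show ?thesis using False that by (auto simp: y'_def)
  qed (use xp in auto)
  have 3: "P k \<le> p \<and> (P k, k) \<in> E \<and> a (P k) + b k = w (P k, k) \<and>
       (P k \<noteq> p \<longrightarrow> (m(x := y)) (P k) \<in> D \<and> ord ((m(x := y)) (P k)) < ord k)"
    if "k \<in> D" "ord k \<le> ord y'" for k
  proof -
    have "P k \<noteq> x"
    proof
      assume "P k = x"
      then have "ord y' < ord k" using o[of k] that y' xp by (auto simp: y'_def)
      then show False using that by simp
    qed
    then show ?thesis using o[of k] that y' by auto
  qed
  have "augment_inv n E w p a b (m(x := y)) (c(y := Suc x)) P y' (ord y')"
    unfolding augment_inv_def using 1 2 3 y'(1) \<open>y' < n\<close> by blast
  then show ?thesis using y' by (auto simp: x_def y'_def)
qed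

lemma augment_inv_finish:
  assumes inv: "augment_inv n E w p a b m c P y v" and "\<not> P y < p"
  shows "matched n E w (Suc p) a b (m(P y := y)) (c(y := Suc (P y)))"
proof -
  have "P y = p" and py: "(p, y) \<in> E" "a p + b y = w (p, y)"
    using inv \<open>\<not> P y < p\<close> unfolding augment_inv_def by force+
  have mj: "\<And>j. j < p \<Longrightarrow> (j, m j) \<in> E \<and> m j \<noteq> y \<and> c (m j) = Suc j \<and> a j + b (m j) = w (j, m j)"
    and ck: "\<And>k. k < n \<Longrightarrow> k \<noteq> y \<Longrightarrow> c k \<noteq> 0 \<Longrightarrow> c k \<le> p \<and> m (c k - 1) = k"
    using inv by (auto simp: augment_inv_def)
  have "(m(p := y)) ((c(y := Suc p)) k - 1) = k \<and> (c(y := Suc p)) k \<le> Suc p"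
    if "k < n" "(c(y := Suc p)) k \<noteq> 0" for k
  proof (cases "k = y")
    case False
    then have "m (c k - 1) = k" "c k \<le> p" "c k \<noteq> 0" using ck[of k] that by auto
    moreover from this have "c k - 1 \<noteq> p" by linarith
    ultimately show ?thesis using False by auto
  qed auto
  then show ?thesis
    using mj py \<open>P y = p\<close> unfolding matched_def by (auto simp: less_Suc_eq)
qed

lemma matched_perfect:
  assumes E: "E \<subseteq> {..<n} \<times> {..<n}" and m: "matched n E w n a b m c" and f: "feasible_below E w n a b"
  shows "dual_feasible E w a b" "perfect_matching n (tight_edges E w a b) m"
proof -
  show "dual_feasible E w a b" using f E by (auto simp: feasible_below_def dual_feasible_def)
  have mj: "\<And>j. j < n \<Longrightarrow> (j, m j) \<in> E \<and> c (m j) = Suc j \<and> a j + b (m j) = w (j, m j)"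
    using m by (auto simp: matched_def)
  have "inj_on m {..<n}" by (rule inj_onI) (metis mj lessThan_iff nat.inject)
  moreover have "m ` {..<n} \<subseteq> {..<n}" using mj E by auto
  ultimately have "bij_betw m {..<n} {..<n}"
    by (simp add: bij_betw_def endo_inj_surj)
  then show "perfect_matching n (tight_edges E w a b) m"
    using mj by (simp add: perfect_matching_def tight_edges_def)
qed

section \<open>Execution of programs\<close>

lemma exec_time_pos: "exec c s t s' \<Longrightarrow> 1 \<le> t"
  by (induction rule: exec.induct) auto

section \<open>Variables a program can write, and locality of its cost accesses\<close>

primrec nat_writes :: "com \<Rightarrow> vname set" where
  "nat_writes Skip = {}"
| "nat_writes (NAssign x es e) = {x}"
| "nat_writes (RAssign x es e) = {}"
| "nat_writes (Seq c1 c2) = nat_writes c1 \<union> nat_writes c2"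
| "nat_writes (Cond b c1 c2) = nat_writes c1 \<union> nat_writes c2"
| "nat_writes (While b c) = nat_writes c"

primrec real_writes :: "com \<Rightarrow> vname set" where
  "real_writes Skip = {}"
| "real_writes (NAssign x es e) = {}"
| "real_writes (RAssign x es e) = {x}"
| "real_writes (Seq c1 c2) = real_writes c1 \<union> real_writes c2"
| "real_writes (Cond b c1 c2) = real_writes c1 \<union> real_writes c2"
| "real_writes (While b c) = real_writes c"

text \<open>Locality makes the choices up to level \<open>i\<close> independent of the costs of later levels.\<close>

primrec local_rexp :: "rexp \<Rightarrow> bool" where
  "local_rexp (RConst k) \<longleftrightarrow> True"
| "local_rexp (RVar x es) \<longleftrightarrow> (x = ''C'' \<longrightarrow> es \<noteq> [] \<and> hd es = NVar ''i'' [])"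
| "local_rexp (RAdd a b) \<longleftrightarrow> local_rexp a \<and> local_rexp b"
| "local_rexp (RSub a b) \<longleftrightarrow> local_rexp a \<and> local_rexp b"

primrec local_bexp :: "bexp \<Rightarrow> bool" where
  "local_bexp (NLess a b) \<longleftrightarrow> True"
| "local_bexp (RLess a b) \<longleftrightarrow> local_rexp a \<and> local_rexp b"
| "local_bexp (BNot b) \<longleftrightarrow> local_bexp b"
| "local_bexp (BAnd a b) \<longleftrightarrow> local_bexp a \<and> local_bexp b"

primrec local_com :: "com \<Rightarrow> bool" where
  "local_com Skip \<longleftrightarrow> True"
| "local_com (NAssign x es e) \<longleftrightarrow> x \<noteq> ''i''"
| "local_com (RAssign x es e) \<longleftrightarrow> x \<noteq> ''C'' \<and> local_rexp e"
| "local_com (Seq c1 c2) \<longleftrightarrow> local_com c1 \<and> local_com c2"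
| "local_com (Cond b c1 c2) \<longleftrightarrow> local_bexp b \<and> local_com c1 \<and> local_com c2"
| "local_com (While b c) \<longleftrightarrow> local_bexp b \<and> local_com c"

lemma local_com_writes: "local_com c \<Longrightarrow> ''i'' \<notin> nat_writes c \<and> ''C'' \<notin> real_writes c"
  by (induction c) auto

lemma upd_same [simp]: "upd m x ix v x = (m x)(ix := v)"
  and upd_other [simp]: "y \<noteq> x \<Longrightarrow> upd m x ix v y = m y"
  by (auto simp: upd_def)

lemma exec_nats_frame: "exec c s t s' \<Longrightarrow> x \<notin> nat_writes c \<Longrightarrow> nats s' x = nats s x"
  by (induction rule: exec.induct) auto

lemma exec_reals_frame: "exec c s t s' \<Longrightarrow> x \<notin> real_writes c \<Longrightarrow> reals s' x = reals s x"
  by (induction rule: exec.induct) auto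

definition with_costs :: "(nat list \<Rightarrow> real) \<Rightarrow> store \<Rightarrow> store" where
  "with_costs D s = s\<lparr>reals := (reals s)(''C'' := D)\<rparr>"

definition same_level_costs :: "(nat list \<Rightarrow> real) \<Rightarrow> store \<Rightarrow> bool" where
  "same_level_costs D s \<longleftrightarrow> (\<forall>ix. D (nats s ''i'' [] # ix) = reals s ''C'' (nats s ''i'' [] # ix))"

lemma nats_with_costs [simp]: "nats (with_costs D s) = nats s"
  by (simp add: with_costs_def)

lemma nval_with_costs [simp]: "nval e (with_costs D s) = nval e s"
  by (induction e) (auto simp: with_costs_def cong: map_cong)

lemma rval_with_costs: "same_level_costs D s \<Longrightarrow> local_rexp e \<Longrightarrow> rval e (with_costs D s) = rval e s"
proof (induction e)
  case (RVar x es)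
  show ?case
  proof (cases "x = ''C''")
    case True
    with RVar obtain es' where "es = NVar ''i'' [] # es'" by (cases es) auto
    with True RVar show ?thesis
      by (simp add: same_level_costs_def) (simp add: with_costs_def)
  qed (simp, simp add: with_costs_def)
qed auto

lemma bval_with_costs: "same_level_costs D s \<Longrightarrow> local_bexp b \<Longrightarrow> bval b (with_costs D s) = bval b s"
  by (induction b) (auto simp: rval_with_costs)

lemma exec_same_level_costs:
  assumes "exec c s t s'" "local_com c"
  shows "same_level_costs D s' = same_level_costs D s"
  using exec_nats_frame[OF assms(1), of "''i''"] exec_reals_frame[OF assms(1), of "''C''"]
    local_com_writes[OF assms(2)] by (simp add: same_level_costs_def)

text \<open>A local program evaluates \<open>C\<close> only at indices headed by the current
  \<open>i\<close>, which it cannot change. Cost arrays that agree at this level therefore yield the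
  same run, step for step.\<close>

lemma exec_with_costs:
  "exec c s t s' \<Longrightarrow> local_com c \<Longrightarrow> same_level_costs D s \<Longrightarrow> exec c (with_costs D s) t (with_costs D s')"
proof (induction rule: exec.induct)
  case (NAssign y es e s)
  have "with_costs D (s\<lparr>nats := upd (nats s) y (map (\<lambda>e. nval e s) es) (nval e s)\<rparr>) =
     (with_costs D s)\<lparr>nats := upd (nats (with_costs D s)) y (map (\<lambda>e. nval e (with_costs D s)) es) (nval e (with_costs D s))\<rparr>"
    by (simp only: nval_with_costs) (simp add: with_costs_def)
  then show ?case by (simp only: exec.NAssign)
next
  case (RAssign y es e s)
  then have "rval e (with_costs D s) = rval e s" "y \<noteq> ''C''" by (simp_all add: rval_with_costs)
  then have "with_costs D (s\<lparr>reals := upd (reals s) y (map (\<lambda>e. nval e s) es) (rval e s)\<rparr>) =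
     (with_costs D s)\<lparr>reals := upd (reals (with_costs D s)) y (map (\<lambda>e. nval e (with_costs D s)) es) (rval e (with_costs D s))\<rparr>"
    by (simp only: nval_with_costs) (simp add: with_costs_def upd_def fun_upd_twist)
  then show ?case by (simp only: exec.RAssign)
next
  case (Seq c1 s1 t1 s2 c2 t2 s3)
  then show ?case using exec_same_level_costs[OF Seq.hyps(1)] by (auto intro: exec.Seq)
next
  case (WhileTrue b s1 c t1 s2 t2 s3)
  then show ?case using exec_same_level_costs[OF WhileTrue.hyps(2)]
    by (auto intro!: exec.WhileTrue simp: bval_with_costs)
\<comment> \<open>The rules with time 1 are repeated with \<open>Suc 0\<close>, the form that
  simplification produces.\<close>
qed (auto intro: exec.intros exec.Skip[unfolded One_nat_def] exec.WhileFalse[unfolded One_nat_def]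
    simp: bval_with_costs)

section \<open>Measurability of the final store as a function of the random input\<close>

definition measurable_store :: "'w measure \<Rightarrow> ('w \<Rightarrow> store) \<Rightarrow> bool" where
  "measurable_store N \<sigma> \<longleftrightarrow>
     (\<forall>x ix. (\<lambda>w. nats (\<sigma> w) x ix) \<in> measurable N (count_space UNIV)) \<and>
     (\<forall>x ix. (\<lambda>w. reals (\<sigma> w) x ix) \<in> borel_measurable N)"

text \<open>Index lists computed at run time take countably many values, which reduces an array
  access at a random index to accesses at fixed ones.\<close>

lemma measurable_map_count_space:
  fixes f :: "'e \<Rightarrow> 'w \<Rightarrow> nat"
  assumes "\<And>e. e \<in> set es \<Longrightarrow> f e \<in> measurable N (count_space UNIV)"
  shows "(\<lambda>w. map (\<lambda>e. f e w) es) \<in> measurable N (count_space UNIV)"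
  using assms
proof (induction es)
  case (Cons e es)
  have "(\<lambda>w. (\<lambda>v w. v # map (\<lambda>e. f e w) es) (f e w) w) \<in> measurable N (count_space UNIV)"
  proof (rule measurable_compose_countable[where f = "\<lambda>v w. v # map (\<lambda>e. f e w) es"])
    show "(\<lambda>w. v # map (\<lambda>e. f e w) es) \<in> measurable N (count_space UNIV)" for v
      using measurable_compose[OF Cons.IH, of "\<lambda>xs. v # xs" "count_space UNIV"] Cons.prems by simp
  qed (use Cons.prems in auto)
  then show ?case by simp
qed auto

lemma measurable_nval:
  assumes "measurable_store N \<sigma>"
  shows "(\<lambda>w. nval e (\<sigma> w)) \<in> measurable N (count_space UNIV)"
proof (induction e)
  case (NVar x es)
  have "(\<lambda>w. (\<lambda>ix w. nats (\<sigma> w) x ix) (map (\<lambda>e. nval e (\<sigma> w)) es) w) \<in> measurable N (count_space UNIV)"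
    by (rule measurable_compose_countable)
       (use assms NVar in \<open>auto simp: measurable_store_def intro!: measurable_map_count_space\<close>)
  then show ?case by simp
qed auto

lemma measurable_rval:
  assumes "measurable_store N \<sigma>"
  shows "(\<lambda>w. rval e (\<sigma> w)) \<in> borel_measurable N"
proof (induction e)
  case (RVar x es)
  have "(\<lambda>w. (\<lambda>ix w. reals (\<sigma> w) x ix) (map (\<lambda>e. nval e (\<sigma> w)) es) w) \<in> borel_measurable N"
    by (rule measurable_compose_countable)
       (use assms in \<open>auto simp: measurable_store_def intro!: measurable_map_count_space measurable_nval\<close>)
  then show ?case by simp
qed auto

lemma measurable_bval:
  assumes "measurable_store N \<sigma>"
  shows "Measurable.pred N (\<lambda>w. bval b (\<sigma> w))"
proof (induction b)
  case (NLess a b)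
  have "Measurable.pred N (\<lambda>w. (\<lambda>v w. v < nval b (\<sigma> w)) (nval a (\<sigma> w)) w)"
  proof (rule measurable_compose_countable[where f = "\<lambda>v w. v < nval b (\<sigma> w)", OF _ measurable_nval[OF assms]])
    show "Measurable.pred N (\<lambda>w. v < nval b (\<sigma> w))" for v
      using measurable_compose[OF measurable_nval[OF assms], of "\<lambda>z. v < z" "count_space UNIV"] by simp
  qed
  then show ?case by simp
next
  case (RLess a b)
  note [measurable] = measurable_rval[OF assms]
  show ?case by simp
qed auto

lemma measurable_upd:
  fixes f :: "'w \<Rightarrow> vname \<Rightarrow> nat list \<Rightarrow> 'v"
  assumes f: "(\<lambda>w. f w y jx) \<in> measurable N M" and g: "g \<in> measurable N (count_space UNIV)"
    and v: "v \<in> measurable N M"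
  shows "(\<lambda>w. upd (f w) x (g w) (v w) y jx) \<in> measurable N M"
proof -
  have "(\<lambda>w. if y = x \<and> g w = jx then v w else f w y jx) \<in> measurable N M"
    using f v measurable_compose[OF g, of "\<lambda>z. y = x \<and> z = jx" "count_space UNIV"]
    by (intro measurable_If) (auto simp: pred_def[symmetric])
  moreover have "(\<lambda>w. upd (f w) x (g w) (v w) y jx) = (\<lambda>w. if y = x \<and> g w = jx then v w else f w y jx)"
    by (auto simp: upd_def fun_eq_iff)
  ultimately show ?thesis by simp
qed

lemma measurable_store_restrict:
  "measurable_store N \<sigma> \<Longrightarrow> measurable_store (restrict_space N A) \<sigma>"
  by (auto simp: measurable_store_def intro: measurable_restrict_space1)

lemma measurable_store_cong:
  "measurable_store N \<sigma> \<Longrightarrow> (\<And>w. w \<in> space N \<Longrightarrow> \<sigma> w = \<tau> w) \<Longrightarrow> measurable_store N \<tau>"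
  by (auto simp: measurable_store_def cong: measurable_cong)

text \<open>For tests: the two outcomes of a measurable test can be treated on separate restricted
  spaces, each with a fixed program.\<close>

lemma measurable_store_split:
  assumes "Measurable.pred N P"
    and 1: "measurable_store (restrict_space N {w. P w}) \<sigma>"
    and 2: "measurable_store (restrict_space N {w. \<not> P w}) \<sigma>"
  shows "measurable_store N \<sigma>"
proof -
  have sets: "{w \<in> space N. P w} \<in> sets N" using assms(1) by simp
  show ?thesis
    using 1 2 measurable_If_restrict_space_iff[OF sets, of "\<lambda>w. nats (\<sigma> w) x ix" "\<lambda>w. nats (\<sigma> w) x ix" for x ix]
      measurable_If_restrict_space_iff[OF sets, of "\<lambda>w. reals (\<sigma> w) x ix" "\<lambda>w. reals (\<sigma> w) x ix" for x ix]
    by (simp add: measurable_store_def)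
qed

text \<open>Induction on the running time, not on the program: a terminating loop splits into its body and
  a shorter run of itself.\<close>

lemma measurable_store_exec:
  assumes "measurable_store N \<sigma>" "\<And>w. w \<in> space N \<Longrightarrow> \<exists>t'\<le>t. exec c (\<sigma> w) t' (\<tau> w)"
  shows "measurable_store N \<tau>"
  using assms
proof (induction t arbitrary: c N \<sigma> \<tau> rule: less_induct)
  case (less t)
  have IH: "measurable_store N \<tau>" if "t1 < t" "measurable_store N \<sigma>" "\<And>w. w \<in> space N \<Longrightarrow> \<exists>t'\<le>t1. exec c (\<sigma> w) t' (\<tau> w)"
    for t1 N \<sigma> c and \<tau> :: "'a \<Rightarrow> store"
    using less.IH[of t1 N \<sigma> c \<tau>] that by blast
  show ?case
  proof (cases "space N = {}")
    case True
    then show ?thesis by (auto simp: measurable_store_def measurable_def)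
  next
    case False
    note st = less.prems(1)
    have seq: "measurable_store N' \<tau>" if N': "measurable_store N' \<sigma>"
      and ex: "\<And>w. w \<in> space N' \<Longrightarrow> \<exists>t1 t2 s. t1 + t2 \<le> t \<and> exec c1 (\<sigma> w) t1 s \<and> exec c2 s t2 (\<tau> w)" for N' c1 c2
    proof -
      \<comment> \<open>The intermediate store is picked pointwise, with no regard to measurability;
        the induction hypothesis covers any such pick. Either part takes at least one step, hence
        each takes fewer than \<open>t\<close>.\<close>
      obtain t1 t2 \<rho> where r: "\<And>w. w \<in> space N' \<Longrightarrow> t1 w + t2 w \<le> t \<and> exec c1 (\<sigma> w) (t1 w) (\<rho> w) \<and> exec c2 (\<rho> w) (t2 w) (\<tau> w)"
        using ex by metis
      have lt: "t1 w \<le> t - 1" "t2 w \<le> t - 1" if "w \<in> space N'" for w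
        using r[OF that] exec_time_pos[of c1] exec_time_pos[of c2] by fastforce+
      show ?thesis
      proof (cases "space N' = {}")
        case True
        then show ?thesis by (auto simp: measurable_store_def measurable_def)
      next
        case False
        then obtain w where "w \<in> space N'" by auto
        then have "t - 1 < t" using r[of w] exec_time_pos[of c1 "\<sigma> w" "t1 w" "\<rho> w"] by auto
        have "measurable_store N' \<rho>"
          by (rule IH[OF \<open>t - 1 < t\<close> N', of c1]) (use r lt in blast)
        then show ?thesis
          by (rule IH[OF \<open>t - 1 < t\<close>, of _ _ c2]) (use r lt in blast)
      qed
    qed
    obtain w0 where "w0 \<in> space N" using False by auto
    then have "1 \<le> t" using less.prems(2) exec_time_pos by fastforce
    then have t1: "t - 1 < t" by simp
    show ?thesis
    proof (cases c)
      case Skip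
      have "\<sigma> w = \<tau> w" if "w \<in> space N" for w
        using less.prems(2)[OF that] unfolding Skip by (auto elim: exec_elims)
      then show ?thesis using st measurable_store_cong by blast
    next
      case (NAssign x es e)
      define \<rho> where "\<rho> w = (\<sigma> w)\<lparr>nats := upd (nats (\<sigma> w)) x (map (\<lambda>e. nval e (\<sigma> w)) es) (nval e (\<sigma> w))\<rparr>" for w
      have "\<rho> w = \<tau> w" if "w \<in> space N" for w
        using less.prems(2)[OF that] unfolding NAssign \<rho>_def by (auto elim: exec_elims)
      moreover have "measurable_store N \<rho>"
        using st unfolding measurable_store_def \<rho>_def
        by (auto intro!: measurable_upd measurable_map_count_space measurable_nval[OF st])
      ultimately show ?thesis using measurable_store_cong by blast
    next
      case (RAssign x es e)
      define \<rho> where "\<rho> w = (\<sigma> w)\<lparr>reals := upd (reals (\<sigma> w)) x (map (\<lambda>e. nval e (\<sigma> w)) es) (rval e (\<sigma> w))\<rparr>" for w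
      have "\<rho> w = \<tau> w" if "w \<in> space N" for w
        using less.prems(2)[OF that] unfolding RAssign \<rho>_def by (auto elim: exec_elims)
      moreover have "measurable_store N \<rho>"
        using st unfolding measurable_store_def \<rho>_def
        by (auto intro!: measurable_upd measurable_map_count_space measurable_nval[OF st] measurable_rval[OF st])
      ultimately show ?thesis using measurable_store_cong by blast
    next
      case (Seq c1 c2)
      show ?thesis
      proof (rule seq[OF st, of c1 c2])
        fix w assume "w \<in> space N"
        with less.prems(2) obtain t' where "t' \<le> t" "exec (Seq c1 c2) (\<sigma> w) t' (\<tau> w)"
          unfolding Seq by blast
        then show "\<exists>t1 t2 s. t1 + t2 \<le> t \<and> exec c1 (\<sigma> w) t1 s \<and> exec c2 s t2 (\<tau> w)"
          by (auto elim!: exec_elims(4))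
      qed
    next
      case (Cond b c1 c2)
      have ex: "\<exists>t'\<le>t - 1. exec (if bval b (\<sigma> w) then c1 else c2) (\<sigma> w) t' (\<tau> w)" if w: "w \<in> space N" for w
      proof -
        obtain t' where "t' \<le> t" "exec (Cond b c1 c2) (\<sigma> w) t' (\<tau> w)"
          using less.prems(2)[OF w] unfolding Cond by blast
        then obtain u where "Suc u \<le> t" "exec (if bval b (\<sigma> w) then c1 else c2) (\<sigma> w) u (\<tau> w)"
          by (elim exec_elims(5)) auto
        then show ?thesis by (intro exI[of _ u]) auto
      qed
      show ?thesis
      proof (rule measurable_store_split[OF measurable_bval[OF st, of b]])
        show "measurable_store (restrict_space N {w. bval b (\<sigma> w)}) \<tau>"
          using ex by (intro IH[OF t1 measurable_store_restrict[OF st], of _ c1]) (fastforce simp: space_restrict_space)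
        show "measurable_store (restrict_space N {w. \<not> bval b (\<sigma> w)}) \<tau>"
          using ex by (intro IH[OF t1 measurable_store_restrict[OF st], of _ c2]) (fastforce simp: space_restrict_space)
      qed
    next
      case (While b c')
      have ex: "if bval b (\<sigma> w) then \<exists>t1 t2 s. t1 + t2 \<le> t \<and> exec c' (\<sigma> w) t1 s \<and> exec (While b c') s t2 (\<tau> w)
          else \<tau> w = \<sigma> w" if w: "w \<in> space N" for w
      proof -
        obtain t' where "t' \<le> t" "exec (While b c') (\<sigma> w) t' (\<tau> w)"
          using less.prems(2)[OF w] unfolding While by blast
        from this(2) show ?thesis
        proof (rule exec_elims(6))
          fix t1 s2 t2
          assume "t' = Suc (t1 + t2)" "bval b (\<sigma> w)" "exec c' (\<sigma> w) t1 s2" "exec (While b c') s2 t2 (\<tau> w)"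
          moreover from this have "t1 + t2 \<le> t" using \<open>t' \<le> t\<close> by simp
          ultimately show ?thesis by auto
        qed simp
      qed
      show ?thesis
      proof (rule measurable_store_split[OF measurable_bval[OF st, of b]])
        show "measurable_store (restrict_space N {w. bval b (\<sigma> w)}) \<tau>"
          by (rule seq[OF measurable_store_restrict[OF st], of _ c' "While b c'"])
             (use ex in \<open>force simp: space_restrict_space\<close>)
        show "measurable_store (restrict_space N {w. \<not> bval b (\<sigma> w)}) \<tau>"
          by (rule measurable_store_cong[OF measurable_store_restrict[OF st]])
             (use ex in \<open>force simp: space_restrict_space\<close>)
      qed
    qed
  qed
qed

section \<open>Total correctness with bounds on the number of steps\<close>

definition runs :: "com \<Rightarrow> store \<Rightarrow> nat \<Rightarrow> (store \<Rightarrow> bool) \<Rightarrow> bool" where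
  "runs c s T Q \<longleftrightarrow> (\<exists>t s'. exec c s t s' \<and> t \<le> T \<and> Q s')"

lemma runs_mono: "runs c s T Q \<Longrightarrow> T \<le> T' \<Longrightarrow> (\<And>s'. Q s' \<Longrightarrow> Q' s') \<Longrightarrow> runs c s T' Q'"
  unfolding runs_def by (meson order_trans)

abbreviation framed :: "com \<Rightarrow> store \<Rightarrow> store \<Rightarrow> bool" where
  "framed c s s' \<equiv> (\<forall>x. x \<notin> nat_writes c \<longrightarrow> nats s' x = nats s x) \<and>
     (\<forall>x. x \<notin> real_writes c \<longrightarrow> reals s' x = reals s x)"

lemma runs_frame:
  assumes "runs c s T Q"
  shows "runs c s T (\<lambda>s'. Q s' \<and> framed c s s')"
  using assms exec_nats_frame exec_reals_frame unfolding runs_def by blast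

lemma runs_Skip: "1 \<le> T \<Longrightarrow> Q s \<Longrightarrow> runs Skip s T Q"
  unfolding runs_def using exec.Skip by blast

lemma runs_NAssign:
  "1 \<le> T \<Longrightarrow> Q (s\<lparr>nats := upd (nats s) x (map (\<lambda>e. nval e s) es) (nval e s)\<rparr>) \<Longrightarrow> runs (NAssign x es e) s T Q"
  unfolding runs_def using exec.NAssign by blast

lemma runs_RAssign:
  "1 \<le> T \<Longrightarrow> Q (s\<lparr>reals := upd (reals s) x (map (\<lambda>e. nval e s) es) (rval e s)\<rparr>) \<Longrightarrow> runs (RAssign x es e) s T Q"
  unfolding runs_def using exec.RAssign by blast

lemma runs_Seq: "runs c1 s T1 (\<lambda>s'. runs c2 s' T2 Q) \<Longrightarrow> T1 + T2 \<le> T \<Longrightarrow> runs (Seq c1 c2) s T Q"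
  unfolding runs_def using exec.Seq by (meson add_mono order_trans)

lemma runs_Cond:
  "(bval b s \<Longrightarrow> runs c1 s T Q) \<Longrightarrow> (\<not> bval b s \<Longrightarrow> runs c2 s T Q) \<Longrightarrow> Suc T \<le> T' \<Longrightarrow> runs (Cond b c1 c2) s T' Q"
  unfolding runs_def by (cases "bval b s") (meson exec.CondTrue exec.CondFalse Suc_le_mono order_trans)+

text \<open>The index of \<open>I\<close> is a rank that drops in every round. A round costs its
  body and one test; the final failing test adds 1.\<close>

lemma runs_While:
  assumes "I K s"
    and step: "\<And>k s. I k s \<Longrightarrow> bval b s \<Longrightarrow> runs c s T (\<lambda>s'. \<exists>k'<k. I k' s')"
    and stop: "\<And>k s. I k s \<Longrightarrow> \<not> bval b s \<Longrightarrow> Q s"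
  shows "runs (While b c) s (K * (T + 1) + 1) Q"
  using assms(1)
proof (induction K arbitrary: s rule: less_induct)
  case (less K)
  show ?case
  proof (cases "bval b s")
    case True
    then obtain t s' k where 1: "exec c s t s'" "t \<le> T" "k < K" "I k s'"
      using step[OF less.prems] unfolding runs_def by blast
    then obtain t' s'' where 2: "exec (While b c) s' t' s''" "t' \<le> k * (T + 1) + 1" "Q s''"
      using less.IH unfolding runs_def by blast
    have "Suc (t + t') \<le> Suc (T + (k * (T + 1) + 1))" using 1 2 by simp
    also have "\<dots> = Suc k * (T + 1) + 1" by simp
    also have "\<dots> \<le> K * (T + 1) + 1" using \<open>k < K\<close> by (intro add_mono mult_le_mono) auto
    finally show ?thesis
      unfolding runs_def using exec.WhileTrue[OF True 1(1) 2(1)] 2(3) by blast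
  next
    case False
    then show ?thesis
      unfolding runs_def using stop[OF less.prems] exec.WhileFalse[OF False] by fastforce
  qed
qed

abbreviation "scalar x \<equiv> NVar x []"

definition For :: "vname \<Rightarrow> com \<Rightarrow> com" where
  "For x c = Seq (NAssign x [] (NConst 0))
     (While (NLess (scalar x) (scalar ''n'')) (Seq c (NAssign x [] (NAdd (scalar x) (NConst 1)))))"

lemma For_writes [simp]:
  "nat_writes (For x c) = insert x (nat_writes c)" "real_writes (For x c) = real_writes c"
  "local_com (For x c) \<longleftrightarrow> x \<noteq> ''i'' \<and> local_com c"
  by (auto simp: For_def)

text \<open>\<open>counter\<close> says that the invariant ignores the loop variable, which the loop
  itself resets and increments. A round costs the body, an increment and a test; the initialisation
  and the last test add 2.\<close>

lemma runs_For:
  assumes names: "x \<noteq> ''n''" "x \<notin> nat_writes c" "''n'' \<notin> nat_writes c"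
    and n: "nats s ''n'' [] = n"
    and init: "I 0 s"
    and counter: "\<And>v u s. I v s \<Longrightarrow> I v (s\<lparr>nats := upd (nats s) x [] u\<rparr>)"
    and step: "\<And>v s. v < n \<Longrightarrow> I v s \<Longrightarrow> nats s x [] = v \<Longrightarrow> nats s ''n'' [] = n \<Longrightarrow> runs c s T (I (Suc v))"
    and T': "n * (T + 2) + 2 \<le> T'"
  shows "runs (For x c) s T' (I n)"
proof -
  define J where "J k s \<longleftrightarrow> (\<exists>v\<le>n. k = n - v \<and> I v s \<and> nats s x [] = v \<and> nats s ''n'' [] = n)" for k s
  have "runs (While (NLess (scalar x) (scalar ''n'')) (Seq c (NAssign x [] (NAdd (scalar x) (NConst 1)))))
      (s\<lparr>nats := upd (nats s) x [] 0\<rparr>) (n * ((T + 1) + 1) + 1) (I n)"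
  proof (rule runs_While[where I = J])
    show "J n (s\<lparr>nats := upd (nats s) x [] 0\<rparr>)"
      using counter[OF init, of 0] n names by (auto simp: J_def)
    show "I n s'" if "J k s'" "\<not> bval (NLess (scalar x) (scalar ''n'')) s'" for k s'
      using that by (auto simp: J_def)
    show "runs (Seq c (NAssign x [] (NAdd (scalar x) (NConst 1)))) s' (T + 1) (\<lambda>s'. \<exists>k'<k. J k' s')"
      if J: "J k s'" and b: "bval (NLess (scalar x) (scalar ''n'')) s'" for k s'
    proof -
      from J obtain v where v: "v \<le> n" "k = n - v" "I v s'" "nats s' x [] = v" "nats s' ''n'' [] = n"
        by (auto simp: J_def)
      with b have "v < n" by simp
      show ?thesis
      proof (rule runs_Seq[OF runs_mono[OF runs_frame[OF step[OF \<open>v < n\<close> v(3-5)]] order_refl]])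
        fix s'' assume s'': "I (Suc v) s'' \<and> framed c s' s''"
        then have "nats s'' x [] = v" "nats s'' ''n'' [] = n" using names v by auto
        then have "J (n - Suc v) (s''\<lparr>nats := upd (nats s'') x [] (Suc v)\<rparr>)"
          using counter[of "Suc v" s'' "Suc v"] s'' names \<open>v < n\<close> by (auto simp: J_def)
        moreover have "n - Suc v < k" using v \<open>v < n\<close> by simp
        ultimately show "runs (NAssign x [] (NAdd (scalar x) (NConst 1))) s'' 1 (\<lambda>s'. \<exists>k'<k. J k' s')"
          using \<open>nats s'' x [] = v\<close> by (intro runs_NAssign) auto
      qed simp
    qed
  qed
  then show ?thesis
    unfolding For_def by (intro runs_Seq[where ?T1.0 = 1, OF runs_NAssign]) (use T' in auto)
qed

section \<open>The greedy program\<close>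

text \<open>
  Variables: \<open>U\<close> marks the pairs used by earlier levels; \<open>a\<close>, \<open>b\<close> are the dual variables; \<open>m\<close> is the
  column matched to a row, and \<open>c\<close> the successor of the row matched to a column (0 if unmatched);
  \<open>S\<close>, \<open>T\<close>, \<open>P\<close> are the rows, columns and parents of the alternating tree with root \<open>p\<close>; \<open>(x, y)\<close> is
  the edge of least slack \<open>z\<close> leaving the tree; \<open>f\<close>, \<open>d\<close>, \<open>g\<close> are flags. The duals need no
  initialisation: the first shift of a phase, possibly by a negative amount, makes row \<open>p\<close> feasible.
\<close>

definition clear_mates :: com where
  "clear_mates = For ''k'' (NAssign ''c'' [scalar ''k''] (NConst 0))"

definition init_tree :: com where
  "init_tree = Seq (For ''j'' (Seq (NAssign ''S'' [scalar ''j''] (NConst 0)) (NAssign ''T'' [scalar ''j''] (NConst 0))))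
     (Seq (NAssign ''S'' [scalar ''p''] (NConst 1)) (NAssign ''d'' [] (NConst 0)))"

definition slack_exp :: rexp where
  "slack_exp = RSub (RSub (RVar ''C'' [scalar ''i'', scalar ''j'', scalar ''k'']) (RVar ''a'' [scalar ''j'']))
     (RVar ''b'' [scalar ''k''])"

text \<open>\<open>bexp\<close> has no disjunction: the negated conjunction says that no edge is
  recorded yet or that the new slack is below \<open>z\<close>.\<close>

definition better_exp :: bexp where
  "better_exp = BAnd (NLess (NConst 0) (NVar ''S'' [scalar ''j'']))
     (BAnd (NLess (NVar ''T'' [scalar ''k'']) (NConst 1))
     (BAnd (NLess (NVar ''U'' [scalar ''j'', scalar ''k'']) (NConst 1))
       (BNot (BAnd (NLess (NConst 0) (scalar ''f'')) (BNot (RLess slack_exp (RVar ''z'' [])))))))"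

definition record_edge :: com where
  "record_edge = Seq (NAssign ''f'' [] (NConst 1)) (Seq (NAssign ''x'' [] (scalar ''j''))
     (Seq (NAssign ''y'' [] (scalar ''k'')) (RAssign ''z'' [] slack_exp)))"

definition search :: com where
  "search = Seq (NAssign ''f'' [] (NConst 0)) (For ''j'' (For ''k'' (Cond better_exp record_edge Skip)))"

definition shift_row :: com where
  "shift_row = Cond (NLess (NConst 0) (NVar ''S'' [scalar ''j'']))
     (RAssign ''a'' [scalar ''j''] (RAdd (RVar ''a'' [scalar ''j'']) (RVar ''z'' []))) Skip"

definition shift_col :: com where
  "shift_col = Cond (NLess (NConst 0) (NVar ''T'' [scalar ''j'']))
     (RAssign ''b'' [scalar ''j''] (RSub (RVar ''b'' [scalar ''j'']) (RVar ''z'' []))) Skip"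

definition shift_duals :: com where
  "shift_duals = For ''j'' (Seq shift_row shift_col)"

definition augment :: com where
  "augment = Seq (NAssign ''g'' [] (NConst 0)) (While (NLess (scalar ''g'') (NConst 1))
     (Seq (NAssign ''x'' [] (NVar ''P'' [scalar ''y'']))
     (Seq (NAssign ''k'' [] (NVar ''m'' [scalar ''x'']))
     (Seq (NAssign ''c'' [scalar ''y''] (NAdd (scalar ''x'') (NConst 1)))
     (Seq (NAssign ''m'' [scalar ''x''] (scalar ''y''))
       (Cond (NLess (scalar ''x'') (scalar ''p'')) (NAssign ''y'' [] (scalar ''k'')) (NAssign ''g'' [] (NConst 1))))))))"

definition extend_tree :: com where
  "extend_tree = Seq (NAssign ''T'' [scalar ''y''] (NConst 1))
     (NAssign ''S'' [NSub (NVar ''c'' [scalar ''y'']) (NConst 1)] (NConst 1))"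

definition grow :: com where
  "grow = Seq (NAssign ''P'' [scalar ''y''] (scalar ''x''))
     (Cond (NLess (NConst 0) (NVar ''c'' [scalar ''y''])) extend_tree (Seq (NAssign ''d'' [] (NConst 1)) augment))"

definition phase :: com where
  "phase = Seq init_tree (While (NLess (scalar ''d'') (NConst 1)) (Seq search (Seq shift_duals grow)))"

definition write_level :: com where
  "write_level = For ''j'' (Seq
     (NAssign ''X'' [scalar ''i'', scalar ''j'', NVar ''m'' [scalar ''j'']] (NConst 1))
     (NAssign ''U'' [scalar ''j'', NVar ''m'' [scalar ''j'']] (NConst 1)))"

definition level :: com where
  "level = Seq clear_mates (Seq (For ''p'' phase) write_level)"

definition greedy_program :: com where
  "greedy_program = For ''i'' level"

lemmas program_defs = clear_mates_def init_tree_def slack_exp_def better_exp_def record_edge_def search_def shift_row_def shift_col_def shift_duals_def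
  augment_def extend_tree_def grow_def phase_def write_level_def level_def

section \<open>Invariants and step bounds for the parts of the program\<close>

definition edges :: "nat \<Rightarrow> store \<Rightarrow> (nat \<times> nat) set" where
  "edges n s = {(j, k). j < n \<and> k < n \<and> nats s ''U'' [j, k] = 0}"

definition level_cost :: "store \<Rightarrow> nat \<times> nat \<Rightarrow> real" where
  "level_cost s = (\<lambda>(j, k). reals s ''C'' [nats s ''i'' [], j, k])"

abbreviation "row_dual s \<equiv> (\<lambda>j. reals s ''a'' [j])"
abbreviation "col_dual s \<equiv> (\<lambda>k. reals s ''b'' [k])"
abbreviation "row_mate s \<equiv> (\<lambda>j. nats s ''m'' [j])"
abbreviation "col_mate s \<equiv> (\<lambda>k. nats s ''c'' [k])"
abbreviation "parent s \<equiv> (\<lambda>k. nats s ''P'' [k])"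
abbreviation "tree_rows n s \<equiv> {j. j < n \<and> 0 < nats s ''S'' [j]}"
abbreviation "tree_cols n s \<equiv> {k. k < n \<and> 0 < nats s ''T'' [k]}"

definition setting :: "nat \<Rightarrow> (nat \<times> nat) set \<Rightarrow> (nat \<times> nat \<Rightarrow> real) \<Rightarrow> nat \<Rightarrow> store \<Rightarrow> bool" where
  "setting n E w p s \<longleftrightarrow> nats s ''n'' [] = n \<and> edges n s = E \<and> level_cost s = w \<and> nats s ''p'' [] = p"

lemma setting_frame:
  assumes "setting n E w p s" "framed c s s'" "{''n'', ''U'', ''i'', ''p''} \<inter> nat_writes c = {}" "''C'' \<notin> real_writes c"
  shows "setting n E w p s'"
  using assms by (simp add: setting_def edges_def level_cost_def)

text \<open>Invariant of a search started in \<open>s0\<close>, with \<open>A\<close> the pairs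
  inspected so far. The frontier \<open>F\<close> and the slack are taken from \<open>s0\<close>,
  since the search writes none of the variables that they depend on.\<close>

definition scanned :: "nat \<Rightarrow> store \<Rightarrow> (nat \<times> nat) set \<Rightarrow> store \<Rightarrow> bool" where
  "scanned n s0 A s \<longleftrightarrow>
     (\<forall>x. x \<notin> {''f'', ''x'', ''y'', ''j'', ''k''} \<longrightarrow> nats s x = nats s0 x) \<and>
     (\<forall>x. x \<noteq> ''z'' \<longrightarrow> reals s x = reals s0 x) \<and>
     (let F = {(j, k) \<in> edges n s0. j \<in> tree_rows n s0 \<and> k \<notin> tree_cols n s0};
          slack = (\<lambda>(j, k). level_cost s0 (j, k) - row_dual s0 j - col_dual s0 k)
      in if nats s ''f'' [] = 0 then F \<inter> A = {}
         else (nats s ''x'' [], nats s ''y'' []) \<in> F \<and>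
              reals s ''z'' [] = slack (nats s ''x'' [], nats s ''y'' []) \<and>
              (\<forall>e\<in>F \<inter> A. reals s ''z'' [] \<le> slack e))"

lemma scanned_counter:
  assumes "scanned n s0 A s" "x \<in> {''j'', ''k''}"
  shows "scanned n s0 A (s\<lparr>nats := upd (nats s) x [] u\<rparr>)"
proof -
  have ne: "''f'' \<noteq> x" "''x'' \<noteq> x" "''y'' \<noteq> x" using assms(2) by auto
  have 1: "\<forall>v. v \<notin> {''f'', ''x'', ''y'', ''j'', ''k''} \<longrightarrow> nats (s\<lparr>nats := upd (nats s) x [] u\<rparr>) v = nats s0 v"
  proof (intro allI impI)
    fix v assume v: "v \<notin> {''f'', ''x'', ''y'', ''j'', ''k''}"
    then have "v \<noteq> x" using assms(2) by blast
    moreover have "nats s v = nats s0 v" using assms(1) v unfolding scanned_def by blast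
    ultimately show "nats (s\<lparr>nats := upd (nats s) x [] u\<rparr>) v = nats s0 v" by simp
  qed
  have 2: "nats (s\<lparr>nats := upd (nats s) x [] u\<rparr>) ''f'' = nats s ''f''"
    "nats (s\<lparr>nats := upd (nats s) x [] u\<rparr>) ''x'' = nats s ''x''"
    "nats (s\<lparr>nats := upd (nats s) x [] u\<rparr>) ''y'' = nats s ''y''"
    "reals (s\<lparr>nats := upd (nats s) x [] u\<rparr>) = reals s"
    using ne by simp_all
  show ?thesis
    using 1 assms(1)[unfolded scanned_def, THEN conjunct2] unfolding scanned_def 2 by (rule conjI)
qed

text \<open>Moving from the end of one row of the scan to the start of the next changes the
  inspected pairs only off the graph.\<close>

lemma scanned_cong:
  assumes "scanned n s0 A s" "edges n s0 \<inter> A = edges n s0 \<inter> B"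
  shows "scanned n s0 B s"
proof -
  have "{(j, k) \<in> edges n s0. j \<in> tree_rows n s0 \<and> k \<notin> tree_cols n s0} \<inter> A
      = {(j, k) \<in> edges n s0. j \<in> tree_rows n s0 \<and> k \<notin> tree_cols n s0} \<inter> B"
    using assms(2) by blast
  from assms(1)[unfolded scanned_def Let_def this] show ?thesis unfolding scanned_def Let_def .
qed

text \<open>As a frontier edge exists, the flag \<open>f\<close> ends up set, so
  \<open>(x, y)\<close> and \<open>z\<close> describe a least slack and are not leftovers.\<close>

lemma runs_search:
  assumes n: "nats s0 ''n'' [] = n"
    and front: "\<exists>x\<in>tree_rows n s0. \<exists>y. y \<notin> tree_cols n s0 \<and> (x, y) \<in> edges n s0"
  shows "runs search s0 (n * (n * 7 + 4) + 3) (\<lambda>s. let x = nats s ''x'' []; y = nats s ''y'' []; z = reals s ''z'' [] in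
     x \<in> tree_rows n s0 \<and> y \<notin> tree_cols n s0 \<and> (x, y) \<in> edges n s0 \<and>
     z = level_cost s0 (x, y) - row_dual s0 x - col_dual s0 y \<and>
     (\<forall>j k. j \<in> tree_rows n s0 \<longrightarrow> k \<notin> tree_cols n s0 \<longrightarrow> (j, k) \<in> edges n s0 \<longrightarrow>
        z \<le> level_cost s0 (j, k) - row_dual s0 j - col_dual s0 k))"
    (is "runs search s0 _ ?Q")
proof -
  \<comment> \<open>The pairs that precede \<open>(v, u)\<close> in the order of the two nested
    loops.\<close>
  define A where "A v u = {(j, k). j < v \<or> j = v \<and> k < (u :: nat)}" for v u :: nat
  define body where "body = Cond better_exp record_edge Skip"
  have step: "runs body s 5 (\<lambda>s. scanned n s0 (A v (Suc u)) s \<and> nats s ''j'' [] = v)"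
    if s: "scanned n s0 (A v u) s \<and> nats s ''j'' [] = v" and u: "nats s ''k'' [] = u" "u < n" "v < n" for s u v
  proof -
    define F where "F = {(j, k) \<in> edges n s0. j \<in> tree_rows n s0 \<and> k \<notin> tree_cols n s0}"
    define slack where "slack = (\<lambda>(j, k). level_cost s0 (j, k) - row_dual s0 j - col_dual s0 k)"
    have A: "A v (Suc u) = insert (v, u) (A v u)" by (auto simp: A_def)
    have fr: "nats s ''S'' = nats s0 ''S''" "nats s ''T'' = nats s0 ''T''" "nats s ''U'' = nats s0 ''U''"
      "nats s ''i'' = nats s0 ''i''" "reals s ''C'' = reals s0 ''C''" "reals s ''a'' = reals s0 ''a''"
      "reals s ''b'' = reals s0 ''b''"
      using s by (auto simp: scanned_def)
    have slack: "rval slack_exp s = slack (v, u)"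
      using s u fr by (simp add: slack_exp_def slack_def level_cost_def)
    have better: "bval better_exp s \<longleftrightarrow> (v, u) \<in> F \<and> (nats s ''f'' [] = 0 \<or> slack (v, u) < reals s ''z'' [])"
      using s u fr slack by (auto simp: better_exp_def F_def edges_def)
    have frame: "nats s x = nats s0 x" if "x \<notin> {''f'', ''x'', ''y'', ''j'', ''k''}" for x
      using s that by (simp add: scanned_def)
    have rframe: "reals s x = reals s0 x" if "x \<noteq> ''z''" for x
      using s that by (simp add: scanned_def)
    have sc: "if nats s ''f'' [] = 0 then F \<inter> A v u = {}
        else (nats s ''x'' [], nats s ''y'' []) \<in> F \<and> reals s ''z'' [] = slack (nats s ''x'' [], nats s ''y'' []) \<and>
          (\<forall>e\<in>F \<inter> A v u. reals s ''z'' [] \<le> slack e)"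
      using s unfolding scanned_def Let_def F_def slack_def by (elim conjE)
    have none: "F \<inter> A v u = {}" if "nats s ''f'' [] = 0"
      using sc that by simp
    have some: "(nats s ''x'' [], nats s ''y'' []) \<in> F" "reals s ''z'' [] = slack (nats s ''x'' [], nats s ''y'' [])"
       "\<And>e. e \<in> F \<Longrightarrow> e \<in> A v u \<Longrightarrow> reals s ''z'' [] \<le> slack e" if "nats s ''f'' [] \<noteq> 0"
      using sc that by (simp, simp, auto split: if_splits)
    show ?thesis
      unfolding body_def
    proof (rule runs_Cond[where T = 4])
      assume b: "bval better_exp s"
      define s' where "s' = s\<lparr>nats := upd (upd (upd (nats s) ''f'' [] 1) ''x'' [] v) ''y'' [] u,
         reals := upd (reals s) ''z'' [] (slack (v, u))\<rparr>"
      have "rval slack_exp (s\<lparr>nats := upd (upd (upd (nats s) ''f'' [] 1) ''x'' [] v) ''y'' [] u\<rparr>) = slack (v, u)"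
        using s u fr by (simp add: slack_exp_def slack_def level_cost_def)
      then have run: "runs record_edge s 4 (\<lambda>t. t = s')"
        using s u unfolding record_edge_def
        by (intro runs_Seq[where ?T1.0 = 1 and ?T2.0 = 3] runs_Seq[where ?T1.0 = 1 and ?T2.0 = 2]
             runs_Seq[where ?T1.0 = 1 and ?T2.0 = 1] runs_NAssign runs_RAssign)
           (simp_all add: s'_def)
      have "\<forall>e\<in>F \<inter> A v (Suc u). slack (v, u) \<le> slack e"
      proof
        fix e assume "e \<in> F \<inter> A v (Suc u)"
        then show "slack (v, u) \<le> slack e"
          using none some(3)[of e] b unfolding A better by (cases "e = (v, u)") fastforce+
      qed
      then have "scanned n s0 (A v (Suc u)) s'"
        using b frame rframe unfolding scanned_def Let_def F_def[symmetric] slack_def[symmetric]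
        by (simp add: s'_def better)
      moreover have "nats s' ''j'' [] = v" using s by (simp add: s'_def)
      ultimately show "runs record_edge s 4 (\<lambda>s. scanned n s0 (A v (Suc u)) s \<and> nats s ''j'' [] = v)"
        by (intro runs_mono[OF run]) auto
    next
      assume b: "\<not> bval better_exp s"
      have "scanned n s0 (A v (Suc u)) s"
      proof (cases "nats s ''f'' [] = 0")
        case True
        then have "F \<inter> A v (Suc u) = {}" using none b unfolding A better by auto
        with True show ?thesis
          using frame rframe unfolding scanned_def Let_def F_def[symmetric] slack_def[symmetric] by simp
      next
        case False
        have "reals s ''z'' [] \<le> slack e" if "e \<in> F \<inter> A v (Suc u)" for e
          using some(3)[OF False, of e] that b False unfolding A better by (cases "e = (v, u)") auto
        with False show ?thesis
          using frame rframe some[OF False]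
          unfolding scanned_def Let_def F_def[symmetric] slack_def[symmetric] by simp
      qed
      then show "runs Skip s 4 (\<lambda>s. scanned n s0 (A v (Suc u)) s \<and> nats s ''j'' [] = v)"
        using s by (intro runs_Skip) auto
    qed simp
  qed
  have body_writes: "nat_writes body = {''f'', ''x'', ''y''}" by (auto simp: body_def record_edge_def)
  have inner: "runs (For ''k'' body) s (n * 7 + 2) (scanned n s0 (A (Suc v) 0))"
    if v: "v < n" "scanned n s0 (A v 0) s" "nats s ''j'' [] = v" "nats s ''n'' [] = n" for s v
  proof -
    have "runs (For ''k'' body) s (n * 7 + 2) (\<lambda>s. scanned n s0 (A v n) s \<and> nats s ''j'' [] = v)"
    proof (rule runs_For[where I = "\<lambda>u s. scanned n s0 (A v u) s \<and> nats s ''j'' [] = v" and T = 5])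
      show "scanned n s0 (A v u) (s'\<lparr>nats := upd (nats s') ''k'' [] u'\<rparr>) \<and> nats (s'\<lparr>nats := upd (nats s') ''k'' [] u'\<rparr>) ''j'' [] = v"
        if "scanned n s0 (A v u) s' \<and> nats s' ''j'' [] = v" for u u' s'
        using that by (simp add: scanned_counter)
      show "runs body s' 5 (\<lambda>s. scanned n s0 (A v (Suc u)) s \<and> nats s ''j'' [] = v)"
        if "u < n" "scanned n s0 (A v u) s' \<and> nats s' ''j'' [] = v" "nats s' ''k'' [] = u" for u s'
        using step that v(1) by blast
    qed (use v in \<open>simp_all add: body_writes\<close>)
    then show ?thesis
      by (rule runs_mono[OF _ order_refl])
         (rule scanned_cong[of _ _ "A v n"], auto simp: A_def edges_def less_Suc_eq)
  qed
  have outer: "runs (For ''j'' (For ''k'' body)) s (n * (n * 7 + 4) + 2) (scanned n s0 (A n 0))"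
    if s: "scanned n s0 (A 0 0) s" "nats s ''n'' [] = n" for s
  proof (rule runs_For[where I = "\<lambda>v. scanned n s0 (A v 0)" and T = "n * 7 + 2"])
    show "runs (For ''k'' body) s' (n * 7 + 2) (scanned n s0 (A (Suc v) 0))"
      if "v < n" "scanned n s0 (A v 0) s'" "nats s' ''j'' [] = v" "nats s' ''n'' [] = n" for v s'
      using inner that by blast
  qed (use s in \<open>simp_all add: body_writes scanned_counter distrib_left\<close>)
  have "scanned n s0 (A 0 0) (s0\<lparr>nats := upd (nats s0) ''f'' [] 0\<rparr>)"
    by (simp add: scanned_def A_def)
  then have "runs search s0 (n * (n * 7 + 4) + 3) (scanned n s0 (A n 0))"
    unfolding search_def body_def[symmetric] using n
    by (intro runs_Seq[where ?T1.0 = 1 and ?T2.0 = "n * (n * 7 + 4) + 2"] runs_NAssign outer) simp_all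
  then show ?thesis
  proof (rule runs_mono[OF _ order_refl])
    fix s assume s: "scanned n s0 (A n 0) s"
    define F where "F = {(j, k) \<in> edges n s0. j \<in> tree_rows n s0 \<and> k \<notin> tree_cols n s0}"
    define slack where "slack = (\<lambda>(j, k). level_cost s0 (j, k) - row_dual s0 j - col_dual s0 k)"
    have F: "F \<inter> A n 0 = F" "F \<noteq> {}"
      using front by (auto simp: A_def edges_def F_def)
    have sc: "if nats s ''f'' [] = 0 then F \<inter> A n 0 = {}
        else (nats s ''x'' [], nats s ''y'' []) \<in> F \<and> reals s ''z'' [] = slack (nats s ''x'' [], nats s ''y'' []) \<and>
          (\<forall>e\<in>F \<inter> A n 0. reals s ''z'' [] \<le> slack e)"
      using s unfolding scanned_def Let_def F_def slack_def by (elim conjE)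
    have nz: "nats s ''f'' [] \<noteq> 0" using sc F by (intro notI) simp
    have r: "(nats s ''x'' [], nats s ''y'' []) \<in> F \<and> reals s ''z'' [] = slack (nats s ''x'' [], nats s ''y'' []) \<and>
          (\<forall>e\<in>F. reals s ''z'' [] \<le> slack e)"
      using sc unfolding F(1) if_not_P[OF nz] .
    have "nats s ''x'' [] \<in> tree_rows n s0 \<and> nats s ''y'' [] \<notin> tree_cols n s0 \<and>
       (nats s ''x'' [], nats s ''y'' []) \<in> edges n s0"
      using r[THEN conjunct1] unfolding F_def by blast
    moreover have "reals s ''z'' [] = level_cost s0 (nats s ''x'' [], nats s ''y'' []) -
        row_dual s0 (nats s ''x'' []) - col_dual s0 (nats s ''y'' [])"
      using r[THEN conjunct2, THEN conjunct1] unfolding slack_def prod.case .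
    moreover have "reals s ''z'' [] \<le> level_cost s0 (j, k) - row_dual s0 j - col_dual s0 k"
      if "j \<in> tree_rows n s0" "k \<notin> tree_cols n s0" "(j, k) \<in> edges n s0" for j k
    proof -
      have "(j, k) \<in> F" using that unfolding F_def by blast
      then have "reals s ''z'' [] \<le> slack (j, k)" using r[THEN conjunct2, THEN conjunct2] by (rule bspec[rotated])
      then show ?thesis unfolding slack_def prod.case .
    qed
    ultimately show "?Q s"
      unfolding Let_def by blast
  qed
qed

lemma runs_shift_duals:
  assumes n: "nats s ''n'' [] = n"
  shows "runs shift_duals s (n * 6 + 2) (\<lambda>s'.
     row_dual s' = (\<lambda>j. if j \<in> tree_rows n s then row_dual s j + reals s ''z'' [] else row_dual s j) \<and>
     col_dual s' = (\<lambda>k. if k \<in> tree_cols n s then col_dual s k - reals s ''z'' [] else col_dual s k))"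
proof -
  define z where "z = reals s ''z'' []"
  define I where "I v s' \<longleftrightarrow> nats s' ''S'' = nats s ''S'' \<and> nats s' ''T'' = nats s ''T'' \<and> reals s' ''z'' [] = z \<and>
     row_dual s' = (\<lambda>j. if j < v \<and> 0 < nats s ''S'' [j] then row_dual s j + z else row_dual s j) \<and>
     col_dual s' = (\<lambda>k. if k < v \<and> 0 < nats s ''T'' [k] then col_dual s k - z else col_dual s k)" for v and s' :: store
  have "runs shift_duals s (n * 6 + 2) (I n)"
    unfolding shift_duals_def
  proof (rule runs_For[where T = 4])
    show "I v (s'\<lparr>nats := upd (nats s') ''j'' [] u\<rparr>)" if "I v s'" for v u s'
      using that unfolding I_def by simp
    show "runs (Seq shift_row shift_col) s' 4 (I (Suc v))" if I: "I v s'" and v: "nats s' ''j'' [] = v" for v s'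
    proof -
      define t1 where "t1 = (if 0 < nats s' ''S'' [v] then s'\<lparr>reals := upd (reals s') ''a'' [v] (row_dual s' v + z)\<rparr> else s')"
      define t2 where "t2 = (if 0 < nats t1 ''T'' [v] then t1\<lparr>reals := upd (reals t1) ''b'' [v] (col_dual t1 v - z)\<rparr> else t1)"
      have z': "reals s' ''z'' [] = z" "reals t1 ''z'' [] = z" and v': "nats t1 ''j'' [] = v"
        using I v unfolding I_def t1_def by simp_all
      have "runs (Seq shift_row shift_col) s' 4 (\<lambda>t. t = t2)"
      proof (rule runs_Seq[where ?T1.0 = 2 and ?T2.0 = 2])
        show "runs shift_row s' 2
          (\<lambda>t. runs shift_col t 2 (\<lambda>t. t = t2))"
        proof (rule runs_mono[where Q = "\<lambda>t. t = t1" and T = 2])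
          show "runs shift_row s' 2 (\<lambda>t. t = t1)"
            using v z' unfolding shift_row_def by (intro runs_Cond[where T = 1] runs_RAssign runs_Skip) (simp_all add: t1_def)
          show "runs shift_col t 2 (\<lambda>t. t = t2)"
            if "t = t1" for t
            using v' z' that unfolding shift_col_def by (intro runs_Cond[where T = 1] runs_RAssign runs_Skip) (simp_all add: t2_def)
        qed simp
      qed simp
      moreover have "I (Suc v) t2"
        using I v unfolding I_def t2_def t1_def
        by (auto simp: fun_eq_iff less_Suc_eq)
      ultimately show ?thesis by (auto elim: runs_mono)
    qed
  qed (use n in \<open>simp_all add: shift_row_def shift_col_def I_def z_def\<close>)
  then show ?thesis
    unfolding z_def[symmetric] by (rule runs_mono[OF _ order_refl]) (simp add: I_def conj_commute cong: conj_cong)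
qed

lemma runs_augment:
  assumes E: "E \<subseteq> {..<n} \<times> {..<n}" and p: "nats s ''p'' [] = p"
    and inv: "augment_inv n E w p a b (row_mate s) (col_mate s) (parent s) (nats s ''y'' []) v" and "v \<le> n"
  shows "runs augment s (Suc n * 7 + 2) (\<lambda>s'. matched n E w (Suc p) a b (row_mate s') (col_mate s'))"
proof -
  define body where "body = Seq (NAssign ''x'' [] (NVar ''P'' [scalar ''y'']))
     (Seq (NAssign ''k'' [] (NVar ''m'' [scalar ''x'']))
     (Seq (NAssign ''c'' [scalar ''y''] (NAdd (scalar ''x'') (NConst 1)))
     (Seq (NAssign ''m'' [scalar ''x''] (scalar ''y''))
       (Cond (NLess (scalar ''x'') (scalar ''p'')) (NAssign ''y'' [] (scalar ''k'')) (NAssign ''g'' [] (NConst 1))))))"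
  define PP where "PP = parent s"
  \<comment> \<open>The rank is \<open>Suc v\<close> while the path is followed, and may be 0 once
    \<open>g\<close> is set; thus the closing round decreases it too.\<close>
  define I where "I k s' \<longleftrightarrow> nats s' ''p'' [] = p \<and> parent s' = PP \<and>
     (if nats s' ''g'' [] = 0
      then \<exists>v. k = Suc v \<and> augment_inv n E w p a b (row_mate s') (col_mate s') PP (nats s' ''y'' []) v
      else matched n E w (Suc p) a b (row_mate s') (col_mate s'))" for k and s' :: store
  have "runs (While (NLess (scalar ''g'') (NConst 1)) body) (s\<lparr>nats := upd (nats s) ''g'' [] 0\<rparr>) (Suc v * (6 + 1) + 1)
     (\<lambda>s'. matched n E w (Suc p) a b (row_mate s') (col_mate s'))"
  proof (rule runs_While[where I = I])
    show "I (Suc v) (s\<lparr>nats := upd (nats s) ''g'' [] 0\<rparr>)"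
      using p inv by (simp add: I_def PP_def)
    show "matched n E w (Suc p) a b (row_mate s') (col_mate s')"
      if "I k s'" "\<not> bval (NLess (scalar ''g'') (NConst 1)) s'" for k s'
      using that by (simp add: I_def)
    show "runs body s' 6 (\<lambda>s'. \<exists>k'<k. I k' s')" if I: "I k s'" and g: "bval (NLess (scalar ''g'') (NConst 1)) s'" for k s'
    proof -
      define y where "y = nats s' ''y'' []"
      define x where "x = PP y"
      define y' where "y' = row_mate s' x"
      have g0: "nats s' ''g'' [] = 0" using g by simp
      with I obtain v where v: "k = Suc v" "augment_inv n E w p a b (row_mate s') (col_mate s') PP y v"
        and p': "nats s' ''p'' [] = p" and par: "\<And>k. nats s' ''P'' [k] = PP k"
        unfolding I_def y_def by (auto simp: fun_eq_iff)
      define t1 where "t1 = s'\<lparr>nats := upd (upd (upd (upd (nats s') ''x'' [] x) ''k'' [] y') ''c'' [y] (Suc x)) ''m'' [x] y\<rparr>"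
      define t2 where "t2 = (if x < p then t1\<lparr>nats := upd (nats t1) ''y'' [] y'\<rparr> else t1\<lparr>nats := upd (nats t1) ''g'' [] 1\<rparr>)"
      have c: "runs (Cond (NLess (scalar ''x'') (scalar ''p'')) (NAssign ''y'' [] (scalar ''k'')) (NAssign ''g'' [] (NConst 1)))
           t1 2 (\<lambda>t. t = t2)"
        using p' by (intro runs_Cond[where T = 1] runs_NAssign) (simp_all add: t2_def t1_def)
      have run: "runs body s' 6 (\<lambda>t. t = t2)"
        unfolding body_def
        by (rule runs_Seq[where ?T1.0 = 1 and ?T2.0 = 5], rule runs_NAssign, simp,
            rule runs_Seq[where ?T1.0 = 1 and ?T2.0 = 4], rule runs_NAssign, simp,
            rule runs_Seq[where ?T1.0 = 1 and ?T2.0 = 3], rule runs_NAssign, simp,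
            rule runs_Seq[where ?T1.0 = 1 and ?T2.0 = 2], rule runs_NAssign, simp)
           (use c in \<open>simp_all add: t1_def y_def[symmetric] par x_def[symmetric] y'_def[symmetric]\<close>)
      have mates: "row_mate t2 = (row_mate s')(x := y)" "col_mate t2 = (col_mate s')(y := Suc x)"
        by (auto simp: t2_def t1_def fun_eq_iff)
      have frame: "nats t2 ''p'' [] = p" "parent t2 = PP"
        using p' par by (simp_all add: t2_def t1_def)
      have "\<exists>k'<k. I k' t2"
      proof (cases "x < p")
        case True
        then obtain v' where v': "v' < v" "augment_inv n E w p a b ((row_mate s')(x := y)) ((col_mate s')(y := Suc x)) PP y' v'"
          using augment_inv_step[OF E v(2)] by (auto simp: x_def y'_def)
        have "nats t2 ''g'' [] = 0" "nats t2 ''y'' [] = y'" using True g0 by (simp_all add: t2_def t1_def)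
        with v' frame have "I (Suc v') t2" unfolding I_def mates by simp
        with v' v(1) show ?thesis by (intro exI[of _ "Suc v'"]) simp
      next
        case False
        then have "nats t2 ''g'' [] = 1" by (simp add: t2_def t1_def)
        moreover have "matched n E w (Suc p) a b ((row_mate s')(x := y)) ((col_mate s')(y := Suc x))"
          using augment_inv_finish[OF v(2)] False by (simp add: x_def)
        ultimately have "I 0 t2" using frame unfolding I_def mates by simp
        with v(1) show ?thesis by (intro exI[of _ 0]) simp
      qed
      with run show ?thesis by (auto elim: runs_mono)
    qed
  qed
  moreover have "Suc v * (6 + 1) + 1 \<le> Suc n * 7 + 1" using \<open>v \<le> n\<close> by simp
  ultimately show ?thesis
    unfolding augment_def body_def[symmetric]
    by (intro runs_Seq[where ?T1.0 = 1 and ?T2.0 = "Suc n * 7 + 1"] runs_NAssign) (auto elim: runs_mono)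
qed

lemma runs_grow:
  assumes E: "E \<subseteq> {..<n} \<times> {..<n}" and p: "nats s ''p'' [] = p" "p < n" and d: "nats s ''d'' [] = 0"
    and inv: "tree_inv n E w p a b (row_mate s) (col_mate s) (tree_rows n s) (tree_cols n s) (parent s)"
    and feas: "feasible_below E w (Suc p) a b"
    and x: "nats s ''x'' [] = x" "x \<in> tree_rows n s" and y: "nats s ''y'' [] = y" "y \<notin> tree_cols n s"
    and xy: "(x, y) \<in> E" "a x + b y = w (x, y)"
  shows "runs grow s (n * 7 + 12) (\<lambda>s'.
     if nats s' ''d'' [] = 0
     then tree_inv n E w p a b (row_mate s') (col_mate s') (tree_rows n s') (tree_cols n s') (parent s') \<and>
          card (tree_cols n s') = Suc (card (tree_cols n s))
     else matched n E w (Suc p) a b (row_mate s') (col_mate s'))"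
    (is "runs grow s _ ?Q")
proof -
  define t1 where "t1 = s\<lparr>nats := upd (nats s) ''P'' [y] x\<rparr>"
  have "y < n" using xy E by auto
  have par: "parent t1 = (parent s)(y := x)" by (auto simp: t1_def fun_eq_iff)
  have "runs (Cond (NLess (NConst 0) (NVar ''c'' [scalar ''y'']))
       extend_tree
       (Seq (NAssign ''d'' [] (NConst 1)) augment)) t1 (n * 7 + 11) ?Q"
  proof (rule runs_Cond[where T = "n * 7 + 10"])
    assume "bval (NLess (NConst 0) (NVar ''c'' [scalar ''y''])) t1"
    then have c: "col_mate s y \<noteq> 0" using y by (simp add: t1_def)
    define t2 where "t2 = t1\<lparr>nats := upd (upd (nats t1) ''T'' [y] 1) ''S'' [col_mate s y - 1] 1\<rparr>"
    have run: "runs extend_tree t1 (n * 7 + 10) (\<lambda>t. t = t2)"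
      unfolding extend_tree_def by (rule runs_Seq[where ?T1.0 = 1 and ?T2.0 = 1], rule runs_NAssign, simp, rule runs_NAssign)
         (use y in \<open>simp_all add: t2_def t1_def\<close>)
    have "col_mate s y \<le> p" using inv c \<open>y < n\<close> by (simp add: tree_inv_def matched_def)
    then have rows: "tree_rows n t2 = insert (col_mate s y - 1) (tree_rows n s)"
      using \<open>p < n\<close> c by (auto simp: t2_def t1_def)
    have cols: "tree_cols n t2 = insert y (tree_cols n s)"
      using \<open>y < n\<close> by (auto simp: t2_def t1_def)
    have others: "row_mate t2 = row_mate s" "col_mate t2 = col_mate s" "parent t2 = parent t1" "nats t2 ''d'' [] = 0"
      using d by (simp_all add: t2_def t1_def)
    have "?Q t2"
      using tree_inv_grow[OF inv feas x(2) y(2) \<open>y < n\<close> xy c] y(2)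
      unfolding rows cols others par by simp
    with run show "runs extend_tree t1 (n * 7 + 10) ?Q"
      by (auto elim: runs_mono)
  next
    assume "\<not> bval (NLess (NConst 0) (NVar ''c'' [scalar ''y''])) t1"
    then have c: "col_mate s y = 0" using y by (simp add: t1_def)
    define t2 where "t2 = t1\<lparr>nats := upd (nats t1) ''d'' [] 1\<rparr>"
    have t2: "row_mate t2 = row_mate s" "col_mate t2 = col_mate s" "parent t2 = parent t1"
      "nats t2 ''y'' [] = y" "nats t2 ''p'' [] = p" "nats t2 ''d'' [] = 1"
      using y p by (simp_all add: t2_def t1_def)
    obtain v where v: "v \<le> n" "augment_inv n E w p a b (row_mate s) (col_mate s) ((parent s)(y := x)) y v"
      using tree_inv_augment[OF inv x(2) y(2) \<open>y < n\<close> xy c] by blast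
    have "runs augment t2 (Suc n * 7 + 2) (\<lambda>s'. matched n E w (Suc p) a b (row_mate s') (col_mate s'))"
      by (rule runs_augment[OF E t2(5) _ v(1)]) (use v(2) in \<open>simp add: t2 par\<close>)
    \<comment> \<open>An augmentation does not write \<open>d\<close>, so the flag set just before
      selects the second branch of the postcondition.\<close>
    then have "runs augment t2 (n * 7 + 9) ?Q"
      by (rule runs_mono[OF runs_frame]) (use t2(6) in \<open>simp_all add: augment_def\<close>)
    then show "runs (Seq (NAssign ''d'' [] (NConst 1)) augment) t1 (n * 7 + 10) ?Q"
      by (intro runs_Seq[where ?T1.0 = 1 and ?T2.0 = "n * 7 + 9"] runs_NAssign) (simp_all add: t2_def)
  qed simp
  then show ?thesis
    unfolding grow_def using x y
    by (intro runs_Seq[where ?T1.0 = 1 and ?T2.0 = "n * 7 + 11"] runs_NAssign) (simp_all add: t1_def)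
qed

lemma runs_init_tree:
  assumes n: "nats s ''n'' [] = n" and p: "nats s ''p'' [] = p" "p < n"
  shows "runs init_tree s (n * 4 + 4) (\<lambda>s'. tree_rows n s' = {p} \<and> tree_cols n s' = {} \<and> nats s' ''d'' [] = 0)"
proof -
  define body where "body = Seq (NAssign ''S'' [scalar ''j''] (NConst 0)) (NAssign ''T'' [scalar ''j''] (NConst 0))"
  define I where "I v s' \<longleftrightarrow> nats s' ''p'' [] = p \<and> (\<forall>j<v. nats s' ''S'' [j] = 0 \<and> nats s' ''T'' [j] = 0)" for v and s' :: store
  have "runs (For ''j'' body) s (n * 4 + 2) (I n)"
  proof (rule runs_For[where T = 2])
    show "runs body s' 2 (I (Suc v))" if "I v s'" "nats s' ''j'' [] = v" for v s'
      unfolding body_def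
      by (rule runs_Seq[where ?T1.0 = 1 and ?T2.0 = 1], rule runs_NAssign, simp, rule runs_NAssign)
         (use that in \<open>auto simp: I_def less_Suc_eq\<close>)
  qed (use n p in \<open>simp_all add: body_def I_def\<close>)
  then show ?thesis
    unfolding init_tree_def body_def[symmetric]
  proof (rule runs_Seq[where ?T2.0 = 2, OF runs_mono])
    fix s' assume "I n s'"
    then show "runs (Seq (NAssign ''S'' [scalar ''p''] (NConst 1)) (NAssign ''d'' [] (NConst 0))) s' 2
       (\<lambda>s'. tree_rows n s' = {p} \<and> tree_cols n s' = {} \<and> nats s' ''d'' [] = 0)"
      using \<open>p < n\<close>
      by (intro runs_Seq[where ?T1.0 = 1 and ?T2.0 = 1] runs_NAssign) (auto simp: I_def)
  qed auto
qed

lemma runs_phase: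
  assumes reg: "regular_graph n r E" "0 < r" and set: "setting n E w p s" and "p < n"
    and m: "matched n E w p (row_dual s) (col_dual s) (row_mate s) (col_mate s)"
    and f: "feasible_below E w p (row_dual s) (col_dual s)"
  shows "runs phase s (Suc n * (n * (n * 7 + 17) + 18) + (n * 4 + 5)) (\<lambda>s'.
     matched n E w (Suc p) (row_dual s') (col_dual s') (row_mate s') (col_mate s') \<and>
     feasible_below E w (Suc p) (row_dual s') (col_dual s'))"
    (is "runs phase s _ ?Q")
proof -
  have E: "E \<subseteq> {..<n} \<times> {..<n}" using reg by (simp add: regular_graph_def)
  define body where "body = Seq search (Seq shift_duals grow)"
  \<comment> \<open>Each round adds a column to the tree or ends the phase, so the number of missing
    columns plus 1 serves as rank.\<close>
  define I where "I k s' \<longleftrightarrow> setting n E w p s' \<and>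
     (if nats s' ''d'' [] = 0 then k = Suc (n - card (tree_cols n s')) \<and>
        tree_inv n E w p (row_dual s') (col_dual s') (row_mate s') (col_mate s') (tree_rows n s') (tree_cols n s') (parent s')
      else matched n E w (Suc p) (row_dual s') (col_dual s') (row_mate s') (col_mate s') \<and>
        feasible_below E w (Suc p) (row_dual s') (col_dual s'))" for k and s' :: store
  have loop: "runs (While (NLess (scalar ''d'') (NConst 1)) body) s' (Suc n * (n * (n * 7 + 17) + 17 + 1) + 1) ?Q" if "I (Suc n) s'" for s'
  proof (rule runs_While[where I = I, OF that])
    show "?Q s'"
      if "I k s'" "\<not> bval (NLess (scalar ''d'') (NConst 1)) s'" for k s'
      using that by (simp add: I_def)
    fix k s0 assume I: "I k s0" and b: "bval (NLess (scalar ''d'') (NConst 1)) s0"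
    define a b S T P m c where defs: "a = row_dual s0" "b = col_dual s0" "S = tree_rows n s0" "T = tree_cols n s0"
      "P = parent s0" "m = row_mate s0" "c = col_mate s0"
    have d: "nats s0 ''d'' [] = 0" using b by simp
    have set0: "setting n E w p s0" and k: "k = Suc (n - card T)" and inv: "tree_inv n E w p a b m c S T P"
      using I d by (simp_all add: I_def defs)
    have n0: "nats s0 ''n'' [] = n" and E0: "edges n s0 = E" and w0: "level_cost s0 = w"
      using set0 by (simp_all add: setting_def)
    define found where "found s1 \<longleftrightarrow> (let x = nats s1 ''x'' []; y = nats s1 ''y'' []; z = reals s1 ''z'' [] in
       x \<in> S \<and> y \<notin> T \<and> (x, y) \<in> E \<and> z = w (x, y) - a x - b y \<and>
       (\<forall>j k. j \<in> S \<longrightarrow> k \<notin> T \<longrightarrow> (j, k) \<in> E \<longrightarrow> z \<le> w (j, k) - a j - b k))" for s1 :: store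
    have "runs search s0 (n * (n * 7 + 4) + 3) found"
      using runs_search[OF n0, unfolded E0 w0, folded defs(3,4)] tree_inv_frontier[OF reg inv \<open>p < n\<close>]
      unfolding found_def defs(1,2) by blast
    then show "runs body s0 (n * (n * 7 + 17) + 17) (\<lambda>s'. \<exists>k'<k. I k' s')"
      unfolding body_def
    proof (rule runs_Seq[where ?T2.0 = "n * 13 + 14", OF runs_mono[OF runs_frame order_refl]])
      fix s1 :: store assume s1: "found s1 \<and> framed search s0 s1"
      define x y \<theta> where "x = nats s1 ''x'' []" and "y = nats s1 ''y'' []" and "\<theta> = reals s1 ''z'' []"
      have xy_all: "x \<in> S \<and> y \<notin> T \<and> (x, y) \<in> E \<and> \<theta> = w (x, y) - a x - b y \<and>
          (\<forall>j k. j \<in> S \<longrightarrow> k \<notin> T \<longrightarrow> (j, k) \<in> E \<longrightarrow> \<theta> \<le> w (j, k) - a j - b k)"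
        using s1[THEN conjunct1] unfolding found_def Let_def x_def y_def \<theta>_def .
      note xy = xy_all[THEN conjunct1] xy_all[THEN conjunct2, THEN conjunct1]
        xy_all[THEN conjunct2, THEN conjunct2, THEN conjunct1]
        xy_all[THEN conjunct2, THEN conjunct2, THEN conjunct2, THEN conjunct1]
      have xy_min: "\<theta> \<le> w (j, k) - a j - b k" if "j \<in> S" "k \<notin> T" "(j, k) \<in> E" for j k
        using xy_all[THEN conjunct2, THEN conjunct2, THEN conjunct2, THEN conjunct2, rule_format] that .
      have set1: "setting n E w p s1"
        by (rule setting_frame[OF set0 s1[THEN conjunct2]])
           (simp_all add: search_def record_edge_def)
      have nf1: "nats s1 ''d'' = nats s0 ''d''" "nats s1 ''S'' = nats s0 ''S''" "nats s1 ''T'' = nats s0 ''T''"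
        "nats s1 ''P'' = nats s0 ''P''" "nats s1 ''m'' = nats s0 ''m''" "nats s1 ''c'' = nats s0 ''c''"
        "nats s1 ''n'' = nats s0 ''n''"
        using s1[THEN conjunct2, THEN conjunct1] by (simp_all add: search_def record_edge_def)
      have rf1: "reals s1 ''a'' = reals s0 ''a''" "reals s1 ''b'' = reals s0 ''b''"
        using s1[THEN conjunct2, THEN conjunct2] by (simp_all add: search_def record_edge_def)
      define a' b' where "a' = (\<lambda>j. if j \<in> S then a j + \<theta> else a j)" and "b' = (\<lambda>k. if k \<in> T then b k - \<theta> else b k)"
      have n1: "nats s1 ''n'' [] = n" using n0 nf1 by simp
      have shift: "runs shift_duals s1 (n * 6 + 2) (\<lambda>s2. row_dual s2 = a' \<and> col_dual s2 = b')"
        using runs_shift_duals[OF n1] nf1 rf1 by (simp add: a'_def b'_def defs \<theta>_def cong: if_cong)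
      have inv': "tree_inv n E w p a' b' m c S T P" "feasible_below E w (Suc p) a' b'" "a' x + b' y = w (x, y)"
        unfolding a'_def b'_def by (rule tree_inv_shift[OF inv xy], simp add: xy_min)+
      from shift show "runs (Seq shift_duals grow) s1 (n * 13 + 14) (\<lambda>s'. \<exists>k'<k. I k' s')"
      proof (rule runs_Seq[where ?T2.0 = "n * 7 + 12", OF runs_mono[OF runs_frame order_refl]])
        fix s2 :: store assume s2: "(row_dual s2 = a' \<and> col_dual s2 = b') \<and> framed shift_duals s1 s2"
        have set2: "setting n E w p s2"
          by (rule setting_frame[OF set1 s2[THEN conjunct2]])
             (simp_all add: shift_duals_def shift_row_def shift_col_def)
        have "nats s2 ''d'' = nats s1 ''d''" "nats s2 ''S'' = nats s1 ''S''" "nats s2 ''T'' = nats s1 ''T''"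
          "nats s2 ''P'' = nats s1 ''P''" "nats s2 ''m'' = nats s1 ''m''" "nats s2 ''c'' = nats s1 ''c''"
          "nats s2 ''x'' = nats s1 ''x''" "nats s2 ''y'' = nats s1 ''y''"
          using s2[THEN conjunct2, THEN conjunct1] by (simp_all add: shift_duals_def shift_row_def shift_col_def)
        then have s2_eqs: "tree_rows n s2 = S" "tree_cols n s2 = T" "parent s2 = P" "row_mate s2 = m" "col_mate s2 = c"
          "nats s2 ''d'' [] = 0" "nats s2 ''x'' [] = x" "nats s2 ''y'' [] = y"
          using nf1 d by (simp_all add: defs x_def y_def)
        have p2: "nats s2 ''p'' [] = p" using set2 by (simp add: setting_def)
        have g: "runs grow s2 (n * 7 + 12) (\<lambda>s'. if nats s' ''d'' [] = 0
           then tree_inv n E w p a' b' (row_mate s') (col_mate s') (tree_rows n s') (tree_cols n s') (parent s') \<and>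
                card (tree_cols n s') = Suc (card T)
           else matched n E w (Suc p) a' b' (row_mate s') (col_mate s'))"
          using runs_grow[OF E p2 \<open>p < n\<close> s2_eqs(6), unfolded s2_eqs, OF inv'(1,2) refl xy(1) refl xy(2,3) inv'(3)] .
        show "runs grow s2 (n * 7 + 12) (\<lambda>s'. \<exists>k'<k. I k' s')"
        proof (rule runs_mono[OF runs_frame[OF g] order_refl])
          fix s3 :: store assume s3: "(if nats s3 ''d'' [] = 0
           then tree_inv n E w p a' b' (row_mate s3) (col_mate s3) (tree_rows n s3) (tree_cols n s3) (parent s3) \<and>
                card (tree_cols n s3) = Suc (card T)
           else matched n E w (Suc p) a' b' (row_mate s3) (col_mate s3)) \<and>
           framed grow s2 s3"
          have set3: "setting n E w p s3"
            by (rule setting_frame[OF set2 s3[THEN conjunct2]])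
               (simp_all add: grow_def extend_tree_def augment_def)
          have "reals s3 v = reals s2 v" for v
            using s3[THEN conjunct2, THEN conjunct2] by (auto simp: grow_def extend_tree_def augment_def)
          then have duals: "row_dual s3 = a'" "col_dual s3 = b'" using s2 by simp_all
          show "\<exists>k'<k. I k' s3"
          proof (cases "nats s3 ''d'' [] = 0")
            case True
            have "card (tree_cols n s3) \<le> card {..<n}" by (intro card_mono) auto
            then have "Suc (card T) \<le> n" using s3 True by simp
            then have "Suc (n - Suc (card T)) < k" using k by simp
            moreover have "I (Suc (n - Suc (card T))) s3"
              using s3[THEN conjunct1] True set3 by (simp add: I_def duals)
            ultimately show ?thesis by blast
          next
            case False
            then have "I 0 s3" using s3[THEN conjunct1] set3 inv'(2) by (simp add: I_def duals)
            then show ?thesis using k by (intro exI[of _ 0]) simp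
          qed
        qed
      qed simp
    qed (simp add: distrib_left)
  qed
  show ?thesis
    unfolding phase_def body_def[symmetric]
  proof (rule runs_Seq[where ?T1.0 = "n * 4 + 4" and ?T2.0 = "Suc n * (n * (n * 7 + 17) + 17 + 1) + 1"])
    have n: "nats s ''n'' [] = n" "nats s ''p'' [] = p" using set by (simp_all add: setting_def)
    show "runs init_tree s (n * 4 + 4) (\<lambda>s'. runs (While (NLess (scalar ''d'') (NConst 1)) body) s' (Suc n * (n * (n * 7 + 17) + 17 + 1) + 1) ?Q)"
    proof (rule runs_mono[OF runs_frame[OF runs_init_tree[OF n \<open>p < n\<close>]] order_refl])
      fix s1 :: store assume s1: "(tree_rows n s1 = {p} \<and> tree_cols n s1 = {} \<and> nats s1 ''d'' [] = 0) \<and>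
         framed init_tree s s1"
      have set1: "setting n E w p s1"
        by (rule setting_frame[OF set s1[THEN conjunct2]])
           (simp_all add: init_tree_def)
      have "nats s1 ''m'' = nats s ''m''" "nats s1 ''c'' = nats s ''c''" "reals s1 ''a'' = reals s ''a''" "reals s1 ''b'' = reals s ''b''"
        using s1[THEN conjunct2] by (simp_all add: init_tree_def)
      then have "tree_inv n E w p (row_dual s1) (col_dual s1) (row_mate s1) (col_mate s1) {p} {} (parent s1)"
        using tree_inv_initial[OF m f] by simp
      moreover have rows: "tree_rows n s1 = {p}" and cols: "tree_cols n s1 = {}" and d: "nats s1 ''d'' [] = 0"
        using s1 by blast+
      ultimately have "I (Suc n) s1" using set1 unfolding I_def rows cols by simp
      then show "runs (While (NLess (scalar ''d'') (NConst 1)) body) s1 (Suc n * (n * (n * 7 + 17) + 17 + 1) + 1) ?Q"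
        by (rule loop)
    qed
  qed simp
qed

lemma runs_rows:
  assumes reg: "regular_graph n r E" "0 < r" and n: "nats s ''n'' [] = n" and E: "edges n s = E" and w: "level_cost s = w"
    and c: "\<And>k. k < n \<Longrightarrow> nats s ''c'' [k] = 0"
  shows "runs (For ''p'' phase) s (n * (Suc n * (n * (n * 7 + 17) + 18) + (n * 4 + 5) + 2) + 2) (\<lambda>s'.
     dual_feasible E w (row_dual s') (col_dual s') \<and>
     perfect_matching n (tight_edges E w (row_dual s') (col_dual s')) (row_mate s'))"
proof -
  define I where "I p s' \<longleftrightarrow> edges n s' = E \<and> level_cost s' = w \<and>
     matched n E w p (row_dual s') (col_dual s') (row_mate s') (col_mate s') \<and>
     feasible_below E w p (row_dual s') (col_dual s')" for p and s' :: store
  have "runs (For ''p'' phase) s (n * (Suc n * (n * (n * 7 + 17) + 18) + (n * 4 + 5) + 2) + 2) (I n)"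
  proof (rule runs_For[where T = "Suc n * (n * (n * 7 + 17) + 18) + (n * 4 + 5)"])
    show "I 0 s" using E w c by (simp add: I_def matched_def feasible_below_def)
    show "I p (s'\<lparr>nats := upd (nats s') ''p'' [] u\<rparr>)" if "I p s'" for p u s'
      using that by (simp add: I_def edges_def level_cost_def)
    show "runs phase s' (Suc n * (n * (n * 7 + 17) + 18) + (n * 4 + 5)) (I (Suc p))"
      if p: "p < n" "I p s'" "nats s' ''p'' [] = p" "nats s' ''n'' [] = n" for p s'
    proof -
      have set: "setting n E w p s'" using p by (simp add: I_def setting_def)
      have m: "matched n E w p (row_dual s') (col_dual s') (row_mate s') (col_mate s')"
        and f: "feasible_below E w p (row_dual s') (col_dual s')"
        using p(2) unfolding I_def by blast+
      show ?thesis
      proof (rule runs_mono[OF runs_frame[OF runs_phase[OF reg set p(1) m f]] order_refl])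
        fix t :: store assume t: "(matched n E w (Suc p) (row_dual t) (col_dual t) (row_mate t) (col_mate t) \<and>
            feasible_below E w (Suc p) (row_dual t) (col_dual t)) \<and>
          framed phase s' t"
        have "setting n E w p t"
          by (rule setting_frame[OF set t[THEN conjunct2]])
             (simp_all add: program_defs)
        then show "I (Suc p) t" using t[THEN conjunct1] unfolding I_def setting_def by blast
      qed
    qed
  qed (use n in \<open>simp_all add: program_defs\<close>)
  then show ?thesis
  proof (rule runs_mono[OF _ order_refl])
    fix s' assume "I n s'"
    moreover have "E \<subseteq> {..<n} \<times> {..<n}" using reg by (simp add: regular_graph_def)
    ultimately show "dual_feasible E w (row_dual s') (col_dual s') \<and>
       perfect_matching n (tight_edges E w (row_dual s') (col_dual s')) (row_mate s')"
      using matched_perfect[of E n w "row_dual s'" "col_dual s'" "row_mate s'" "col_mate s'"] unfolding I_def by blast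
  qed
qed

lemma runs_write_level:
  assumes n: "nats s ''n'' [] = n"
  shows "runs write_level s (n * 4 + 2) (\<lambda>s'.
     (\<forall>ix. nats s' ''X'' ix = (if \<exists>j<n. ix = [nats s ''i'' [], j, row_mate s j] then 1 else nats s ''X'' ix)) \<and>
     (\<forall>ix. nats s' ''U'' ix = (if \<exists>j<n. ix = [j, row_mate s j] then 1 else nats s ''U'' ix)))"
proof -
  define i m where "i = nats s ''i'' []" and "m = row_mate s"
  define body where "body = Seq
     (NAssign ''X'' [scalar ''i'', scalar ''j'', NVar ''m'' [scalar ''j'']] (NConst 1))
     (NAssign ''U'' [scalar ''j'', NVar ''m'' [scalar ''j'']] (NConst 1))"
  define I where "I v s' \<longleftrightarrow> nats s' ''i'' [] = i \<and> row_mate s' = m \<and>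
     (\<forall>ix. nats s' ''X'' ix = (if \<exists>j<v. ix = [i, j, m j] then 1 else nats s ''X'' ix)) \<and>
     (\<forall>ix. nats s' ''U'' ix = (if \<exists>j<v. ix = [j, m j] then 1 else nats s ''U'' ix))" for v and s' :: store
  have "runs (For ''j'' body) s (n * 4 + 2) (I n)"
  proof (rule runs_For[where T = 2])
    show "runs body s' 2 (I (Suc v))" if I: "I v s'" and v: "nats s' ''j'' [] = v" for v s'
    proof -
      have i: "nats s' ''i'' [] = i" and mate: "row_mate s' = m"
        and X: "\<forall>ix. nats s' ''X'' ix = (if \<exists>j<v. ix = [i, j, m j] then 1 else nats s ''X'' ix)"
        and U: "\<forall>ix. nats s' ''U'' ix = (if \<exists>j<v. ix = [j, m j] then 1 else nats s ''U'' ix)"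
        using I unfolding I_def by blast+
      have m: "nats s' ''m'' [v] = m v" using fun_cong[OF mate, of v] .
      define t where "t = s'\<lparr>nats := upd (upd (nats s') ''X'' [i, v, m v] 1) ''U'' [v, m v] 1\<rparr>"
      have "runs body s' 2 (\<lambda>t'. t' = t)"
        unfolding body_def
        by (rule runs_Seq[where ?T1.0 = 1 and ?T2.0 = 1], rule runs_NAssign, simp, rule runs_NAssign)
           (simp_all add: v m i t_def)
      moreover have "nats t ''X'' ix = (if \<exists>j<Suc v. ix = [i, j, m j] then 1 else nats s ''X'' ix)" for ix
        using X[rule_format, of ix] by (auto simp: t_def less_Suc_eq)
      moreover have "nats t ''U'' ix = (if \<exists>j<Suc v. ix = [j, m j] then 1 else nats s ''U'' ix)" for ix
        using U[rule_format, of ix] by (auto simp: t_def less_Suc_eq)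
      moreover have "nats t ''i'' [] = i" "row_mate t = m" using i mate by (simp_all add: t_def)
      ultimately have "runs body s' 2 (\<lambda>t'. t' = t)" "I (Suc v) t" unfolding I_def by blast+
      then show ?thesis by (auto elim: runs_mono)
    qed
  qed (use n in \<open>simp_all add: body_def I_def i_def m_def\<close>)
  then show ?thesis
    unfolding write_level_def body_def[symmetric] i_def[symmetric] m_def[symmetric]
    by (rule runs_mono[OF _ order_refl]) (unfold I_def m_def, elim conjE, intro conjI)
qed

lemma runs_level:
  assumes reg: "regular_graph n r E" "0 < r" and n: "nats s ''n'' [] = n" and E: "edges n s = E" and w: "level_cost s = w"
    and i: "nats s ''i'' [] = i"
  shows "runs level s (n * (Suc n * (n * (n * 7 + 17) + 18) + (n * 4 + 5) + 2) + (n * 7 + 6)) (\<lambda>s'. \<exists>a b m.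
     dual_feasible E w a b \<and> perfect_matching n (tight_edges E w a b) m \<and>
     (\<forall>ix. nats s' ''X'' ix = (if \<exists>j<n. ix = [i, j, m j] then 1 else nats s ''X'' ix)) \<and>
     (\<forall>ix. nats s' ''U'' ix = (if \<exists>j<n. ix = [j, m j] then 1 else nats s ''U'' ix)))"
    (is "runs level s _ ?Q")
proof -
  define T where "T = n * (Suc n * (n * (n * 7 + 17) + 18) + (n * 4 + 5) + 2) + 2"
  have "runs clear_mates s (n * 3 + 2) (\<lambda>s'. \<forall>k<n. nats s' ''c'' [k] = 0)"
    unfolding clear_mates_def
  proof (rule runs_For[where I = "\<lambda>v s'. \<forall>k<v. nats s' ''c'' [k] = 0" and T = 1])
    show "runs (NAssign ''c'' [scalar ''k''] (NConst 0)) s' 1 (\<lambda>s'. \<forall>k<Suc v. nats s' ''c'' [k] = 0)"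
      if "\<forall>k<v. nats s' ''c'' [k] = 0" "nats s' ''k'' [] = v" for v s'
      using that by (intro runs_NAssign) (auto simp: less_Suc_eq)
  qed (use n in simp_all)
  then show ?thesis
    unfolding level_def
  proof (rule runs_Seq[where ?T2.0 = "T + (n * 4 + 2)", OF runs_mono[OF runs_frame order_refl]])
    fix s1 :: store
    assume s1: "(\<forall>k<n. nats s1 ''c'' [k] = 0) \<and> framed clear_mates s s1"
    have fr1: "nats s1 ''n'' = nats s ''n''" "nats s1 ''i'' = nats s ''i''" "nats s1 ''U'' = nats s ''U''"
      "nats s1 ''X'' = nats s ''X''" "reals s1 ''C'' = reals s ''C''"
      using s1[THEN conjunct2] by (simp_all add: clear_mates_def)
    have n1: "nats s1 ''n'' [] = n" and E1: "edges n s1 = E" and w1: "level_cost s1 = w"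
      using n E w fr1 by (simp_all add: edges_def level_cost_def)
    have "runs (For ''p'' phase) s1 T (\<lambda>s'. dual_feasible E w (row_dual s') (col_dual s') \<and>
       perfect_matching n (tight_edges E w (row_dual s') (col_dual s')) (row_mate s'))"
      unfolding T_def using s1 by (intro runs_rows[OF reg n1 E1 w1]) blast
    then show "runs (Seq (For ''p'' phase) write_level) s1 (T + (n * 4 + 2)) ?Q"
    proof (rule runs_Seq[where ?T2.0 = "n * 4 + 2", OF runs_mono[OF runs_frame order_refl]])
      fix s2 :: store
      assume s2: "(dual_feasible E w (row_dual s2) (col_dual s2) \<and>
          perfect_matching n (tight_edges E w (row_dual s2) (col_dual s2)) (row_mate s2)) \<and>
        framed (For ''p'' phase) s1 s2"
      have fr2: "nats s2 ''n'' = nats s1 ''n''" "nats s2 ''i'' = nats s1 ''i''" "nats s2 ''U'' = nats s1 ''U''"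
        "nats s2 ''X'' = nats s1 ''X''"
        using s2[THEN conjunct2] by (simp_all add: program_defs)
      have n2: "nats s2 ''n'' [] = n" and i2: "nats s2 ''i'' [] = i" using n i fr1 fr2 by simp_all
      show "runs write_level s2 (n * 4 + 2) ?Q"
      proof (rule runs_mono[OF runs_write_level[OF n2, unfolded i2] order_refl])
        fix s3 :: store assume s3: "(\<forall>ix. nats s3 ''X'' ix = (if \<exists>j<n. ix = [i, j, row_mate s2 j] then 1 else nats s2 ''X'' ix)) \<and>
           (\<forall>ix. nats s3 ''U'' ix = (if \<exists>j<n. ix = [j, row_mate s2 j] then 1 else nats s2 ''U'' ix))"
        show "?Q s3"
          using s2[THEN conjunct1] s3 unfolding fr2 fr1 by blast
      qed
    qed simp
  qed (simp add: T_def)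
qed

section \<open>Greedy axial assignments\<close>

text \<open>Strong duality from total correctness: one level of the program, run on a store in which
  \<open>U\<close> marks the complement of \<open>E\<close> and the costs are \<open>w\<close>,
  halts with a feasible dual and a matching tight for it.\<close>

lemma optimal_dual_exists:
  assumes reg: "regular_graph n r E" "0 < r"
  shows "\<exists>a b M. dual_feasible E w a b \<and> perfect_matching n (tight_edges E w a b) M"
proof -
  define s :: store where "s = \<lparr>nats = (\<lambda>x ix. if x = ''n'' then n else if x = ''U'' then of_bool ((ix ! 0, ix ! 1) \<notin> E) else 0),
      reals = (\<lambda>x ix. w (ix ! 1, ix ! 2))\<rparr>"
  have "edges n s = E" using reg by (auto simp: edges_def s_def regular_graph_def)
  moreover have "level_cost s = w" by (auto simp: level_cost_def s_def)
  moreover have "nats s ''n'' [] = n" "nats s ''i'' [] = 0" by (simp_all add: s_def)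
  ultimately show ?thesis
    using runs_level[OF reg] unfolding runs_def by blast
qed

definition array_costs :: "nat \<Rightarrow> (nat list \<Rightarrow> real) \<Rightarrow> nat list \<Rightarrow> real" where
  "array_costs n C = (\<lambda>ix. if ix \<in> positions 3 n then C ix else 0)"

definition remaining :: "nat \<Rightarrow> (nat \<Rightarrow> nat \<Rightarrow> nat) \<Rightarrow> nat \<Rightarrow> (nat \<times> nat) set" where
  "remaining n \<pi> v = {(j, k). j < n \<and> k < n \<and> (\<forall>i<v. \<pi> i j \<noteq> k)}"

definition level_inv :: "nat \<Rightarrow> (nat list \<Rightarrow> real) \<Rightarrow> nat \<Rightarrow> (nat \<Rightarrow> nat \<Rightarrow> nat) \<Rightarrow> store \<Rightarrow> bool" where
  "level_inv n C v \<pi> s \<longleftrightarrow> nats s ''n'' [] = n \<and> nats s ''i'' [] = v \<and> reals s ''C'' = array_costs n C \<and>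
     (\<forall>i<v. bij_betw (\<pi> i) {..<n} {..<n}) \<and> (\<forall>i<v. \<forall>i'<i. \<forall>j<n. \<pi> i j \<noteq> \<pi> i' j) \<and>
     (\<forall>ix. nats s ''X'' ix = of_bool (\<exists>i<v. \<exists>j<n. ix = [i, j, \<pi> i j])) \<and>
     (\<forall>ix. nats s ''U'' ix = of_bool (\<exists>i<v. \<exists>j<n. ix = [j, \<pi> i j]))"

definition level_optimal :: "nat \<Rightarrow> (nat list \<Rightarrow> real) \<Rightarrow> (nat \<Rightarrow> nat \<Rightarrow> nat) \<Rightarrow> nat \<Rightarrow> bool" where
  "level_optimal n C \<pi> v \<longleftrightarrow> (\<forall>M. perfect_matching n (remaining n \<pi> v) M \<longrightarrow>
     (\<Sum>j<n. C [v, j, \<pi> v j]) \<le> (\<Sum>j<n. C [v, j, M j]))"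

lemma remaining_cong: "(\<And>i. i < v \<Longrightarrow> \<pi> i = \<rho> i) \<Longrightarrow> remaining n \<pi> v = remaining n \<rho> v"
  by (auto simp: remaining_def)

lemma level_inv_cong: "(\<And>i. i < v \<Longrightarrow> \<pi> i = \<rho> i) \<Longrightarrow> level_inv n C v \<pi> s = level_inv n C v \<rho> s"
  unfolding level_inv_def by (auto cong: conj_cong)

text \<open>Row \<open>j\<close> has lost \<open>v\<close> columns, distinct because the earlier
  matchings are edge-disjoint; column \<open>k\<close> has lost its \<open>v\<close> preimages,
  distinct for the same reason.\<close>

lemma remaining_regular:
  assumes "level_inv n C v \<pi> s" "v \<le> n"
  shows "regular_graph n (n - v) (remaining n \<pi> v)"
proof -
  have bij: "\<And>i. i < v \<Longrightarrow> bij_betw (\<pi> i) {..<n} {..<n}" and diff: "\<And>i i' j. i < v \<Longrightarrow> i' < i \<Longrightarrow> j < n \<Longrightarrow> \<pi> i j \<noteq> \<pi> i' j"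
    using assms(1) unfolding level_inv_def by blast+
  have diff': "i = i'" if "i < v" "i' < v" "j < n" "\<pi> i j = \<pi> i' j" for i i' j
  proof (rule ccontr)
    assume "i \<noteq> i'"
    then consider "i < i'" | "i' < i" by linarith
    then show False using diff[of i i' j] diff[of i' i j] that by cases auto
  qed
  have "card {k. (j, k) \<in> remaining n \<pi> v} = n - v" if j: "j < n" for j
  proof -
    have "inj_on (\<lambda>i. \<pi> i j) {..<v}"
      by (rule inj_onI) (use diff'[OF _ _ j] in blast)
    then have "card ((\<lambda>i. \<pi> i j) ` {..<v}) = v" by (simp add: card_image)
    moreover have "(\<lambda>i. \<pi> i j) ` {..<v} \<subseteq> {..<n}"
    proof clarify
      fix i assume "i < v"
      then show "\<pi> i j < n" using bij_betw_apply[OF bij, of i j] j by simp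
    qed
    moreover have "{k. (j, k) \<in> remaining n \<pi> v} = {..<n} - (\<lambda>i. \<pi> i j) ` {..<v}"
      using j by (auto simp: remaining_def)
    ultimately show ?thesis by (simp add: card_Diff_subset)
  qed
  moreover have "card {j. (j, k) \<in> remaining n \<pi> v} = n - v" if k: "k < n" for k
  proof -
    define \<iota> where "\<iota> i = the_inv_into {..<n} (\<pi> i) k" for i
    have inv: "\<iota> i < n" "\<pi> i (\<iota> i) = k" if "i < v" for i
    proof -
      have i: "inj_on (\<pi> i) {..<n}" "k \<in> \<pi> i ` {..<n}" using bij[OF that] k by (simp_all add: bij_betw_def)
      show "\<iota> i < n" using the_inv_into_into[OF i order_refl] by (simp add: \<iota>_def)
      show "\<pi> i (\<iota> i) = k" using f_the_inv_into_f[OF i] by (simp add: \<iota>_def)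
    qed
    have uniq: "j = \<iota> i" if "i < v" "j < n" "\<pi> i j = k" for i j
    proof -
      have "inj_on (\<pi> i) {..<n}" using bij[OF that(1)] by (simp add: bij_betw_def)
      then show ?thesis using inv[OF that(1)] that by (simp add: inj_on_def)
    qed
    have "inj_on \<iota> {..<v}"
    proof (rule inj_onI)
      fix i i' assume ii': "i \<in> {..<v}" "i' \<in> {..<v}" "\<iota> i = \<iota> i'"
      then have "\<pi> i (\<iota> i) = \<pi> i' (\<iota> i)" using inv(2)[of i] inv(2)[of i'] by simp
      then show "i = i'" using diff'[of i i' "\<iota> i"] inv(1)[of i] ii' by simp
    qed
    then have "card (\<iota> ` {..<v}) = v" by (simp add: card_image)
    moreover have "\<iota> ` {..<v} \<subseteq> {..<n}" using inv by auto
    moreover have "{j. (j, k) \<in> remaining n \<pi> v} = {..<n} - \<iota> ` {..<v}"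
    proof (intro set_eqI iffI)
      fix j assume j: "j \<in> {j. (j, k) \<in> remaining n \<pi> v}"
      then have "j \<noteq> \<iota> i" if "i < v" for i using inv(2)[OF that] that by (auto simp: remaining_def)
      with j show "j \<in> {..<n} - \<iota> ` {..<v}" by (auto simp: remaining_def)
    next
      fix j assume "j \<in> {..<n} - \<iota> ` {..<v}"
      then show "j \<in> {j. (j, k) \<in> remaining n \<pi> v}" using uniq k by (auto simp: remaining_def)
    qed
    ultimately show ?thesis by (simp add: card_Diff_subset)
  qed
  ultimately show ?thesis by (auto simp: regular_graph_def remaining_def)
qed

definition next_level :: com where
  "next_level = Seq level (NAssign ''i'' [] (NAdd (scalar ''i'') (NConst 1)))"

definition level_time :: "nat \<Rightarrow> nat" where
  "level_time n = n * (Suc n * (n * (n * 7 + 17) + 18) + (n * 4 + 5) + 2) + (n * 7 + 6)"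

lemma runs_next_level:
  assumes inv: "level_inv n C v \<pi> s" and "v < n"
  shows "runs next_level s (level_time n + 1) (\<lambda>s'. \<exists>M. level_inv n C (Suc v) (\<pi>(v := M)) s' \<and> level_optimal n C (\<pi>(v := M)) v)"
proof -
  define E where "E = remaining n \<pi> v"
  have n: "nats s ''n'' [] = n" and i: "nats s ''i'' [] = v" and costs: "reals s ''C'' = array_costs n C"
    and bij: "\<And>i. i < v \<Longrightarrow> bij_betw (\<pi> i) {..<n} {..<n}"
    and diff: "\<And>i i' j. i < v \<Longrightarrow> i' < i \<Longrightarrow> j < n \<Longrightarrow> \<pi> i j \<noteq> \<pi> i' j"
    and X: "\<And>ix. nats s ''X'' ix = of_bool (\<exists>i<v. \<exists>j<n. ix = [i, j, \<pi> i j])"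
    and U: "\<And>ix. nats s ''U'' ix = of_bool (\<exists>i<v. \<exists>j<n. ix = [j, \<pi> i j])"
    using inv unfolding level_inv_def by blast+
  have reg: "regular_graph n (n - v) E"
    unfolding E_def using remaining_regular[OF inv] \<open>v < n\<close> by simp
  have edges: "edges n s = E"
    by (auto simp: edges_def E_def remaining_def U)
  define w where "w = level_cost s"
  have w: "w (j, k) = C [v, j, k]" if "j < n" "k < n" for j k
    using that \<open>v < n\<close> by (simp add: w_def level_cost_def costs i array_costs_def positions_def)
  show ?thesis
    unfolding next_level_def
  proof (rule runs_Seq[where ?T1.0 = "level_time n" and ?T2.0 = 1])
    show "runs level s (level_time n) (\<lambda>s'. runs (NAssign ''i'' [] (NAdd (scalar ''i'') (NConst 1))) s' 1
       (\<lambda>s'. \<exists>M. level_inv n C (Suc v) (\<pi>(v := M)) s' \<and> level_optimal n C (\<pi>(v := M)) v))"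
      unfolding level_time_def
    proof (rule runs_mono[OF runs_frame[OF runs_level[OF reg _ n edges w_def[symmetric] i]] order_refl])
      fix s1 :: store
      assume s1: "(\<exists>a b m. dual_feasible E w a b \<and> perfect_matching n (tight_edges E w a b) m \<and>
          (\<forall>ix. nats s1 ''X'' ix = (if \<exists>j<n. ix = [v, j, m j] then 1 else nats s ''X'' ix)) \<and>
          (\<forall>ix. nats s1 ''U'' ix = (if \<exists>j<n. ix = [j, m j] then 1 else nats s ''U'' ix))) \<and>
        framed level s s1"
      then obtain a b M where dual: "dual_feasible E w a b" and M: "perfect_matching n (tight_edges E w a b) M"
        and X1: "\<And>ix. nats s1 ''X'' ix = (if \<exists>j<n. ix = [v, j, M j] then 1 else nats s ''X'' ix)"
        and U1: "\<And>ix. nats s1 ''U'' ix = (if \<exists>j<n. ix = [j, M j] then 1 else nats s ''U'' ix)"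
        by blast
      have fr: "nats s1 ''n'' = nats s ''n''" "nats s1 ''i'' = nats s ''i''" "reals s1 ''C'' = reals s ''C''"
        using s1[THEN conjunct2] by (simp_all add: program_defs)
      have ME: "perfect_matching n E M" using M by (auto simp: perfect_matching_def tight_edges_def)
      define \<rho> where "\<rho> = \<pi>(v := M)"
      define s2 where "s2 = s1\<lparr>nats := upd (nats s1) ''i'' [] (Suc v)\<rparr>"
      have rem: "remaining n \<rho> v = E" unfolding E_def \<rho>_def by (rule remaining_cong) simp
      have "level_optimal n C \<rho> v"
        unfolding level_optimal_def rem
      proof (intro allI impI)
        fix M' assume M': "perfect_matching n E M'"
        have E_lt: "j < n \<and> k < n" if "(j, k) \<in> E" for j k using that by (auto simp: E_def remaining_def)
        have sum_w: "(\<Sum>j<n. w (j, N j)) = (\<Sum>j<n. C [v, j, N j])" if "perfect_matching n E N" for N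
          using that E_lt w by (intro sum.cong) (auto simp: perfect_matching_def)
        show "(\<Sum>j<n. C [v, j, \<rho> v j]) \<le> (\<Sum>j<n. C [v, j, M' j])"
          using tight_matching_optimal[OF M dual M'] sum_w[OF ME] sum_w[OF M'] by (simp add: \<rho>_def)
      qed
      moreover have "level_inv n C (Suc v) \<rho> s2"
        unfolding level_inv_def
      proof (intro conjI allI impI)
        show "bij_betw (\<rho> i) {..<n} {..<n}" if "i < Suc v" for i
          using that bij ME by (auto simp: \<rho>_def perfect_matching_def less_Suc_eq)
        show "\<rho> i j \<noteq> \<rho> i' j" if "i < Suc v" "i' < i" "j < n" for i i' j
        proof (cases "i = v")
          case True
          have "(j, M j) \<in> E" using ME \<open>j < n\<close> by (simp add: perfect_matching_def)
          then show ?thesis using True that by (auto simp: \<rho>_def E_def remaining_def)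
        next
          case False
          then show ?thesis using diff[of i i' j] that by (auto simp: \<rho>_def)
        qed
        show "nats s2 ''X'' ix = of_bool (\<exists>i<Suc v. \<exists>j<n. ix = [i, j, \<rho> i j])" for ix
          using X1[of ix] X[of ix] by (auto simp: s2_def \<rho>_def less_Suc_eq)
        show "nats s2 ''U'' ix = of_bool (\<exists>i<Suc v. \<exists>j<n. ix = [j, \<rho> i j])" for ix
          using U1[of ix] U[of ix] by (auto simp: s2_def \<rho>_def less_Suc_eq)
      qed (use n costs fr in \<open>simp_all add: s2_def\<close>)
      ultimately show "runs (NAssign ''i'' [] (NAdd (scalar ''i'') (NConst 1))) s1 1
         (\<lambda>s'. \<exists>M. level_inv n C (Suc v) (\<pi>(v := M)) s' \<and> level_optimal n C (\<pi>(v := M)) v)"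
        using i fr by (intro runs_NAssign) (auto simp: s2_def \<rho>_def)
    qed (use \<open>v < n\<close> in simp)
  qed simp
qed

definition after :: "com \<Rightarrow> store \<Rightarrow> store" where
  "after c s = (THE s'. \<exists>t. exec c s t s')"

lemma after_eq: "exec c s t s' \<Longrightarrow> after c s = s'"
  unfolding after_def using exec_deterministic by (intro the_equality) blast+

text \<open>Iterates of the loop body of \<open>greedy_program\<close>. With names for the states
  between levels, runs on two inputs can be compared level by level.\<close>

definition state :: "nat \<Rightarrow> (nat list \<Rightarrow> real) \<Rightarrow> nat \<Rightarrow> store" where
  "state n C v = (after next_level ^^ v) (input_store 3 n C)"

lemma state_0: "state n C 0 = input_store 3 n C"
  and state_Suc: "state n C (Suc v) = after next_level (state n C v)"
  by (simp_all add: state_def)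

lemma input_store_level_inv: "level_inv n C 0 \<pi> (input_store 3 n C)"
  by (auto simp: level_inv_def input_store_def array_costs_def fun_eq_iff)

lemma exec_next_level:
  assumes "level_inv n C v \<pi> (state n C v)" "v < n"
  shows "\<exists>t\<le>level_time n + 1. exec next_level (state n C v) t (state n C (Suc v))"
    and "\<exists>M. level_inv n C (Suc v) (\<pi>(v := M)) (state n C (Suc v)) \<and> level_optimal n C (\<pi>(v := M)) v"
proof -
  obtain t s' where "exec next_level (state n C v) t s'" "t \<le> level_time n + 1"
    and Q: "\<exists>M. level_inv n C (Suc v) (\<pi>(v := M)) s' \<and> level_optimal n C (\<pi>(v := M)) v"
    using runs_next_level[OF assms] unfolding runs_def by blast
  moreover from this have "state n C (Suc v) = s'" by (simp add: state_Suc after_eq)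
  ultimately show "\<exists>t\<le>level_time n + 1. exec next_level (state n C v) t (state n C (Suc v))"
    "\<exists>M. level_inv n C (Suc v) (\<pi>(v := M)) (state n C (Suc v)) \<and> level_optimal n C (\<pi>(v := M)) v"
    by auto
qed

text \<open>One family \<open>\<pi>\<close> serves all levels: the invariant at \<open>v\<close>
  involves only the matchings before \<open>v\<close>, and optimality of \<open>v\<close> only those
  up to \<open>v\<close>, so adding matching \<open>m\<close> leaves the earlier statements
  intact.\<close>

lemma greedy_matchings:
  assumes "m \<le> n"
  shows "\<exists>\<pi>. (\<forall>v\<le>m. level_inv n C v \<pi> (state n C v)) \<and> (\<forall>v<m. level_optimal n C \<pi> v)"
  using assms
proof (induction m)
  case 0
  then show ?case using input_store_level_inv by (auto simp: state_0)
next
  case (Suc m)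
  then obtain \<pi> where \<pi>: "\<And>v. v \<le> m \<Longrightarrow> level_inv n C v \<pi> (state n C v)" "\<And>v. v < m \<Longrightarrow> level_optimal n C \<pi> v"
    by auto
  obtain M where M: "level_inv n C (Suc m) (\<pi>(m := M)) (state n C (Suc m))" "level_optimal n C (\<pi>(m := M)) m"
    using exec_next_level(2)[OF \<pi>(1)[of m]] Suc.prems by auto
  have "level_inv n C v (\<pi>(m := M)) (state n C v)" if "v \<le> Suc m" for v
  proof (cases "v = Suc m")
    case False
    then have "v \<le> m" using that by simp
    then show ?thesis using \<pi>(1)[of v] level_inv_cong[of v "\<pi>(m := M)" \<pi>] by simp
  qed (use M in simp)
  moreover have "level_optimal n C (\<pi>(m := M)) v" if "v < Suc m" for v
  proof (cases "v = m")
    case False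
    then have "v < m" using that by simp
    then have "remaining n (\<pi>(m := M)) v = remaining n \<pi> v" by (intro remaining_cong) auto
    then show ?thesis using \<pi>(2)[OF \<open>v < m\<close>] \<open>v < m\<close> by (simp add: level_optimal_def)
  qed (use M in simp)
  ultimately show ?case by blast
qed

definition greedy :: "nat \<Rightarrow> (nat list \<Rightarrow> real) \<Rightarrow> nat list \<Rightarrow> nat" where
  "greedy n C ix = nats (state n C n) ''X'' ix"

lemma exec_greedy_program:
  "\<exists>t\<le>n * (level_time n + 2) + 2. exec greedy_program (input_store 3 n C) t (state n C n)"
proof -
  obtain \<pi> where \<pi>: "\<And>v. v \<le> n \<Longrightarrow> level_inv n C v \<pi> (state n C v)"
    using greedy_matchings[of n n C] by auto
  let ?W = "While (NLess (scalar ''i'') (scalar ''n'')) next_level"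
  have "\<exists>t\<le>u * (level_time n + 2) + 1. exec ?W (state n C (n - u)) t (state n C n)" if "u \<le> n" for u
    using that
  proof (induction u)
    case 0
    have "\<not> bval (NLess (scalar ''i'') (scalar ''n'')) (state n C n)"
      using \<pi>[of n] by (simp add: level_inv_def)
    from exec.WhileFalse[OF this, of next_level] show ?case by auto
  next
    case (Suc u)
    define v where "v = n - Suc u"
    have v: "v < n" "Suc v = n - u" using Suc.prems by (auto simp: v_def)
    have b: "bval (NLess (scalar ''i'') (scalar ''n'')) (state n C v)"
      using \<pi>[of v] v by (simp add: level_inv_def)
    obtain t1 where t1: "t1 \<le> level_time n + 1" "exec next_level (state n C v) t1 (state n C (Suc v))"
      using exec_next_level(1)[OF \<pi>[of v]] v by auto
    obtain t2 where t2: "t2 \<le> u * (level_time n + 2) + 1" "exec ?W (state n C (Suc v)) t2 (state n C n)"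
      using Suc v by auto
    show ?case
      using exec.WhileTrue[OF b t1(2) t2(2)] t1(1) t2(1) unfolding v_def[symmetric]
      by (intro exI[of _ "Suc (t1 + t2)"]) auto
  qed
  from this[of n] obtain t where t: "t \<le> n * (level_time n + 2) + 1" "exec ?W (state n C 0) t (state n C n)"
    by auto
  \<comment> \<open>Naturals are 0 by default, so the initial assignment to \<open>i\<close> changes
    nothing and \<open>state n C 0\<close> is the state in which the loop starts.\<close>
  have "(input_store 3 n C)\<lparr>nats := upd (nats (input_store 3 n C)) ''i'' [] 0\<rparr> = input_store 3 n C"
    by (simp add: input_store_def upd_def fun_eq_iff)
  then have init: "exec (NAssign ''i'' [] (NConst 0)) (input_store 3 n C) 1 (input_store 3 n C)"
    using exec.NAssign[of "''i''" "[]" "NConst 0" "input_store 3 n C"] by simp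
  have "exec greedy_program (input_store 3 n C) (1 + t) (state n C n)"
    unfolding greedy_program_def For_def next_level_def[symmetric]
    by (rule exec.Seq[OF init]) (use t in \<open>simp add: state_0\<close>)
  then show ?thesis using t(1) by (intro exI[of _ "1 + t"]) simp
qed

lemma poly_time_greedy: "poly_time_algorithm 3 greedy"
proof -
  define x :: "nat poly" where "x = [:0, 1:]"
  define T :: "nat poly" where "T = x * ((x * ((x + [:1:]) * (x * (x * [:7:] + [:17:]) + [:18:]) + (x * [:4:] + [:5:]) + [:2:]) + (x * [:7:] + [:6:])) + [:2:]) + [:2:]"
  have "poly T n = n * (level_time n + 2) + 2" for n
    by (simp add: T_def x_def level_time_def algebra_simps)
  then show ?thesis
    unfolding poly_time_algorithm_def greedy_def
    using exec_greedy_program by (intro exI[of _ greedy_program] exI[of _ T]) metis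
qed

lemma greedy_spec:
  obtains \<pi> where "\<And>i. i < n \<Longrightarrow> bij_betw (\<pi> i) {..<n} {..<n}"
    "\<And>i i' j. i < n \<Longrightarrow> i' < i \<Longrightarrow> j < n \<Longrightarrow> \<pi> i j \<noteq> \<pi> i' j"
    "\<And>ix. greedy n C ix = of_bool (\<exists>i<n. \<exists>j<n. ix = [i, j, \<pi> i j])"
    "\<And>v. v \<le> n \<Longrightarrow> regular_graph n (n - v) (remaining n \<pi> v)"
    "\<And>v. v < n \<Longrightarrow> level_optimal n C \<pi> v"
proof -
  obtain \<pi> where \<pi>: "\<And>v. v \<le> n \<Longrightarrow> level_inv n C v \<pi> (state n C v)" "\<And>v. v < n \<Longrightarrow> level_optimal n C \<pi> v"
    using greedy_matchings[of n n C] by auto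
  have "level_inv n C n \<pi> (state n C n)" using \<pi>(1) by simp
  then have fin: "\<forall>i<n. bij_betw (\<pi> i) {..<n} {..<n}" "\<forall>i<n. \<forall>i'<i. \<forall>j<n. \<pi> i j \<noteq> \<pi> i' j"
    "\<forall>ix. greedy n C ix = of_bool (\<exists>i<n. \<exists>j<n. ix = [i, j, \<pi> i j])"
    unfolding level_inv_def greedy_def by simp_all
  show ?thesis
  proof (rule that[of \<pi>])
    show "regular_graph n (n - v) (remaining n \<pi> v)" if "v \<le> n" for v
      by (rule remaining_regular[OF \<pi>(1)[OF that] that])
  qed (use fin \<pi>(2) in simp_all)
qed

text \<open>Lines in the third direction meet \<open>X\<close> once because each level is a
  function, those in the second because it is a bijection. For the first direction, the graph left
  after \<open>n\<close> levels is 0-regular, so every pair has been used, and only once by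
  disjointness.\<close>

lemma axial_assignment_greedy: "axial_assignment 3 n (greedy n C)"
proof -
  obtain \<pi> where bij: "\<And>i. i < n \<Longrightarrow> bij_betw (\<pi> i) {..<n} {..<n}"
    and diff: "\<And>i i' j. i < n \<Longrightarrow> i' < i \<Longrightarrow> j < n \<Longrightarrow> \<pi> i j \<noteq> \<pi> i' j"
    and X: "\<And>ix. greedy n C ix = of_bool (\<exists>i<n. \<exists>j<n. ix = [i, j, \<pi> i j])"
    and reg: "\<And>v. v \<le> n \<Longrightarrow> regular_graph n (n - v) (remaining n \<pi> v)"
    by (rule greedy_spec[of n C]) blast
  have X_iff: "greedy n C [i, j, k] = 1 \<longleftrightarrow> i < n \<and> j < n \<and> k = \<pi> i j" for i j k
    by (auto simp: X)
  have lt: "\<pi> i j < n" if "i < n" "j < n" for i j using bij[OF that(1)] that by (auto simp: bij_betw_def)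
  have "\<exists>!v. v < n \<and> greedy n C (ix[p := v]) = 1" if ix: "ix \<in> positions 3 n" and p: "p < 3" for ix p
  proof -
    obtain i j k where ijk: "ix = [i, j, k]" "i < n" "j < n" "k < n"
      using ix by (auto simp: positions_def numeral_3_eq_3 length_Suc_conv)
    consider "p = 0" | "p = 1" | "p = 2" using p by linarith
    then show ?thesis
    proof cases
      case 1
      have "card {k. (j, k) \<in> remaining n \<pi> n} = 0"
        using reg[of n] ijk(3) by (simp add: regular_graph_def)
      moreover have "finite {k. (j, k) \<in> remaining n \<pi> n}"
        by (rule finite_subset[of _ "{..<n}"]) (auto simp: remaining_def)
      ultimately have "(j, k) \<notin> remaining n \<pi> n" by auto
      then obtain v where v: "v < n" "k = \<pi> v j" using ijk unfolding remaining_def by blast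
      have uniq: "v' = v" if v': "v' < n" "k = \<pi> v' j" for v'
      proof (rule ccontr)
        assume "v' \<noteq> v"
        moreover have "\<pi> v j = \<pi> v' j" using v(2) v'(2) by simp
        ultimately show False
          using diff[OF v(1) _ \<open>j < n\<close>] diff[OF v'(1) _ \<open>j < n\<close>] by (metis nat_neq_iff)
      qed
      have upd: "ix[p := v] = [v, j, k]" for v using 1 ijk by simp
      have "\<exists>!v. v < n \<and> v < n \<and> j < n \<and> k = \<pi> v j"
        by (rule ex1I[of _ v]) (use v ijk uniq in blast)+
      then show ?thesis unfolding upd X_iff .
    next
      case 2
      have inj: "inj_on (\<pi> i) {..<n}" using bij[OF ijk(2)] by (rule bij_betw_imp_inj_on)
      have "k \<in> \<pi> i ` {..<n}" using bij[OF ijk(2)] ijk by (simp add: bij_betw_def)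
      then obtain v where v: "v < n" "k = \<pi> i v" by auto
      have uniq: "v' = v" if "v' < n" "k = \<pi> i v'" for v'
        using inj_onD[OF inj, of v' v] that v by simp
      have upd: "ix[p := v] = [i, v, k]" for v using 2 ijk by simp
      have "\<exists>!v. v < n \<and> i < n \<and> v < n \<and> k = \<pi> i v"
        by (rule ex1I[of _ v]) (use v ijk uniq in blast)+
      then show ?thesis unfolding upd X_iff .
    next
      case 3
      have upd: "ix[p := v] = [i, j, v]" for v using 3 ijk by (simp add: numeral_2_eq_2)
      have "\<exists>!v. v < n \<and> i < n \<and> j < n \<and> v = \<pi> i j"
        by (rule ex1I[of _ "\<pi> i j"]) (use ijk lt in simp_all)
      then show ?thesis unfolding upd X_iff .
    qed
  qed
  moreover have "greedy n C ix \<in> {0, 1}" for ix by (simp add: X)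
  ultimately show ?thesis unfolding axial_assignment_def by blast
qed

lemma sum_positions_3: "(\<Sum>ix\<in>positions 3 n. g ix) = (\<Sum>i<n. \<Sum>j<n. \<Sum>k<n. g [i, j, k])"
proof -
  have "positions 0 n = {[]}" by (auto simp: positions_def)
  then show ?thesis by (simp add: numeral_3_eq_3 sum_positions_Suc)
qed

lemma greedy_cost:
  assumes X: "\<And>ix. greedy n C ix = of_bool (\<exists>i<n. \<exists>j<n. ix = [i, j, \<pi> i j])"
    and lt: "\<And>i j. i < n \<Longrightarrow> j < n \<Longrightarrow> \<pi> i j < n"
  shows "assignment_cost 3 n C (greedy n C) = (\<Sum>i<n. \<Sum>j<n. C [i, j, \<pi> i j])"
proof -
  have "(\<Sum>k<n. real (greedy n C [i, j, k]) * C [i, j, k]) = C [i, j, \<pi> i j]" if "i < n" "j < n" for i j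
  proof -
    have "(\<Sum>k<n. real (greedy n C [i, j, k]) * C [i, j, k]) = (\<Sum>k<n. if \<pi> i j = k then C [i, j, k] else 0)"
      using that by (intro sum.cong) (auto simp: X)
    also have "\<dots> = C [i, j, \<pi> i j]" using lt[OF that] by (subst sum.delta') auto
    finally show ?thesis .
  qed
  then show ?thesis by (simp add: assignment_cost_def sum_positions_3)
qed

text \<open>The graph \<open>remaining\<close>, but read off the output, so that it is a function of
  \<open>C\<close> alone and its measurability can be stated.\<close>

definition greedy_graph :: "nat \<Rightarrow> nat \<Rightarrow> (nat list \<Rightarrow> real) \<Rightarrow> (nat \<times> nat) set" where
  "greedy_graph n v C = {(j, k). j < n \<and> k < n \<and> (\<forall>i<v. greedy n C [i, j, k] \<noteq> 1)}"

lemma greedy_graph_eq: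
  assumes X: "\<And>ix. greedy n C ix = of_bool (\<exists>i<n. \<exists>j<n. ix = [i, j, \<pi> i j])" and "v \<le> n"
  shows "greedy_graph n v C = remaining n \<pi> v"
  using \<open>v \<le> n\<close> by (auto simp: greedy_graph_def remaining_def X)

lemma regular_greedy_graph:
  assumes "v \<le> n"
  shows "regular_graph n (n - v) (greedy_graph n v C)"
proof -
  obtain \<pi> where "\<And>ix. greedy n C ix = of_bool (\<exists>i<n. \<exists>j<n. ix = [i, j, \<pi> i j])"
    "\<And>v. v \<le> n \<Longrightarrow> regular_graph n (n - v) (remaining n \<pi> v)"
    by (rule greedy_spec[of n C]) blast
  with assms greedy_graph_eq[of n C \<pi> v] show ?thesis by simp
qed

section \<open>The graph of a level as a function of the earlier costs\<close>

lemma local_level: "local_com level"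
  by (simp add: program_defs)

text \<open>Induction over the levels: level \<open>u < v\<close> reads only costs at
  \<open>u\<close>, where the inputs agree, so the stores differ in the cost array alone.\<close>

lemma state_agree:
  assumes agree: "\<And>ix. ix \<in> positions 3 n \<Longrightarrow> hd ix < v \<Longrightarrow> C ix = D ix" and "u \<le> v" "v \<le> n"
  shows "state n D u = with_costs (array_costs n D) (state n C u)"
  using \<open>u \<le> v\<close>
proof (induction u)
  case 0
  show ?case
    by (auto simp: state_0 with_costs_def input_store_def array_costs_def fun_eq_iff)
next
  case (Suc u)
  obtain \<pi> where inv: "level_inv n C u \<pi> (state n C u)"
    using greedy_matchings[of u n C] Suc.prems \<open>v \<le> n\<close> by auto
  obtain t where "exec next_level (state n C u) t (state n C (Suc u))"
    using exec_next_level(1)[OF inv] Suc.prems \<open>v \<le> n\<close> by auto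
  then obtain t1 s1 where s1: "exec level (state n C u) t1 s1"
      and s2: "state n C (Suc u) = s1\<lparr>nats := upd (nats s1) ''i'' [] (nval (NAdd (scalar ''i'') (NConst 1)) s1)\<rparr>"
    unfolding next_level_def by (auto elim!: exec_elims(4) exec_elims(2))
  have "same_level_costs (array_costs n D) (state n C u)"
    using inv agree Suc.prems by (auto simp: same_level_costs_def level_inv_def array_costs_def)
  then have "exec level (state n D u) t1 (with_costs (array_costs n D) s1)"
    using exec_with_costs[OF s1 local_level] Suc by simp
  then have "exec next_level (state n D u) (t1 + 1) ((with_costs (array_costs n D) s1)
      \<lparr>nats := upd (nats s1) ''i'' [] (nval (NAdd (scalar ''i'') (NConst 1)) s1)\<rparr>)"
    unfolding next_level_def
    using exec.NAssign[of "''i''" "[]" "NAdd (scalar ''i'') (NConst 1)" "with_costs (array_costs n D) s1"]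
    by (intro exec.Seq) auto
  then have "state n D (Suc u) = (with_costs (array_costs n D) s1)
      \<lparr>nats := upd (nats s1) ''i'' [] (nval (NAdd (scalar ''i'') (NConst 1)) s1)\<rparr>"
    unfolding state_Suc by (rule after_eq)
  then show ?case by (simp add: s2 with_costs_def)
qed

text \<open>The entries of \<open>X\<close> at levels below \<open>v\<close> are final when level
  \<open>v\<close> starts, so the graph can be read from \<open>state n C v\<close>, to which
  \<open>state_agree\<close> applies.\<close>

lemma greedy_online:
  assumes agree: "\<And>ix. ix \<in> positions 3 n \<Longrightarrow> hd ix < v \<Longrightarrow> C ix = D ix" and "v \<le> n"
  shows "greedy_graph n v C = greedy_graph n v D"
proof -
  have final: "greedy n C [i, j, k] = nats (state n C v) ''X'' [i, j, k]" if "i < v" for C i j k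
  proof -
    obtain \<pi> where \<pi>: "\<And>v. v \<le> n \<Longrightarrow> level_inv n C v \<pi> (state n C v)"
      using greedy_matchings[of n n C] by auto
    have "nats (state n C u) ''X'' [i, j, k] = of_bool (j < n \<and> k = \<pi> i j)" if "u \<le> n" "i < u" for u
      using \<pi>[OF that(1)] that(2) unfolding level_inv_def by auto
    from this[of n] this[of v] show ?thesis using \<open>i < v\<close> \<open>v \<le> n\<close> by (simp add: greedy_def)
  qed
  have "nats (state n D v) = nats (state n C v)"
    using state_agree[OF agree order_refl \<open>v \<le> n\<close>] by simp
  then show ?thesis unfolding greedy_graph_def by (auto simp: final)
qed

section \<open>Cost of the greedy assignment\<close>

abbreviation exponential_product :: "'i set \<Rightarrow> ('i \<Rightarrow> real) measure" where
  "exponential_product I \<equiv> Pi\<^sub>M I (\<lambda>_. exponential_measure 1)"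

lemma prob_space_exponential_product: "finite I \<Longrightarrow> prob_space (exponential_product I)"
  by (intro prob_space_PiM prob_space_exponential_density) auto

text \<open>Off \<open>I\<close> the component is constantly \<open>undefined\<close> on the space,
  so no index needs a side condition.\<close>

lemma measurable_exponential_component:
  "(\<lambda>x. x i) \<in> borel_measurable (exponential_product I)"
proof (cases "i \<in> I")
  case True
  then have "(\<lambda>x. x i) \<in> measurable (exponential_product I) (exponential_measure 1)" by measurable
  then show ?thesis by simp
next
  case False
  have "(\<lambda>x. undefined) \<in> borel_measurable (exponential_product I)" by simp
  then show ?thesis
    by (rule measurable_cong[THEN iffD1, rotated]) (use False in \<open>auto simp: space_PiM PiE_def extensional_def\<close>)
qed

text \<open>The product over \<open>L \<union> R\<close> is the image of the pair measure under
  \<open>merge\<close>, and the event pulls back to a rectangle.\<close>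

lemma exponential_product_independent:
  assumes disj: "L \<inter> R = {}" and fin: "finite L" "finite R"
    and A: "A \<in> sets (exponential_product L)" and B: "B \<in> sets (exponential_product R)"
  defines "S \<equiv> {C \<in> space (exponential_product (L \<union> R)). restrict C L \<in> A \<and> restrict C R \<in> B}"
  shows "S \<in> sets (exponential_product (L \<union> R))"
    and "measure (exponential_product (L \<union> R)) S = measure (exponential_product L) A * measure (exponential_product R) B"
proof -
  interpret product_sigma_finite "\<lambda>_. exponential_measure 1"
    using prob_space_exponential_density[of 1]
    by (intro product_sigma_finite.intro prob_space_imp_sigma_finite) simp
  interpret PR: prob_space "exponential_product R" by (rule prob_space_exponential_product[OF fin(2)])
  interpret PL: prob_space "exponential_product L" by (rule prob_space_exponential_product[OF fin(1)])
  have [measurable]: "(\<lambda>C. restrict C L) \<in> measurable (exponential_product (L \<union> R)) (exponential_product L)"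
    "(\<lambda>C. restrict C R) \<in> measurable (exponential_product (L \<union> R)) (exponential_product R)"
    by (rule measurable_restrict_subset; simp)+
  note [measurable] = A B
  show S: "S \<in> sets (exponential_product (L \<union> R))"
    unfolding S_def by measurable
  have vimage: "merge L R -` S \<inter> space (exponential_product L \<Otimes>\<^sub>M exponential_product R) = A \<times> B"
  proof (intro set_eqI iffI)
    fix p assume p: "p \<in> merge L R -` S \<inter> space (exponential_product L \<Otimes>\<^sub>M exponential_product R)"
    obtain x y where xy: "p = (x, y)" by force
    with p have "x \<in> extensional L" "y \<in> extensional R"
      by (auto simp: space_pair_measure space_PiM PiE_def)
    then have "restrict (merge L R (x, y)) L = x" "restrict (merge L R (x, y)) R = y"
      using disj by (simp_all add: restrict_merge extensional_restrict)
    then show "p \<in> A \<times> B" using p xy by (auto simp: S_def)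
  next
    fix p assume p: "p \<in> A \<times> B"
    then obtain x y where xy: "p = (x, y)" "x \<in> A" "y \<in> B" by auto
    then have sp: "x \<in> space (exponential_product L)" "y \<in> space (exponential_product R)"
      using A B sets.sets_into_space by blast+
    then have "x \<in> extensional L" "y \<in> extensional R" by (auto simp: space_PiM PiE_def)
    then have "restrict (merge L R (x, y)) L = x" "restrict (merge L R (x, y)) R = y"
      using disj by (simp_all add: restrict_merge extensional_restrict)
    moreover have "merge L R (x, y) \<in> space (exponential_product (L \<union> R))"
      by (auto simp: space_PiM PiE_def merge_def extensional_def)
    ultimately show "p \<in> merge L R -` S \<inter> space (exponential_product L \<Otimes>\<^sub>M exponential_product R)"
      using xy sp by (simp add: S_def space_pair_measure)
  qed
  have "measure (exponential_product (L \<union> R)) S =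
      measure (distr (exponential_product L \<Otimes>\<^sub>M exponential_product R) (exponential_product (L \<union> R)) (merge L R)) S"
    using distr_merge[OF disj fin] by simp
  also have "\<dots> = measure (exponential_product L \<Otimes>\<^sub>M exponential_product R) (A \<times> B)"
    using S by (subst measure_distr) (simp_all add: vimage)
  also have "\<dots> = measure (exponential_product L) A * measure (exponential_product R) B"
    using A B by (simp add: measure_def PR.emeasure_pair_measure_Times enn2real_mult)
  finally show "measure (exponential_product (L \<union> R)) S = measure (exponential_product L) A * measure (exponential_product R) B" .
qed

lemma measurable_input_store: "measurable_store (exponential_product I) (input_store d n)"
proof -
  have "(\<lambda>C. reals (input_store d n C) x ix) \<in> borel_measurable (exponential_product I)" for x ix
    using measurable_exponential_component[of ix I]
    by (cases "x = ''C'' \<and> ix \<in> positions d n") (auto simp: input_store_def)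
  then show ?thesis by (simp add: measurable_store_def) (simp add: input_store_def)
qed

text \<open>The step bound of \<open>exec_greedy_program\<close> is the same for all
  \<open>C\<close>; this uniformity is what \<open>measurable_store_exec\<close> requires.\<close>

lemma measurable_greedy: "(\<lambda>C. greedy n C ix) \<in> measurable (exponential_product I) (count_space UNIV)"
proof -
  have "measurable_store (exponential_product I) (\<lambda>C. state n C n)"
    by (rule measurable_store_exec[OF measurable_input_store]) (rule exec_greedy_program)
  then show ?thesis by (simp add: measurable_store_def greedy_def)
qed

lemma sets_greedy_graph: "{C \<in> space (exponential_product I). greedy_graph n v C = E} \<in> sets (exponential_product I)"
proof (cases "E \<subseteq> {..<n} \<times> {..<n}")
  case True
  have *: "greedy_graph n v C = E \<longleftrightarrow>
      (\<forall>e\<in>{..<n} \<times> {..<n}. e \<in> E \<longleftrightarrow> (\<forall>i\<in>{..<v}. greedy n C [i, fst e, snd e] \<noteq> 1))" for C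
    using True unfolding greedy_graph_def by (auto simp: set_eq_iff)
  have [measurable]: "Measurable.pred (exponential_product I) (\<lambda>C. greedy n C ix \<noteq> 1)" for ix
    using measurable_compose[OF measurable_greedy, of "\<lambda>x. x \<noteq> 1" "count_space UNIV"] by simp
  show ?thesis
    unfolding * by measurable
next
  case False
  then have "{C \<in> space (exponential_product I). greedy_graph n v C = E} = {}"
    by (auto simp: greedy_graph_def)
  then show ?thesis by (simp only: sets.empty_sets)
qed

definition costly :: "nat \<Rightarrow> (nat \<times> nat) set \<Rightarrow> real \<Rightarrow> (nat \<times> nat \<Rightarrow> real) \<Rightarrow> bool" where
  "costly n E z c \<longleftrightarrow> (\<forall>M. perfect_matching n E M \<longrightarrow> z < (\<Sum>j<n. c (j, M j)))"

text \<open>Matchings matter only on \<open>{..<n}\<close>, so the condition is a finite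
  conjunction.\<close>

lemma sets_costly:
  assumes "\<And>e. (\<lambda>x. f x e) \<in> borel_measurable N"
  shows "{x \<in> space N. costly n E z (f x)} \<in> sets N"
proof -
  define Ms where "Ms = {M \<in> {..<n} \<rightarrow>\<^sub>E {..<n}. perfect_matching n E M}"
  have fin: "finite Ms" unfolding Ms_def
    by (rule finite_subset[of _ "{..<n} \<rightarrow>\<^sub>E {..<n}"]) (auto intro: finite_PiE)
  have restr: "restrict M {..<n} \<in> Ms" if "perfect_matching n E M" for M
    using that by (auto simp: Ms_def perfect_matching_def bij_betw_def inj_on_def)
  have "costly n E z c \<longleftrightarrow> (\<forall>M\<in>Ms. z < (\<Sum>j<n. c (j, M j)))" for c
  proof
    assume *: "\<forall>M\<in>Ms. z < (\<Sum>j<n. c (j, M j))"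
    show "costly n E z c"
      unfolding costly_def
    proof (intro allI impI)
      fix M assume "perfect_matching n E M"
      with * restr have "z < (\<Sum>j<n. c (j, restrict M {..<n} j))" by blast
      then show "z < (\<Sum>j<n. c (j, M j))" by simp
    qed
  qed (auto simp: costly_def Ms_def)
  moreover have "{x \<in> space N. z < (\<Sum>j<n. f x (j, M j))} \<in> sets N" for M
    using assms by (intro borel_measurable_less borel_measurable_sum borel_measurable_const) 
  ultimately show ?thesis
    using fin by (simp only:) (rule sets.sets_Collect_finite_All, auto)
qed

text \<open>Split by the graph at the start of level \<open>v\<close>. It is determined by the
  earlier costs \<open>L\<close>, whereas being costly for a fixed graph is determined by the costs
  in \<open>R\<close>. Each such factor is at most \<open>(1 / 4) ^ n\<close>, and the probabilities
  of the graphs sum to at most 1.\<close>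

lemma greedy_level_tail:
  assumes "v < n"
  defines "S \<equiv> {C \<in> space (exp_array 3 n).
      costly n (greedy_graph n v C) (10 * real n / real (n - v)) (\<lambda>(j, k). C [v, j, k])}"
  shows "S \<in> sets (exp_array 3 n)" "measure (exp_array 3 n) S \<le> (1 / 4) ^ n"
proof -
  define z where "z = 10 * real n / real (n - v)"
  define L R where "L = {ix \<in> positions 3 n. hd ix < v}" and "R = {ix \<in> positions 3 n. v \<le> hd ix}"
  have LR: "L \<inter> R = {}" "L \<union> R = positions 3 n" and fin: "finite L" "finite R"
    using finite_positions[of 3 n] by (auto simp: L_def R_def)
  define Gs where "Gs = Pow ({..<n} \<times> {..<n})"
  have finGs: "finite Gs" by (simp add: Gs_def)
  define A where "A E = {x \<in> space (exponential_product L). greedy_graph n v x = E}" for E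
  define B where "B E = {y \<in> space (exponential_product R). costly n E z (\<lambda>(j, k). y [v, j, k])}" for E
  have A_sets: "A E \<in> sets (exponential_product L)" for E unfolding A_def by (rule sets_greedy_graph)
  have B_sets: "B E \<in> sets (exponential_product R)" for E
    unfolding B_def by (rule sets_costly) (auto simp: split_def intro: measurable_exponential_component)
  define Q where "Q E = {C \<in> space (exponential_product (L \<union> R)). restrict C L \<in> A E \<and> restrict C R \<in> B E}" for E
  have ind: "Q E \<in> sets (exponential_product (L \<union> R))"
    "measure (exponential_product (L \<union> R)) (Q E) = measure (exponential_product L) (A E) * measure (exponential_product R) (B E)" for E
    unfolding Q_def by (rule exponential_product_independent[OF LR(1) fin A_sets B_sets])+
  have "S = (\<Union>E\<in>Gs. Q E)"
  proof -
    have "C \<in> S \<longleftrightarrow> (\<exists>E\<in>Gs. C \<in> Q E)" if C: "C \<in> space (exp_array 3 n)" for C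
    proof -
      \<comment> \<open>\<open>restrict C L\<close> is \<open>undefined\<close> at the levels from
        \<open>v\<close> on, which cannot influence the graph before level \<open>v\<close>.\<close>
      have G: "greedy_graph n v (restrict C L) = greedy_graph n v C"
        using \<open>v < n\<close> by (intro greedy_online) (auto simp: L_def)
      have rest: "restrict C L \<in> space (exponential_product L)" "restrict C R \<in> space (exponential_product R)"
        by (simp_all add: space_PiM)
      have "costly n E z (\<lambda>(j, k). restrict C R [v, j, k]) = costly n E z (\<lambda>(j, k). C [v, j, k])" if "E \<in> Gs" for E
      proof -
        have "(\<Sum>j<n. restrict C R [v, j, M j]) = (\<Sum>j<n. C [v, j, M j])" if "perfect_matching n E M" for M
          using that \<open>E \<in> Gs\<close> \<open>v < n\<close>
          by (intro sum.cong) (auto simp: perfect_matching_def Gs_def R_def positions_def)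
        then show ?thesis by (auto simp: costly_def)
      qed
      moreover have "greedy_graph n v C \<in> Gs" by (auto simp: greedy_graph_def Gs_def)
      ultimately show ?thesis
        using C rest G by (auto simp: S_def Q_def A_def B_def LR(2) exp_array_def z_def)
    qed
    moreover have "S \<subseteq> space (exp_array 3 n)" "Q E \<subseteq> space (exp_array 3 n)" for E
      by (auto simp: S_def Q_def LR(2) exp_array_def)
    ultimately show ?thesis by blast
  qed
  have sets_eq: "exponential_product (L \<union> R) = exp_array 3 n" by (simp add: LR(2) exp_array_def)
  show "S \<in> sets (exp_array 3 n)"
    unfolding \<open>S = _\<close> using finGs ind(1) by (intro sets.finite_UN) (auto simp: sets_eq)
  interpret P: prob_space "exp_array 3 n" by (rule prob_space_exp_array)
  interpret PL: prob_space "exponential_product L" by (rule prob_space_exponential_product[OF fin(1)])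
  have PB: "measure (exponential_product R) (B E) \<le> (1 / 4) ^ n" if reg: "regular_graph n (n - v) E" for E
  proof -
    \<comment> \<open>Edges as positions at level \<open>v\<close>: the costs on \<open>E\<close>
      are a reindexed part of the product, hence again independent \<open>Exp(1)\<close>
      variables.\<close>
    define f where "f = (\<lambda>(j, k). [v, j, k :: nat])"
    have E: "E \<subseteq> {..<n} \<times> {..<n}" using reg by (simp add: regular_graph_def)
    have f: "inj_on f E" "f \<in> E \<rightarrow> R"
      using E \<open>v < n\<close> by (auto simp: f_def inj_on_def R_def positions_def)
    define W where "W = {c \<in> space (exponential_product E). costly n E z c}"
    have W: "W \<in> sets (exponential_product E)"
      unfolding W_def by (rule sets_costly) (rule measurable_exponential_component)
    have meas: "(\<lambda>\<omega>. \<lambda>e\<in>E. \<omega> (f e)) \<in> measurable (exponential_product R) (exponential_product E)"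
      using f by (intro measurable_restrict) (auto intro!: measurable_exponential_component)
    have "measure (exponential_product E) W =
        measure (distr (exponential_product R) (exponential_product E) (\<lambda>\<omega>. \<lambda>e\<in>E. \<omega> (f e))) W"
      using distr_PiM_reindex[of R "\<lambda>_. exponential_measure 1" f E] f prob_space_exponential_density[of 1] by simp
    also have "\<dots> = measure (exponential_product R) ((\<lambda>\<omega>. \<lambda>e\<in>E. \<omega> (f e)) -` W \<inter> space (exponential_product R))"
      by (rule measure_distr[OF meas W])
    also have "(\<lambda>\<omega>. \<lambda>e\<in>E. \<omega> (f e)) -` W \<inter> space (exponential_product R) = B E"
    proof -
      have "costly n E z (\<lambda>e\<in>E. y (f e)) = costly n E z (\<lambda>(j, k). y [v, j, k])" for y
        by (auto simp: costly_def perfect_matching_def f_def)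
      then show ?thesis using measurable_space[OF meas] by (auto simp: W_def B_def)
    qed
    finally have "measure (exponential_product R) (B E) = measure (exponential_product E) W" ..
    also have "\<dots> \<le> (1 / 4) ^ n"
      using matching_cost_tail[OF reg _ optimal_dual_exists[OF reg]] \<open>v < n\<close>
      by (simp add: W_def costly_def z_def)
    finally show ?thesis .
  qed
  have "measure (exp_array 3 n) S \<le> (\<Sum>E\<in>Gs. measure (exp_array 3 n) (Q E))"
    unfolding \<open>S = _\<close> using finGs ind(1) by (intro P.finite_measure_subadditive_finite) (auto simp: sets_eq)
  also have "\<dots> = (\<Sum>E\<in>Gs. measure (exponential_product L) (A E) * measure (exponential_product R) (B E))"
    using ind(2) by (simp add: sets_eq)
  also have "\<dots> \<le> (\<Sum>E\<in>Gs. measure (exponential_product L) (A E) * (1 / 4) ^ n)"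
  proof (rule sum_mono)
    fix E assume "E \<in> Gs"
    show "measure (exponential_product L) (A E) * measure (exponential_product R) (B E)
        \<le> measure (exponential_product L) (A E) * (1 / 4) ^ n"
    proof (cases "regular_graph n (n - v) E")
      case True
      then show ?thesis by (intro mult_left_mono PB) auto
    next
      case False
      \<comment> \<open>An irregular graph never arises at the start of a level, so its term
        vanishes.\<close>
      then have "A E = {}" using regular_greedy_graph[of v n] \<open>v < n\<close> by (auto simp: A_def)
      then show ?thesis by simp
    qed
  qed
  also have "\<dots> = (\<Sum>E\<in>Gs. measure (exponential_product L) (A E)) * (1 / 4) ^ n"
    by (simp add: sum_distrib_right)
  also have "(\<Sum>E\<in>Gs. measure (exponential_product L) (A E)) = measure (exponential_product L) (\<Union>E\<in>Gs. A E)"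
    using finGs A_sets by (intro PL.finite_measure_finite_Union[symmetric]) (auto simp: disjoint_family_on_def A_def)
  also have "\<dots> * (1 / 4) ^ n \<le> 1 * (1 / 4) ^ n"
    by (intro mult_right_mono PL.prob_le_1) auto
  finally show "measure (exp_array 3 n) S \<le> (1 / 4) ^ n" by simp
qed

text \<open>\<open>harm - ln\<close> is decreasing and has the value 1 at 1.\<close>

lemma harm_le_one_plus_ln: "0 < n \<Longrightarrow> harm n \<le> 1 + ln (real n)"
  using decseqD[OF decseq_harm_diff_ln, of 0 "n - 1"] by (simp add: harm_expand)

lemma greedy_cost_le:
  assumes "3 \<le> n"
    and good: "\<And>v. v < n \<Longrightarrow> \<not> costly n (greedy_graph n v C) (10 * real n / real (n - v)) (\<lambda>(j, k). C [v, j, k])"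
  shows "assignment_cost 3 n C (greedy n C) \<le> 20 * (real n * ln (real n))"
proof -
  obtain \<pi> where bij: "\<And>i. i < n \<Longrightarrow> bij_betw (\<pi> i) {..<n} {..<n}"
    and X: "\<And>ix. greedy n C ix = of_bool (\<exists>i<n. \<exists>j<n. ix = [i, j, \<pi> i j])"
    and opt: "\<And>v. v < n \<Longrightarrow> level_optimal n C \<pi> v"
    by (rule greedy_spec[of n C]) blast
  have lt: "\<pi> i j < n" if "i < n" "j < n" for i j
    using bij_betw_apply[OF bij[OF that(1)], of j] that by simp
  have "(\<Sum>j<n. C [v, j, \<pi> v j]) \<le> 10 * real n / real (n - v)" if v: "v < n" for v
  proof -
    obtain M where M: "perfect_matching n (greedy_graph n v C) M" "(\<Sum>j<n. C [v, j, M j]) \<le> 10 * real n / real (n - v)"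
      using good[OF v] by (auto simp: costly_def not_less)
    then show ?thesis
      using opt[OF v] greedy_graph_eq[OF X, of v] v by (auto simp: level_optimal_def intro: order_trans)
  qed
  then have "assignment_cost 3 n C (greedy n C) \<le> (\<Sum>v<n. 10 * real n / real (n - v))"
    by (subst greedy_cost[OF X lt]) (auto intro: sum_mono)
  also have "\<dots> = 10 * real n * (\<Sum>v<n. inverse (real (n - v)))"
    by (simp add: sum_distrib_left divide_inverse)
  also have "(\<Sum>v<n. inverse (real (n - v))) = harm n"
    unfolding harm_altdef by (subst sum.nat_diff_reindex[symmetric]) (auto intro!: sum.cong simp: Suc_diff_Suc)
  \<comment> \<open>\<open>n >= 3 >= exp 1\<close> gives \<open>ln n >= 1\<close>, so
    \<open>1 + ln n\<close> is absorbed into \<open>2 * ln n\<close>; this turns 10 into 20.\<close>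
  also have "10 * real n * harm n \<le> 10 * real n * (2 * ln (real n))"
  proof (rule mult_left_mono)
    have "exp 1 \<le> real n" using exp_le assms(1) by simp
    then have "1 \<le> ln (real n)" using assms(1) by (subst ln_ge_iff) auto
    then show "harm n \<le> 2 * ln (real n)" using harm_le_one_plus_ln[of n] assms(1) by simp
  qed simp
  finally show ?thesis by simp
qed

text \<open>Union bound over the \<open>n\<close> levels: some level is costly with probability at
  most \<open>n\<close> times \<open>(1 / 4) ^ n\<close>.\<close>

lemma greedy_cost_whp:
  "(\<lambda>n. \<P>(C in exp_array 3 n. assignment_cost 3 n C (greedy n C) \<le> 20 * (real n * ln (real n)))) \<longlonglongrightarrow> 1"
proof (rule tendsto_sandwich)
  show "\<forall>\<^sub>F n in sequentially. 1 - real n * (1 / 4) ^ n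
     \<le> \<P>(C in exp_array 3 n. assignment_cost 3 n C (greedy n C) \<le> 20 * (real n * ln (real n)))"
  proof (rule eventually_sequentiallyI)
    fix n :: nat assume "3 \<le> n"
    interpret prob_space "exp_array 3 n" by (rule prob_space_exp_array)
    define S where "S v = {C \<in> space (exp_array 3 n).
      costly n (greedy_graph n v C) (10 * real n / real (n - v)) (\<lambda>(j, k). C [v, j, k])}" for v
    let ?good = "{C \<in> space (exp_array 3 n). assignment_cost 3 n C (greedy n C) \<le> 20 * (real n * ln (real n))}"
    have "(\<lambda>C. real (greedy n C ix)) \<in> borel_measurable (exp_array 3 n)" for ix
      unfolding exp_array_def by (rule measurable_compose[OF measurable_greedy]) simp
    then have "(\<lambda>C. assignment_cost 3 n C (greedy n C)) \<in> borel_measurable (exp_array 3 n)"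
      unfolding assignment_cost_def by (intro borel_measurable_sum borel_measurable_times) auto
    then have good: "?good \<in> events" by simp
    have S: "S v \<in> events" "prob (S v) \<le> (1 / 4) ^ n" if "v < n" for v
      using greedy_level_tail[OF that] by (simp_all add: S_def)
    have "1 - real n * (1 / 4) ^ n \<le> 1 - (\<Sum>v<n. prob (S v))"
      using sum_mono[of "{..<n}" "\<lambda>v. prob (S v)" "\<lambda>_. (1 / 4) ^ n"] S(2) by simp
    also have "\<dots> \<le> 1 - prob (\<Union>v<n. S v)"
      using finite_measure_subadditive_finite[of "{..<n}" S] S(1) by auto
    also have "\<dots> = prob (space (exp_array 3 n) - (\<Union>v<n. S v))"
      using S(1) by (intro prob_compl[symmetric] sets.finite_UN) auto
    also have "\<dots> \<le> prob ?good"
    proof (rule finite_measure_mono[OF _ good])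
      show "space (exp_array 3 n) - (\<Union>v<n. S v) \<subseteq> ?good"
        using greedy_cost_le[OF \<open>3 \<le> n\<close>] by (auto simp: S_def)
    qed
    finally show "1 - real n * (1 / 4) ^ n \<le> prob ?good" .
  qed
  show "\<forall>\<^sub>F n in sequentially. \<P>(C in exp_array 3 n. assignment_cost 3 n C (greedy n C) \<le> 20 * (real n * ln (real n))) \<le> 1"
    using prob_space.prob_le_1[OF prob_space_exp_array] by simp
  have "(\<lambda>n. real n * (1 / 4) ^ n) \<longlonglongrightarrow> 0"
    using powser_times_n_limit_0[of "1 / 4 :: real"] by simp
  then show "(\<lambda>n. 1 - real n * (1 / 4) ^ n) \<longlonglongrightarrow> 1"
    using tendsto_diff[OF tendsto_const[of "1 :: real"]] by fastforce
qed simp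

theorem theorem3:
  "(\<forall>d::nat. d \<ge> 3 \<longrightarrow>
     (\<exists>c>0. (\<lambda>n. \<P>(C in exp_array d n. axial_min d n C \<ge> c * real n ^ (d - 2))) \<longlonglongrightarrow> 1)) \<and>
   (\<exists>A. poly_time_algorithm 3 A \<and>
     (\<forall>n C. axial_assignment 3 n (A n C)) \<and>
     (\<exists>K. (\<lambda>n. \<P>(C in exp_array 3 n.
            assignment_cost 3 n C (A n C) \<le> K * (real n * ln (real n)))) \<longlonglongrightarrow> 1))"
proof (intro conjI allI impI)
  fix d :: nat assume "d \<ge> 3"
  then show "\<exists>c>0. (\<lambda>n. \<P>(C in exp_array d n. axial_min d n C \<ge> c * real n ^ (d - 2))) \<longlonglongrightarrow> 1"
    by (intro exI[of _ "1/4"] conjI axial_min_lower_bound_whp) simp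
next
  show "\<exists>A. poly_time_algorithm 3 A \<and> (\<forall>n C. axial_assignment 3 n (A n C)) \<and>
     (\<exists>K. (\<lambda>n. \<P>(C in exp_array 3 n.
            assignment_cost 3 n C (A n C) \<le> K * (real n * ln (real n)))) \<longlonglongrightarrow> 1)"
    using poly_time_greedy axial_assignment_greedy greedy_cost_whp by blast
qed

end
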